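(* Let $k$ be a non-zero commutative ring, $G$ a finite group, $\mathcal{O}=\mathcal{O}_k(G)$, $\sigma$ a lazy two-cocycle of $\mathcal{O}$, and $A$ a right $G$-algebra (equivalently a left $\mathcal{O}$-comodule algebra). Regard ${}_\sigma\mathcal{O}\otimes A$ (tensor product of algebras) as a right $G$-algebra by $(e_g\otimes a)\cdot h=e_{gh}\otimes a\cdot h$, and let $A'=({}_\sigma\mathcal{O}\otimes A)^G$ be the algebra of $G$-invariants, which is itself a right $G$-algebra by $(e_g\otimes a)\cdot h=e_{h^{-1}g}\otimes a$. Then $A'\cong{}_\sigma A$ as right $G$-algebras.
   Context: $\mathcal{O}_k(G)$ is the Hopf algebra of $k$-valued functions on $G$, with basis the Dirac functions $e_g$ ($g\in G$), dual to the Hopf algebra $k[G]$; a right $G$-algebra (a $k$-algebra with a right action of $G$ by algebra automorphisms) is the same as a left $\mathcal{O}$-comodule algebra, with coaction $a\mapsto\sum_{g\in G}e_g\otimes a\cdot g$. A two-cocycle of a Hopf algebra $H$ is a convolution-invertible bilinear form $\sigma:H\times H\to k$ with $\sum\sigma(x_1,y_1)\sigma(x_2y_2,z)=\sum\sigma(y_1,z_1)\sigma(x,y_2z_2)$; it is lazy if $\sum\sigma(x_1,y_1)x_2y_2=\sum\sigma(x_2,y_2)x_1y_1$. For a left $H$-comodule algebra $A$, with coaction $a\mapsto\sum a_{-1}\otimes a_0$, and $\sigma$ lazy, ${}_\sigma A$ is the left $H$-comodule algebra with underlying comodule $A$ and product $a*_\sigma b=\sum\sigma(a_{-1},b_{-1})a_0b_0$.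 In particular ${}_\sigma\mathcal{O}$ is $\mathcal{O}$ with the product $x*_\sigma y=\sum\sigma(x_1,y_1)x_2y_2$; it is an $(\mathcal{O},\mathcal{O})$-bicomodule algebra. *)

theory Defs
  imports "HOL-Algebra.Module" "HOL-Algebra.QuotRing"
begin

section \<open>Associative unital algebras and right \<open>G\<close>-algebras\<close>

text \<open>The library locale \<open>algebra\<close> is restricted to commutative algebras.\<close>

locale assoc_algebra = module R A + ring A
  for R :: "('r, 'm) ring_scheme" and A :: "('r, 'a, 'n) module_scheme" +
  assumes smult_mult_left:
      "r \<in> carrier R \<Longrightarrow> a \<in> carrier A \<Longrightarrow> b \<in> carrier A \<Longrightarrow>
        (r \<odot>\<^bsub>A\<^esub> a) \<otimes>\<^bsub>A\<^esub> b = r \<odot>\<^bsub>A\<^esub> (a \<otimes>\<^bsub>A\<^esub> b)"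
    and smult_mult_right:
      "r \<in> carrier R \<Longrightarrow> a \<in> carrier A \<Longrightarrow> b \<in> carrier A \<Longrightarrow>
        a \<otimes>\<^bsub>A\<^esub> (r \<odot>\<^bsub>A\<^esub> b) = r \<odot>\<^bsub>A\<^esub> (a \<otimes>\<^bsub>A\<^esub> b)"

definition algebra_iso ::
  "('r, 'm) ring_scheme \<Rightarrow> ('r, 'a, 'n) module_scheme \<Rightarrow> ('r, 'b, 'p) module_scheme \<Rightarrow> ('a \<Rightarrow> 'b) set" where
  "algebra_iso R A B =
    {f \<in> ring_iso A B. \<forall>r\<in>carrier R. \<forall>a\<in>carrier A. f (r \<odot>\<^bsub>A\<^esub> a) = r \<odot>\<^bsub>B\<^esub> f a}"

locale right_G_algebra = A: assoc_algebra R A + G: group G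
  for R :: "('r, 'm) ring_scheme" and G :: "('g, 'q) monoid_scheme"
    and A :: "('r, 'a, 'n) module_scheme" and act :: "'a \<Rightarrow> 'g \<Rightarrow> 'a" +
  assumes act_automorphism: "g \<in> carrier G \<Longrightarrow> (\<lambda>a. act a g) \<in> algebra_iso R A A"
    and act_one: "a \<in> carrier A \<Longrightarrow> act a \<one>\<^bsub>G\<^esub> = a"
    and act_mult: "a \<in> carrier A \<Longrightarrow> g \<in> carrier G \<Longrightarrow> h \<in> carrier G \<Longrightarrow>
        act a (g \<otimes>\<^bsub>G\<^esub> h) = act (act a g) h"

definition G_algebra_iso ::
  "('r, 'm) ring_scheme \<Rightarrow> ('g, 'q) monoid_scheme \<Rightarrow> ('r, 'a, 'n) module_scheme \<Rightarrow> ('a \<Rightarrow> 'g \<Rightarrow> 'a) \<Rightarrow>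
   ('r, 'b, 'p) module_scheme \<Rightarrow> ('b \<Rightarrow> 'g \<Rightarrow> 'b) \<Rightarrow> ('a \<Rightarrow> 'b) set" where
  "G_algebra_iso R G A actA B actB =
    {f \<in> algebra_iso R A B. \<forall>a\<in>carrier A. \<forall>g\<in>carrier G. f (actA a g) = actB (f a) g}"

definition invariants ::
  "('r, 'a, 'n) module_scheme \<Rightarrow> ('g, 'q) monoid_scheme \<Rightarrow> ('a \<Rightarrow> 'g \<Rightarrow> 'a) \<Rightarrow> ('r, 'a, 'n) module_scheme" where
  "invariants A G act = A\<lparr>carrier := {a \<in> carrier A. \<forall>g\<in>carrier G. act a g = a}\<rparr>"


section \<open>Tensor products\<close>

text \<open>
  \<open>M \<otimes> N\<close> over \<open>R\<close> is the quotient of the formal finite sums of pairs, represented by lists, by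
  the congruence generated by commutativity of the sum and by bilinearity. A list
  \<open>[(m1, n1), \<dots>, (mr, nr)]\<close> represents \<open>m1 \<otimes> n1 + \<dots> + mr \<otimes> nr\<close>. Additive inverses need no
  formal counterpart: the class of \<open>(-m, n)\<close> is inverse to that of \<open>(m, n)\<close>.
\<close>

inductive_set tensor_rel ::
  "('r, 'm) ring_scheme \<Rightarrow> ('r, 'a, 'n) module_scheme \<Rightarrow> ('r, 'b, 'p) module_scheme \<Rightarrow>
   (('a \<times> 'b) list \<times> ('a \<times> 'b) list) set"
  for R :: "('r, 'm) ring_scheme" and M :: "('r, 'a, 'n) module_scheme" and N :: "('r, 'b, 'p) module_scheme"
where
  refl: "u \<in> lists (carrier M \<times> carrier N) \<Longrightarrow> (u, u) \<in> tensor_rel R M N"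
| sym: "(u, v) \<in> tensor_rel R M N \<Longrightarrow> (v, u) \<in> tensor_rel R M N"
| trans: "(u, v) \<in> tensor_rel R M N \<Longrightarrow> (v, w) \<in> tensor_rel R M N \<Longrightarrow> (u, w) \<in> tensor_rel R M N"
| append: "(u, v) \<in> tensor_rel R M N \<Longrightarrow> (u', v') \<in> tensor_rel R M N \<Longrightarrow>
    (u @ u', v @ v') \<in> tensor_rel R M N"
| comm: "u \<in> lists (carrier M \<times> carrier N) \<Longrightarrow> v \<in> lists (carrier M \<times> carrier N) \<Longrightarrow>
    (u @ v, v @ u) \<in> tensor_rel R M N"
| zero: "n \<in> carrier N \<Longrightarrow> ([(\<zero>\<^bsub>M\<^esub>, n)], []) \<in> tensor_rel R M N"
| add_left: "m \<in> carrier M \<Longrightarrow> m' \<in> carrier M \<Longrightarrow> n \<in> carrier N \<Longrightarrow>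
    ([(m \<oplus>\<^bsub>M\<^esub> m', n)], [(m, n), (m', n)]) \<in> tensor_rel R M N"
| add_right: "m \<in> carrier M \<Longrightarrow> n \<in> carrier N \<Longrightarrow> n' \<in> carrier N \<Longrightarrow>
    ([(m, n \<oplus>\<^bsub>N\<^esub> n')], [(m, n), (m, n')]) \<in> tensor_rel R M N"
| smult: "r \<in> carrier R \<Longrightarrow> m \<in> carrier M \<Longrightarrow> n \<in> carrier N \<Longrightarrow>
    ([(r \<odot>\<^bsub>M\<^esub> m, n)], [(m, r \<odot>\<^bsub>N\<^esub> n)]) \<in> tensor_rel R M N"

definition tensor_class ::
  "('r, 'm) ring_scheme \<Rightarrow> ('r, 'a, 'n) module_scheme \<Rightarrow> ('r, 'b, 'p) module_scheme \<Rightarrow>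
   ('a \<times> 'b) list \<Rightarrow> ('a \<times> 'b) list set" where
  "tensor_class R M N u = tensor_rel R M N `` {u}"

abbreviation pure_tensor ::
  "('r, 'm) ring_scheme \<Rightarrow> ('r, 'a, 'n) module_scheme \<Rightarrow> ('r, 'b, 'p) module_scheme \<Rightarrow>
   'a \<Rightarrow> 'b \<Rightarrow> ('a \<times> 'b) list set" where
  "pure_tensor R M N m n \<equiv> tensor_class R M N [(m, n)]"

definition tensor ::
  "('r, 'm) ring_scheme \<Rightarrow> ('r, 'a, 'n) module_scheme \<Rightarrow> ('r, 'b, 'p) module_scheme \<Rightarrow>
   ('r, ('a \<times> 'b) list set) module" where
  "tensor R M N =
    \<lparr>carrier = lists (carrier M \<times> carrier N) // tensor_rel R M N,
     mult = (\<lambda>s t. \<Union>u\<in>s. \<Union>v\<in>t.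
       tensor_class R M N [(m \<otimes>\<^bsub>M\<^esub> m', n \<otimes>\<^bsub>N\<^esub> n'). (m, n) \<leftarrow> u, (m', n') \<leftarrow> v]),
     one = pure_tensor R M N \<one>\<^bsub>M\<^esub> \<one>\<^bsub>N\<^esub>,
     zero = tensor_class R M N [],
     add = (\<lambda>s t. \<Union>u\<in>s. \<Union>v\<in>t. tensor_class R M N (u @ v)),
     smult = (\<lambda>r t. \<Union>u\<in>t. tensor_class R M N [(r \<odot>\<^bsub>M\<^esub> m, n). (m, n) \<leftarrow> u])\<rparr>"

text \<open>The endomorphism \<open>f \<otimes> g\<close> of \<open>M \<otimes> N\<close>, for linear endomorphisms \<open>f\<close> of \<open>M\<close> and \<open>g\<close> of \<open>N\<close>.\<close>

definition tensor_map ::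
  "('r, 'm) ring_scheme \<Rightarrow> ('r, 'a, 'n) module_scheme \<Rightarrow> ('r, 'b, 'p) module_scheme \<Rightarrow>
   ('a \<Rightarrow> 'a) \<Rightarrow> ('b \<Rightarrow> 'b) \<Rightarrow> ('a \<times> 'b) list set \<Rightarrow> ('a \<times> 'b) list set" where
  "tensor_map R M N f g t = (\<Union>u\<in>t. tensor_class R M N [(f m, g n). (m, n) \<leftarrow> u])"

text \<open>
  The value at \<open>t\<close> of the linear map to \<open>P\<close> induced by a bilinear map \<open>f\<close>. This is Sweedler
  notation: \<open>\<Sum> f x\<^sub>1 x\<^sub>2\<close> is \<open>sweedler P f (\<Delta> x)\<close>. For bilinear \<open>f\<close> all representatives of \<open>t\<close>
  give the same sum, which is the unique element extracted by \<open>the_elem\<close>.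
\<close>

definition sweedler ::
  "('c, 'm) ring_scheme \<Rightarrow> ('a \<Rightarrow> 'b \<Rightarrow> 'c) \<Rightarrow> ('a \<times> 'b) list set \<Rightarrow> 'c" where
  "sweedler P f t =
    the_elem ((\<lambda>u. foldr (\<lambda>(m, n) s. f m n \<oplus>\<^bsub>P\<^esub> s) u \<zero>\<^bsub>P\<^esub>) ` t)"


section \<open>Hopf algebras, lazy two-cocycles and twists\<close>

record ('r, 'h) hopf = "('r, 'h) module" +
  comult :: "'h \<Rightarrow> ('h \<times> 'h) list set"
  counit :: "'h \<Rightarrow> 'r"
  antipode :: "'h \<Rightarrow> 'h"

definition bilinear_form ::
  "('r, 'm) ring_scheme \<Rightarrow> ('r, 'h, 'n) module_scheme \<Rightarrow> ('h \<Rightarrow> 'h \<Rightarrow> 'r) \<Rightarrow> bool" where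
  "bilinear_form R H \<sigma> \<longleftrightarrow>
    (\<forall>x\<in>carrier H. \<forall>y\<in>carrier H. \<sigma> x y \<in> carrier R) \<and>
    (\<forall>x\<in>carrier H. \<forall>x'\<in>carrier H. \<forall>y\<in>carrier H.
       \<sigma> (x \<oplus>\<^bsub>H\<^esub> x') y = \<sigma> x y \<oplus>\<^bsub>R\<^esub> \<sigma> x' y \<and> \<sigma> y (x \<oplus>\<^bsub>H\<^esub> x') = \<sigma> y x \<oplus>\<^bsub>R\<^esub> \<sigma> y x') \<and>
    (\<forall>r\<in>carrier R. \<forall>x\<in>carrier H. \<forall>y\<in>carrier H.
       \<sigma> (r \<odot>\<^bsub>H\<^esub> x) y = r \<otimes>\<^bsub>R\<^esub> \<sigma> x y \<and> \<sigma> x (r \<odot>\<^bsub>H\<^esub> y) = r \<otimes>\<^bsub>R\<^esub> \<sigma> x y)"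

definition convolution ::
  "('r, 'm) ring_scheme \<Rightarrow> ('r, 'h, 'n) hopf_scheme \<Rightarrow> ('h \<Rightarrow> 'h \<Rightarrow> 'r) \<Rightarrow> ('h \<Rightarrow> 'h \<Rightarrow> 'r) \<Rightarrow> 'h \<Rightarrow> 'h \<Rightarrow> 'r" where
  "convolution R H \<sigma> \<tau> x y =
    sweedler R (\<lambda>x1 x2. sweedler R (\<lambda>y1 y2. \<sigma> x1 y1 \<otimes>\<^bsub>R\<^esub> \<tau> x2 y2) (comult H y)) (comult H x)"

definition convolution_invertible ::
  "('r, 'm) ring_scheme \<Rightarrow> ('r, 'h, 'n) hopf_scheme \<Rightarrow> ('h \<Rightarrow> 'h \<Rightarrow> 'r) \<Rightarrow> bool" where
  "convolution_invertible R H \<sigma> \<longleftrightarrow>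
    (\<exists>\<tau>. bilinear_form R H \<tau> \<and> (\<forall>x\<in>carrier H. \<forall>y\<in>carrier H.
       convolution R H \<sigma> \<tau> x y = counit H x \<otimes>\<^bsub>R\<^esub> counit H y \<and>
       convolution R H \<tau> \<sigma> x y = counit H x \<otimes>\<^bsub>R\<^esub> counit H y))"

definition two_cocycle ::
  "('r, 'm) ring_scheme \<Rightarrow> ('r, 'h, 'n) hopf_scheme \<Rightarrow> ('h \<Rightarrow> 'h \<Rightarrow> 'r) \<Rightarrow> bool" where
  "two_cocycle R H \<sigma> \<longleftrightarrow>
    bilinear_form R H \<sigma> \<and> convolution_invertible R H \<sigma> \<and>
    (\<forall>x\<in>carrier H. \<forall>y\<in>carrier H. \<forall>z\<in>carrier H.
       sweedler R (\<lambda>x1 x2. sweedler R (\<lambda>y1 y2. \<sigma> x1 y1 \<otimes>\<^bsub>R\<^esub> \<sigma> (x2 \<otimes>\<^bsub>H\<^esub> y2) z) (comult H y)) (comult H x) =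
       sweedler R (\<lambda>y1 y2. sweedler R (\<lambda>z1 z2. \<sigma> y1 z1 \<otimes>\<^bsub>R\<^esub> \<sigma> x (y2 \<otimes>\<^bsub>H\<^esub> z2)) (comult H z)) (comult H y))"

definition lazy ::
  "('r, 'm) ring_scheme \<Rightarrow> ('r, 'h, 'n) hopf_scheme \<Rightarrow> ('h \<Rightarrow> 'h \<Rightarrow> 'r) \<Rightarrow> bool" where
  "lazy R H \<sigma> \<longleftrightarrow>
    (\<forall>x\<in>carrier H. \<forall>y\<in>carrier H.
       sweedler H (\<lambda>x1 x2. sweedler H (\<lambda>y1 y2. \<sigma> x1 y1 \<odot>\<^bsub>H\<^esub> (x2 \<otimes>\<^bsub>H\<^esub> y2)) (comult H y)) (comult H x) =
       sweedler H (\<lambda>x1 x2. sweedler H (\<lambda>y1 y2. \<sigma> x2 y2 \<odot>\<^bsub>H\<^esub> (x1 \<otimes>\<^bsub>H\<^esub> y1)) (comult H y)) (comult H x))"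

text \<open>
  The twist of an algebra \<open>A\<close> with left coaction \<open>\<rho>\<close> by the two-cocycle \<open>\<sigma>\<close>. Two-cocycles are not
  assumed to be normalized, so the unit of the twisted product is in general not that of \<open>A\<close> but
  \<open>\<sigma>(1,1)\<^sup>-\<^sup>1 1\<close>; it is described here as the neutral element of the twisted product.
\<close>

definition twist_mult ::
  "('h \<Rightarrow> 'h \<Rightarrow> 'r) \<Rightarrow> ('r, 'a, 'n) module_scheme \<Rightarrow> ('a \<Rightarrow> ('h \<times> 'a) list set) \<Rightarrow> 'a \<Rightarrow> 'a \<Rightarrow> 'a" where
  "twist_mult \<sigma> A \<rho> a b =
    sweedler A (\<lambda>x a0. sweedler A (\<lambda>y b0. \<sigma> x y \<odot>\<^bsub>A\<^esub> (a0 \<otimes>\<^bsub>A\<^esub> b0)) (\<rho> b)) (\<rho> a)"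

definition twist ::
  "('h \<Rightarrow> 'h \<Rightarrow> 'r) \<Rightarrow> ('r, 'a, 'n) module_scheme \<Rightarrow> ('a \<Rightarrow> ('h \<times> 'a) list set) \<Rightarrow> ('r, 'a, 'n) module_scheme" where
  "twist \<sigma> A \<rho> =
    A\<lparr>mult := twist_mult \<sigma> A \<rho>,
      one := (THE u. u \<in> carrier A \<and>
        (\<forall>a\<in>carrier A. twist_mult \<sigma> A \<rho> u a = a \<and> twist_mult \<sigma> A \<rho> a u = a))\<rparr>"


section \<open>The Hopf algebra of functions on a finite group\<close>

definition dirac :: "('k, 'm) ring_scheme \<Rightarrow> ('g, 'q) monoid_scheme \<Rightarrow> 'g \<Rightarrow> 'g \<Rightarrow> 'k" where
  "dirac k G g = (\<lambda>x\<in>carrier G. if x = g then \<one>\<^bsub>k\<^esub> else \<zero>\<^bsub>k\<^esub>)"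

definition fun_algebra ::
  "('k, 'm) ring_scheme \<Rightarrow> ('g, 'q) monoid_scheme \<Rightarrow> ('k, 'g \<Rightarrow> 'k) module" where
  "fun_algebra k G =
    \<lparr>carrier = carrier G \<rightarrow>\<^sub>E carrier k,
     mult = (\<lambda>u v. \<lambda>x\<in>carrier G. u x \<otimes>\<^bsub>k\<^esub> v x),
     one = (\<lambda>x\<in>carrier G. \<one>\<^bsub>k\<^esub>),
     zero = (\<lambda>x\<in>carrier G. \<zero>\<^bsub>k\<^esub>),
     add = (\<lambda>u v. \<lambda>x\<in>carrier G. u x \<oplus>\<^bsub>k\<^esub> v x),
     smult = (\<lambda>r u. \<lambda>x\<in>carrier G. r \<otimes>\<^bsub>k\<^esub> u x)\<rparr>"

text \<open>
  The comultiplication is dual to the product of \<open>k[G]\<close>: under the identification of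
  \<open>\<O> \<otimes> \<O>\<close> with the functions on \<open>G \<times> G\<close>, the tensor \<open>\<Delta> u\<close> is the function \<open>(g, h) \<mapsto> u (g h)\<close>.
\<close>

definition fun_comult ::
  "('k, 'm) ring_scheme \<Rightarrow> ('g, 'q) monoid_scheme \<Rightarrow> ('g \<Rightarrow> 'k) \<Rightarrow> (('g \<Rightarrow> 'k) \<times> ('g \<Rightarrow> 'k)) list set" where
  "fun_comult k G u =
    (let F = fun_algebra k G; T = tensor k F F in
     \<Oplus>\<^bsub>T\<^esub> g\<in>carrier G. \<Oplus>\<^bsub>T\<^esub> h\<in>carrier G.
       u (g \<otimes>\<^bsub>G\<^esub> h) \<odot>\<^bsub>T\<^esub> pure_tensor k F F (dirac k G g) (dirac k G h))"

definition fun_hopf ::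
  "('k, 'm) ring_scheme \<Rightarrow> ('g, 'q) monoid_scheme \<Rightarrow> ('k, 'g \<Rightarrow> 'k) hopf" where
  "fun_hopf k G = module.extend (fun_algebra k G)
    \<lparr>comult = fun_comult k G,
     counit = (\<lambda>u. u \<one>\<^bsub>G\<^esub>),
     antipode = (\<lambda>u. \<lambda>x\<in>carrier G. u (inv\<^bsub>G\<^esub> x))\<rparr>"

text \<open>The linear maps \<open>e\<^sub>g \<mapsto> e\<^sub>g\<^sub>h\<close> and \<open>e\<^sub>g \<mapsto> e\<^sub>h\<^sub>'\<^sub>g\<close>, where \<open>h'\<close> is the inverse of \<open>h\<close>.\<close>

definition translate_right :: "('g, 'q) monoid_scheme \<Rightarrow> 'g \<Rightarrow> ('g \<Rightarrow> 'k) \<Rightarrow> 'g \<Rightarrow> 'k" where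
  "translate_right G h u = (\<lambda>x\<in>carrier G. u (x \<otimes>\<^bsub>G\<^esub> inv\<^bsub>G\<^esub> h))"

definition translate_left :: "('g, 'q) monoid_scheme \<Rightarrow> 'g \<Rightarrow> ('g \<Rightarrow> 'k) \<Rightarrow> 'g \<Rightarrow> 'k" where
  "translate_left G h u = (\<lambda>x\<in>carrier G. u (h \<otimes>\<^bsub>G\<^esub> x))"

lemma translate_right_dirac:
  assumes "group G" "g \<in> carrier G" "h \<in> carrier G"
  shows "translate_right G h (dirac k G g) = dirac k G (g \<otimes>\<^bsub>G\<^esub> h)"
proof -
  interpret group G by fact
  have "x \<otimes>\<^bsub>G\<^esub> inv\<^bsub>G\<^esub> h = g \<longleftrightarrow> x = g \<otimes>\<^bsub>G\<^esub> h" if "x \<in> carrier G" for x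
    using assms that by (metis inv_closed inv_solve_right')
  then show ?thesis
    using assms by (auto simp: translate_right_def dirac_def)
qed

lemma translate_left_dirac:
  assumes "group G" "g \<in> carrier G" "h \<in> carrier G"
  shows "translate_left G h (dirac k G g) = dirac k G (inv\<^bsub>G\<^esub> h \<otimes>\<^bsub>G\<^esub> g)"
proof -
  interpret group G by fact
  have "h \<otimes>\<^bsub>G\<^esub> x = g \<longleftrightarrow> x = inv\<^bsub>G\<^esub> h \<otimes>\<^bsub>G\<^esub> g" if "x \<in> carrier G" for x
    using assms that by (metis inv_solve_left)
  then show ?thesis
    using assms by (auto simp: translate_left_def dirac_def)
qed

text \<open>The left coaction \<open>a \<mapsto> \<Sum> e\<^sub>g \<otimes> a \<cdot> g\<close> corresponding to a right action of a finite group.\<close>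

definition coaction ::
  "('k, 'm) ring_scheme \<Rightarrow> ('g, 'q) monoid_scheme \<Rightarrow> ('k, 'a, 'n) module_scheme \<Rightarrow> ('a \<Rightarrow> 'g \<Rightarrow> 'a) \<Rightarrow>
   'a \<Rightarrow> (('g \<Rightarrow> 'k) \<times> 'a) list set" where
  "coaction k G A act a =
    (\<Oplus>\<^bsub>tensor k (fun_hopf k G) A\<^esub> g\<in>carrier G.
       pure_tensor k (fun_hopf k G) A (dirac k G g) (act a g))"

text \<open>\<open>twisted_fun k G \<sigma>\<close> is the algebra of functions with product \<open>x * y = \<Sum> \<sigma>(x\<^sub>1, y\<^sub>1) x\<^sub>2 y\<^sub>2\<close>.\<close>

definition twisted_fun ::
  "('k, 'm) ring_scheme \<Rightarrow> ('g, 'q) monoid_scheme \<Rightarrow> (('g \<Rightarrow> 'k) \<Rightarrow> ('g \<Rightarrow> 'k) \<Rightarrow> 'k) \<Rightarrow>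
   ('k, 'g \<Rightarrow> 'k) hopf" where
  "twisted_fun k G \<sigma> = twist \<sigma> (fun_hopf k G) (comult (fun_hopf k G))"

end

theory Submission
  imports "HOL-Algebra.Subrings" Defs
begin

text \<open>
  The theorem becomes transparent when \<open>\<O> \<otimes> A\<close> is read as the module of functions
  \<open>F : G \<rightarrow> A\<close>, the tensor \<open>u \<otimes> a\<close> being the function \<open>x \<mapsto> u(x) a\<close>; evaluation at the points of
  \<open>G\<close> separates tensors because \<open>t = \<Sum> e\<^sub>g \<otimes> t(g)\<close> (lemmas \<open>eval_simps\<close> and \<open>eval_expand\<close>). With
  \<open>s(g, h) = \<sigma>(e\<^sub>g, e\<^sub>h)\<close> the structure of \<open>\<^sub>\<sigma>\<O> \<otimes> A\<close> reads
  \<open>(F F')(x) = \<Sum> s(g, h) F(g x) F'(h x)\<close>, and the two actions are \<open>(F \<cdot> h)(x) = F(x h\<^sup>-\<^sup>1) \<cdot> h\<close> and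
  \<open>(F \<cdot> h)(x) = F(h x)\<close>. A function is invariant under the first action exactly when
  \<open>F(g) = F(1) \<cdot> g\<close> for all \<open>g\<close>, so it is determined by \<open>F(1)\<close>, and every \<open>a\<close> occurs as \<open>F(1)\<close> for the
  function \<open>\<Sum> e\<^sub>g \<otimes> a \<cdot> g\<close>, which is the coaction on \<open>a\<close>. For invariant functions the product has the
  value \<open>\<Sum> s(g, h) (F(1) \<cdot> g) (F'(1) \<cdot> h)\<close> at \<open>1\<close>, which is the twisted product of \<open>F(1)\<close> and \<open>F'(1)\<close>,
  and the second action sends \<open>F(1)\<close> to \<open>F(h) = F(1) \<cdot> h\<close>. Hence evaluation at \<open>1\<close> is the
  isomorphism (lemma \<open>eval_one_iso\<close>).

  That the objects involved are \<open>G\<close>-algebras at all rests on three properties of the matrix \<open>s\<close>: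
  the cocycle identity (\<open>kernel_cocycle\<close>) makes twisted products associative, laziness
  (\<open>kernel_lazy\<close>) makes \<open>G\<close> act by automorphisms of the twist, and convolution invertibility
  forces the row and column sums at \<open>g \<noteq> 1\<close> to vanish and those at \<open>1\<close> to be the unit \<open>\<sigma>(1, 1)\<close>
  of \<open>k\<close> (\<open>kernel_sums\<close>), which gives the twist a neutral element. The algebra
  \<open>\<^sub>\<sigma>\<O>\<close> is itself the twist of the \<open>G\<close>-algebra \<open>\<O>\<close> with action \<open>(u \<cdot> g)(x) = u(g x)\<close>, so one
  construction serves both twists.
\<close>

section \<open>Balanced maps\<close>

text \<open>
  Balanced maps take values in an abelian group rather than in a module. The commuting of scalars
  past the tensor sign is all that is asked of them, as in the relation that defines the tensor product.
\<close>

definition balanced ::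
  "('r, 'm) ring_scheme \<Rightarrow> ('r, 'a, 'n) module_scheme \<Rightarrow> ('r, 'b, 'p) module_scheme \<Rightarrow>
   ('c, 'q) ring_scheme \<Rightarrow> ('a \<Rightarrow> 'b \<Rightarrow> 'c) \<Rightarrow> bool" where
  "balanced R M N P f \<longleftrightarrow>
    (\<forall>m\<in>carrier M. \<forall>n\<in>carrier N. f m n \<in> carrier P) \<and>
    (\<forall>m\<in>carrier M. \<forall>m'\<in>carrier M. \<forall>n\<in>carrier N. f (m \<oplus>\<^bsub>M\<^esub> m') n = f m n \<oplus>\<^bsub>P\<^esub> f m' n) \<and>
    (\<forall>m\<in>carrier M. \<forall>n\<in>carrier N. \<forall>n'\<in>carrier N. f m (n \<oplus>\<^bsub>N\<^esub> n') = f m n \<oplus>\<^bsub>P\<^esub> f m n') \<and>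
    (\<forall>r\<in>carrier R. \<forall>m\<in>carrier M. \<forall>n\<in>carrier N. f (r \<odot>\<^bsub>M\<^esub> m) n = f m (r \<odot>\<^bsub>N\<^esub> n))"

lemma balancedI:
  assumes "\<And>m n. m \<in> carrier M \<Longrightarrow> n \<in> carrier N \<Longrightarrow> f m n \<in> carrier P"
    and "\<And>m m' n. m \<in> carrier M \<Longrightarrow> m' \<in> carrier M \<Longrightarrow> n \<in> carrier N \<Longrightarrow>
      f (m \<oplus>\<^bsub>M\<^esub> m') n = f m n \<oplus>\<^bsub>P\<^esub> f m' n"
    and "\<And>m n n'. m \<in> carrier M \<Longrightarrow> n \<in> carrier N \<Longrightarrow> n' \<in> carrier N \<Longrightarrow>
      f m (n \<oplus>\<^bsub>N\<^esub> n') = f m n \<oplus>\<^bsub>P\<^esub> f m n'"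
    and "\<And>r m n. r \<in> carrier R \<Longrightarrow> m \<in> carrier M \<Longrightarrow> n \<in> carrier N \<Longrightarrow>
      f (r \<odot>\<^bsub>M\<^esub> m) n = f m (r \<odot>\<^bsub>N\<^esub> n)"
  shows "balanced R M N P f"
  using assms by (simp add: balanced_def)

lemma balancedD:
  assumes "balanced R M N P f"
  shows "m \<in> carrier M \<Longrightarrow> n \<in> carrier N \<Longrightarrow> f m n \<in> carrier P"
    and "m \<in> carrier M \<Longrightarrow> m' \<in> carrier M \<Longrightarrow> n \<in> carrier N \<Longrightarrow>
      f (m \<oplus>\<^bsub>M\<^esub> m') n = f m n \<oplus>\<^bsub>P\<^esub> f m' n"
    and "m \<in> carrier M \<Longrightarrow> n \<in> carrier N \<Longrightarrow> n' \<in> carrier N \<Longrightarrow>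
      f m (n \<oplus>\<^bsub>N\<^esub> n') = f m n \<oplus>\<^bsub>P\<^esub> f m n'"
    and "r \<in> carrier R \<Longrightarrow> m \<in> carrier M \<Longrightarrow> n \<in> carrier N \<Longrightarrow>
      f (r \<odot>\<^bsub>M\<^esub> m) n = f m (r \<odot>\<^bsub>N\<^esub> n)"
  using assms by (simp_all add: balanced_def)

definition linear_on ::
  "('r, 'm) ring_scheme \<Rightarrow> ('r, 'a, 'n) module_scheme \<Rightarrow> ('r, 'b, 'p) module_scheme \<Rightarrow> ('a \<Rightarrow> 'b) \<Rightarrow> bool" where
  "linear_on R M N f \<longleftrightarrow>
    (\<forall>m\<in>carrier M. f m \<in> carrier N) \<and>
    (\<forall>m\<in>carrier M. \<forall>m'\<in>carrier M. f (m \<oplus>\<^bsub>M\<^esub> m') = f m \<oplus>\<^bsub>N\<^esub> f m') \<and>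
    (\<forall>r\<in>carrier R. \<forall>m\<in>carrier M. f (r \<odot>\<^bsub>M\<^esub> m) = r \<odot>\<^bsub>N\<^esub> f m)"

lemma linear_onD:
  assumes "linear_on R M N f"
  shows "m \<in> carrier M \<Longrightarrow> f m \<in> carrier N"
    and "m \<in> carrier M \<Longrightarrow> m' \<in> carrier M \<Longrightarrow> f (m \<oplus>\<^bsub>M\<^esub> m') = f m \<oplus>\<^bsub>N\<^esub> f m'"
    and "r \<in> carrier R \<Longrightarrow> m \<in> carrier M \<Longrightarrow> f (r \<odot>\<^bsub>M\<^esub> m) = r \<odot>\<^bsub>N\<^esub> f m"
  using assms by (simp_all add: linear_on_def)

lemma linear_on_id: "linear_on R M M (\<lambda>m. m)"
  by (simp add: linear_on_def)

lemma (in module) linear_on_smult: "r \<in> carrier R \<Longrightarrow> linear_on R M M (\<lambda>m. r \<odot>\<^bsub>M\<^esub> m)"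
  by (simp add: linear_on_def smult_r_distr R.m_comm flip: smult_assoc1)

lemma additive_zero:
  assumes "abelian_group M" "abelian_group P"
    and "\<And>x. x \<in> carrier M \<Longrightarrow> f x \<in> carrier P"
    and "\<And>x y. x \<in> carrier M \<Longrightarrow> y \<in> carrier M \<Longrightarrow> f (x \<oplus>\<^bsub>M\<^esub> y) = f x \<oplus>\<^bsub>P\<^esub> f y"
  shows "f \<zero>\<^bsub>M\<^esub> = \<zero>\<^bsub>P\<^esub>"
proof -
  interpret M: abelian_group M by fact
  interpret P: abelian_group P by fact
  have "f \<zero>\<^bsub>M\<^esub> \<oplus>\<^bsub>P\<^esub> f \<zero>\<^bsub>M\<^esub> = f \<zero>\<^bsub>M\<^esub>"
    using assms(4)[of "\<zero>\<^bsub>M\<^esub>" "\<zero>\<^bsub>M\<^esub>"] by simp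
  then show ?thesis
    using assms(3) by simp
qed

lemma additive_finsum:
  assumes "abelian_group M" "abelian_group P"
    and closed: "\<And>x. x \<in> carrier M \<Longrightarrow> f x \<in> carrier P"
    and add: "\<And>x y. x \<in> carrier M \<Longrightarrow> y \<in> carrier M \<Longrightarrow> f (x \<oplus>\<^bsub>M\<^esub> y) = f x \<oplus>\<^bsub>P\<^esub> f y"
    and "finite I" and "\<And>i. i \<in> I \<Longrightarrow> x i \<in> carrier M"
  shows "f (\<Oplus>\<^bsub>M\<^esub>i\<in>I. x i) = (\<Oplus>\<^bsub>P\<^esub>i\<in>I. f (x i))"
proof -
  interpret M: abelian_group M by fact
  interpret P: abelian_group P by fact
  show ?thesis
    using assms(5,6)
  proof (induction I)
    case empty
    show ?case
      using additive_zero[OF assms(1,2) closed add] by simp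
  next
    case (insert i I)
    then have "x \<in> I \<rightarrow> carrier M" "(\<lambda>i. f (x i)) \<in> I \<rightarrow> carrier P"
      by (auto simp: closed)
    with insert show ?case
      by (simp add: closed add)
  qed
qed

lemma balanced_zero_left:
  assumes "abelian_group M" "abelian_group P" "balanced R M N P f" "n \<in> carrier N"
  shows "f \<zero>\<^bsub>M\<^esub> n = \<zero>\<^bsub>P\<^esub>"
  by (rule additive_zero[OF assms(1,2), where f = "\<lambda>m. f m n"]) (use assms(3,4) in \<open>auto simp: balancedD\<close>)

lemma balanced_zero_right:
  assumes "abelian_group N" "abelian_group P" "balanced R M N P f" "m \<in> carrier M"
  shows "f m \<zero>\<^bsub>N\<^esub> = \<zero>\<^bsub>P\<^esub>"
  by (rule additive_zero[OF assms(1,2), where f = "f m"]) (use assms(3,4) in \<open>auto simp: balancedD\<close>)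

lemma balanced_finsum_left:
  assumes "abelian_group M" "abelian_group P" "balanced R M N P f" "n \<in> carrier N"
    and "finite I" "\<And>i. i \<in> I \<Longrightarrow> x i \<in> carrier M"
  shows "f (\<Oplus>\<^bsub>M\<^esub>i\<in>I. x i) n = (\<Oplus>\<^bsub>P\<^esub>i\<in>I. f (x i) n)"
  by (rule additive_finsum[OF assms(1,2), where f = "\<lambda>m. f m n"]) (use assms(3-) in \<open>auto simp: balancedD\<close>)

lemma balanced_finsum_right:
  assumes "abelian_group N" "abelian_group P" "balanced R M N P f" "m \<in> carrier M"
    and "finite I" "\<And>i. i \<in> I \<Longrightarrow> x i \<in> carrier N"
  shows "f m (\<Oplus>\<^bsub>N\<^esub>i\<in>I. x i) = (\<Oplus>\<^bsub>P\<^esub>i\<in>I. f m (x i))"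
  by (rule additive_finsum[OF assms(1,2), where f = "f m"]) (use assms(3-) in \<open>auto simp: balancedD\<close>)

section \<open>The tensor product of two modules\<close>

(* Without this, membership of a formal sum in the lists over a product decomposes entrywise,
   which hides the append and map structure that the relation is stated with. *)
declare in_listsD [rule del] in_listsI [rule del]

locale two_modules = M: module R M + N: module R N
  for R :: "('r, 'm) ring_scheme" and M :: "('r, 'a, 'n) module_scheme" and N :: "('r, 'b, 'p) module_scheme"
begin

abbreviation formal :: "('a \<times> 'b) list set" where "formal \<equiv> lists (carrier M \<times> carrier N)"
abbreviation rel where "rel \<equiv> tensor_rel R M N"
abbreviation cls where "cls \<equiv> tensor_class R M N"
abbreviation T where "T \<equiv> tensor R M N"
abbreviation pure where "pure m n \<equiv> cls [(m, n)]"

lemma rel_formal: "(u, v) \<in> rel \<Longrightarrow> u \<in> formal \<and> v \<in> formal"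
  by (induction rule: tensor_rel.induct) auto

lemma equiv_rel: "equiv formal rel"
proof (rule equivI)
  show "rel \<subseteq> formal \<times> formal"
    by (rule subrelI) (use rel_formal in simp)
  show "refl_on formal rel"
    by (simp add: refl_on_def tensor_rel.refl)
  show "sym rel"
    by (rule symI) (rule tensor_rel.sym)
  show "trans rel"
    by (rule transI) (rule tensor_rel.trans)
qed

lemma cls_eqI: "(u, v) \<in> rel \<Longrightarrow> cls u = cls v"
  using equiv_class_eq[OF equiv_rel] by (simp add: tensor_class_def)

lemma cls_closed [simp]: "u \<in> formal \<Longrightarrow> cls u \<in> carrier T"
  by (auto simp: tensor_def tensor_class_def quotient_def)

lemma carrier_tensorE:
  assumes "t \<in> carrier T"
  obtains u where "u \<in> formal" "t = cls u"
  using assms by (auto simp: tensor_def tensor_class_def quotient_def)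

lemma add_cls:
  assumes "u \<in> formal" "v \<in> formal"
  shows "cls u \<oplus>\<^bsub>T\<^esub> cls v = cls (u @ v)"
proof -
  have "congruent2 rel rel (\<lambda>u v. cls (u @ v))"
    by (auto simp: congruent2_def intro!: cls_eqI tensor_rel.append)
  from UN_equiv_class2[OF equiv_rel equiv_rel this assms] show ?thesis
    by (simp add: tensor_def tensor_class_def[symmetric])
qed

lemma formal_map:
  assumes "linear_on R M M f" "linear_on R N N g" "u \<in> formal"
  shows "map (\<lambda>(m, n). (f m, g n)) u \<in> formal"
  using assms(3) by induction (use assms(1,2) in \<open>auto simp: linear_on_def\<close>)

lemma rel_map:
  assumes "linear_on R M M f" "linear_on R N N g" "(u, v) \<in> rel"
  shows "(map (\<lambda>(m, n). (f m, g n)) u, map (\<lambda>(m, n). (f m, g n)) v) \<in> rel"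
  using assms(3)
proof (induction rule: tensor_rel.induct)
  case (refl u)
  with assms(1,2) show ?case
    by (intro tensor_rel.refl formal_map)
next
  case (comm u v)
  with assms(1,2) show ?case
    by (simp add: tensor_rel.comm formal_map)
next
  case (zero n)
  have "f \<zero>\<^bsub>M\<^esub> = \<zero>\<^bsub>M\<^esub>"
    using linear_onD[OF assms(1)] by (intro additive_zero) (auto intro: M.abelian_group_axioms)
  with zero assms show ?case
    by (auto simp: linear_on_def intro!: tensor_rel.zero)
next
  case (trans u v w)
  from trans.IH show ?case by (rule tensor_rel.trans)
next
  case (sym u v)
  from sym.IH show ?case by (rule tensor_rel.sym)
next
  case (append u v u' v')
  from tensor_rel.append[OF append.IH] show ?case by simp
qed (use assms(1,2) in \<open>simp_all add: linear_on_def tensor_rel.add_left tensor_rel.add_right tensor_rel.smult\<close>)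

lemma UN_map:
  assumes "linear_on R M M f" "linear_on R N N g" "u \<in> formal"
  shows "(\<Union>v\<in>cls u. cls (map (\<lambda>(m, n). (f m, g n)) v)) = cls (map (\<lambda>(m, n). (f m, g n)) u)"
proof -
  have "congruent rel (\<lambda>v. cls (map (\<lambda>(m, n). (f m, g n)) v))"
    by (auto simp: congruent_def intro!: cls_eqI rel_map assms)
  from UN_equiv_class[OF equiv_rel this assms(3)] show ?thesis
    by (simp add: tensor_class_def[symmetric])
qed

lemma smult_cls:
  assumes "r \<in> carrier R" "u \<in> formal"
  shows "r \<odot>\<^bsub>T\<^esub> cls u = cls (map (\<lambda>(m, n). (r \<odot>\<^bsub>M\<^esub> m, n)) u)"
  using UN_map[OF M.linear_on_smult[OF assms(1)] linear_on_id assms(2)] by (simp add: tensor_def)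

lemma tensor_map_cls:
  assumes "linear_on R M M f" "linear_on R N N g" "u \<in> formal"
  shows "tensor_map R M N f g (cls u) = cls (map (\<lambda>(m, n). (f m, g n)) u)"
  using UN_map[OF assms] by (simp add: tensor_map_def)

lemma zero_cls: "\<zero>\<^bsub>T\<^esub> = cls []"
  by (simp add: tensor_def)

lemma tensor_abelian_group: "abelian_group T"
proof (rule abelian_groupI)
  fix s t assume "s \<in> carrier T" "t \<in> carrier T"
  then obtain u v where "u \<in> formal" "v \<in> formal" "s = cls u" "t = cls v"
    by (elim carrier_tensorE)
  then show "s \<oplus>\<^bsub>T\<^esub> t \<in> carrier T" "s \<oplus>\<^bsub>T\<^esub> t = t \<oplus>\<^bsub>T\<^esub> s"
    by (simp_all add: add_cls cls_eqI tensor_rel.comm)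
next
  fix s t w assume "s \<in> carrier T" "t \<in> carrier T" "w \<in> carrier T"
  then show "s \<oplus>\<^bsub>T\<^esub> t \<oplus>\<^bsub>T\<^esub> w = s \<oplus>\<^bsub>T\<^esub> (t \<oplus>\<^bsub>T\<^esub> w)"
    by (auto elim!: carrier_tensorE simp: add_cls)
next
  fix s assume "s \<in> carrier T"
  then obtain u where u: "u \<in> formal" "s = cls u" by (rule carrier_tensorE)
  let ?n = "map (\<lambda>(m, n). (\<ominus>\<^bsub>M\<^esub> m, n))"
  have neg: "?n u \<in> formal" if "u \<in> formal" for u
    using that by (auto simp: in_lists_conv_set)
  have "cls (?n u @ u) = cls []"
    using u(1)
  proof (induction u)
    case (Cons p u)
    obtain m n where p: "p = (m, n)" "m \<in> carrier M" "n \<in> carrier N"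
      using Cons by auto
    have "([(\<ominus>\<^bsub>M\<^esub> m, n)] @ [(m, n)], []) \<in> rel"
      using p tensor_rel.add_left[where m = "\<ominus>\<^bsub>M\<^esub> m" and m' = m and n = n and M = M and N = N and R = R]
        tensor_rel.zero[where n = n and M = M and N = N and R = R]
      by (simp add: M.l_neg) (meson tensor_rel.sym tensor_rel.trans)
    from tensor_rel.append[OF this tensor_rel.refl[of "?n u @ u"]]
    have "([(\<ominus>\<^bsub>M\<^esub> m, n)] @ [(m, n)] @ ?n u @ u, ?n u @ u) \<in> rel"
      using Cons neg by simp
    moreover have "([(\<ominus>\<^bsub>M\<^esub> m, n)] @ ((?n u @ [(m, n)]) @ u), [(\<ominus>\<^bsub>M\<^esub> m, n)] @ (([(m, n)] @ ?n u) @ u)) \<in> rel"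
      using Cons neg p by (intro tensor_rel.append tensor_rel.comm tensor_rel.refl) auto
    ultimately have "cls (?n (p # u) @ p # u) = cls (?n u @ u)"
      by (intro cls_eqI) (simp add: p, meson tensor_rel.trans)
    with Cons show ?case by simp
  qed simp
  with u neg show "\<exists>t\<in>carrier T. t \<oplus>\<^bsub>T\<^esub> s = \<zero>\<^bsub>T\<^esub>"
    by (intro bexI[of _ "cls (?n u)"]) (auto simp: add_cls zero_cls)
qed (auto elim!: carrier_tensorE simp: add_cls zero_cls)

sublocale T: abelian_group T
  by (rule tensor_abelian_group)

lemma pure_closed [simp]: "m \<in> carrier M \<Longrightarrow> n \<in> carrier N \<Longrightarrow> pure m n \<in> carrier T"
  by simp

lemma tensor_induct [consumes 1, case_names zero pure add]:
  assumes "t \<in> carrier T" and "Q \<zero>\<^bsub>T\<^esub>"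
    and "\<And>m n. m \<in> carrier M \<Longrightarrow> n \<in> carrier N \<Longrightarrow> Q (pure m n)"
    and "\<And>s t. s \<in> carrier T \<Longrightarrow> t \<in> carrier T \<Longrightarrow> Q s \<Longrightarrow> Q t \<Longrightarrow> Q (s \<oplus>\<^bsub>T\<^esub> t)"
  shows "Q t"
proof -
  obtain u where u: "u \<in> formal" "t = cls u" using assms(1) by (rule carrier_tensorE)
  have "Q (cls u)"
    using u(1)
  proof induction
    case Nil
    show ?case using assms(2) by (simp add: zero_cls)
  next
    case (Cons p u)
    moreover from Cons(1) obtain m n where "p = (m, n)" "m \<in> carrier M" "n \<in> carrier N"
      by auto
    ultimately show ?case
      using assms(3)[of m n] assms(4)[of "pure m n" "cls u"] by (simp add: add_cls)
  qed
  with u show ?thesis by simp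
qed

lemma balanced_pure: "balanced R M N T pure"
  by (rule balancedI)
    (auto simp: add_cls intro!: cls_eqI tensor_rel.add_left tensor_rel.add_right tensor_rel.smult)

lemma smult_pure: "r \<in> carrier R \<Longrightarrow> m \<in> carrier M \<Longrightarrow> n \<in> carrier N \<Longrightarrow> r \<odot>\<^bsub>T\<^esub> pure m n = pure (r \<odot>\<^bsub>M\<^esub> m) n"
  by (simp add: smult_cls)

lemma smult_closed_T: "r \<in> carrier R \<Longrightarrow> t \<in> carrier T \<Longrightarrow> r \<odot>\<^bsub>T\<^esub> t \<in> carrier T"
  by (elim carrier_tensorE)
    (simp add: smult_cls formal_map[OF M.linear_on_smult linear_on_id])

lemma smult_add_T:
  "r \<in> carrier R \<Longrightarrow> s \<in> carrier T \<Longrightarrow> t \<in> carrier T \<Longrightarrow> r \<odot>\<^bsub>T\<^esub> (s \<oplus>\<^bsub>T\<^esub> t) = r \<odot>\<^bsub>T\<^esub> s \<oplus>\<^bsub>T\<^esub> r \<odot>\<^bsub>T\<^esub> t"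
  by (elim carrier_tensorE)
    (simp add: smult_cls add_cls formal_map[OF M.linear_on_smult linear_on_id])

lemma smult_zero_T: "r \<in> carrier R \<Longrightarrow> r \<odot>\<^bsub>T\<^esub> \<zero>\<^bsub>T\<^esub> = \<zero>\<^bsub>T\<^esub>"
  by (simp add: zero_cls smult_cls)

lemma tensor_module: "module R T"
proof (rule moduleI)
  show "cring R" by (rule M.R.cring_axioms)
  show "abelian_group T" by (rule tensor_abelian_group)
next
  fix r t assume *: "r \<in> carrier R" "t \<in> carrier T"
  then show "r \<odot>\<^bsub>T\<^esub> t \<in> carrier T" by (rule smult_closed_T)
next
  fix r s t assume *: "r \<in> carrier R" "s \<in> carrier T" "t \<in> carrier T"
  then show "r \<odot>\<^bsub>T\<^esub> (s \<oplus>\<^bsub>T\<^esub> t) = r \<odot>\<^bsub>T\<^esub> s \<oplus>\<^bsub>T\<^esub> r \<odot>\<^bsub>T\<^esub> t" by (rule smult_add_T)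
next
  fix a b t assume *: "a \<in> carrier R" "b \<in> carrier R" "t \<in> carrier T"
  show "(a \<oplus>\<^bsub>R\<^esub> b) \<odot>\<^bsub>T\<^esub> t = a \<odot>\<^bsub>T\<^esub> t \<oplus>\<^bsub>T\<^esub> b \<odot>\<^bsub>T\<^esub> t"
    using *(3)
  proof (induction rule: tensor_induct)
    case (pure m n)
    with * show ?case
      by (simp add: smult_pure M.smult_l_distr balancedD(2)[OF balanced_pure])
  next
    case (add s t)
    with * show ?case
      by (simp add: smult_add_T smult_closed_T T.a_ac)
  qed (use * in \<open>simp add: smult_zero_T\<close>)
  show "(a \<otimes>\<^bsub>R\<^esub> b) \<odot>\<^bsub>T\<^esub> t = a \<odot>\<^bsub>T\<^esub> (b \<odot>\<^bsub>T\<^esub> t)"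
    using *(3)
    by (induction rule: tensor_induct)
       (use * in \<open>simp_all add: smult_zero_T smult_add_T smult_closed_T smult_pure M.smult_assoc1\<close>)
next
  fix t assume "t \<in> carrier T"
  then show "\<one>\<^bsub>R\<^esub> \<odot>\<^bsub>T\<^esub> t = t"
    by (induction rule: tensor_induct) (simp_all add: smult_zero_T smult_add_T smult_pure)
qed

sublocale T: module R T
  by (rule tensor_module)

end

section \<open>Sweedler sums as induced linear maps\<close>

text \<open>
  The universal property of the tensor product: a balanced map sends each generator of the
  congruence to an identity of the abelian group \<open>P\<close>, so the sum over a formal sum only depends
  on the class. This is what makes the unique element in the definition of \<open>sweedler\<close> exist.
\<close>

lemma (in two_modules) sum_eq_of_rel:
  assumes "abelian_group P" "balanced R M N P f" "(u, v) \<in> rel"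
  shows "foldr (\<lambda>(m, n) s. f m n \<oplus>\<^bsub>P\<^esub> s) u \<zero>\<^bsub>P\<^esub> = foldr (\<lambda>(m, n) s. f m n \<oplus>\<^bsub>P\<^esub> s) v \<zero>\<^bsub>P\<^esub>"
proof -
  interpret P: abelian_group P by fact
  note f = balancedD[OF assms(2)]
  let ?S = "\<lambda>u. foldr (\<lambda>(m, n) s. f m n \<oplus>\<^bsub>P\<^esub> s) u \<zero>\<^bsub>P\<^esub>"
  have closed: "?S u \<in> carrier P" if "u \<in> formal" for u
    using that by induction (auto simp: f)
  have S_append: "?S (u @ v) = ?S u \<oplus>\<^bsub>P\<^esub> ?S v" if "u \<in> formal" "v \<in> formal" for u v
    using that(1) by induction (use closed that(2) in \<open>auto simp: f P.a_assoc closed\<close>)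
  show ?thesis
    using assms(3)
  proof (induction rule: tensor_rel.induct)
    case (append u v u' v')
    then have "u \<in> formal" "u' \<in> formal" "v \<in> formal" "v' \<in> formal"
      using rel_formal by blast+
    with append.IH show ?case by (simp only: S_append)
  next
    case (comm u v)
    then show ?case by (simp only: S_append P.a_comm closed)
  qed (use balanced_zero_left[OF M.abelian_group_axioms assms(1,2)] in \<open>simp_all add: f\<close>)
qed

context two_modules
begin

context
  fixes P :: "('c, 'q) ring_scheme" and f
  assumes P: "abelian_group P" and f: "balanced R M N P f"
begin

interpretation P: abelian_group P by (rule P)

lemma sweedler_cls:
  assumes "u \<in> formal"
  shows "sweedler P f (cls u) = foldr (\<lambda>(m, n) s. f m n \<oplus>\<^bsub>P\<^esub> s) u \<zero>\<^bsub>P\<^esub>"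
proof -
  let ?S = "\<lambda>u. foldr (\<lambda>(m, n) s. f m n \<oplus>\<^bsub>P\<^esub> s) u \<zero>\<^bsub>P\<^esub>"
  have "?S ` cls u = {?S u}"
    using sum_eq_of_rel[OF P f, of u] tensor_rel.refl[OF assms] by (auto simp: tensor_class_def)
  then show ?thesis by (simp add: sweedler_def)
qed

lemma sweedler_zero: "sweedler P f \<zero>\<^bsub>T\<^esub> = \<zero>\<^bsub>P\<^esub>"
  by (simp add: zero_cls sweedler_cls)

lemma sweedler_pure: "m \<in> carrier M \<Longrightarrow> n \<in> carrier N \<Longrightarrow> sweedler P f (pure m n) = f m n"
  by (simp add: sweedler_cls balancedD[OF f])

lemma sum_closed: "u \<in> formal \<Longrightarrow> foldr (\<lambda>(m, n) s. f m n \<oplus>\<^bsub>P\<^esub> s) u \<zero>\<^bsub>P\<^esub> \<in> carrier P"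
  by (induction rule: lists.induct) (auto simp: balancedD[OF f])

lemma sweedler_closed: "t \<in> carrier T \<Longrightarrow> sweedler P f t \<in> carrier P"
  by (elim carrier_tensorE) (simp add: sweedler_cls sum_closed)

lemma sweedler_add:
  assumes "s \<in> carrier T" "t \<in> carrier T"
  shows "sweedler P f (s \<oplus>\<^bsub>T\<^esub> t) = sweedler P f s \<oplus>\<^bsub>P\<^esub> sweedler P f t"
proof -
  obtain u v where u: "u \<in> formal" "v \<in> formal" "s = cls u" "t = cls v"
    using assms by (elim carrier_tensorE)
  let ?S = "\<lambda>u. foldr (\<lambda>(m, n) s. f m n \<oplus>\<^bsub>P\<^esub> s) u \<zero>\<^bsub>P\<^esub>"
  have "?S (u @ v) = ?S u \<oplus>\<^bsub>P\<^esub> ?S v"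
    using u(1) by induction (use u(2) in \<open>auto simp: balancedD[OF f] P.a_assoc sum_closed simp del: foldr_append\<close>)
  with u show ?thesis by (simp add: add_cls sweedler_cls del: foldr_append)
qed

lemma sweedler_finsum:
  assumes "finite I" "\<And>i. i \<in> I \<Longrightarrow> t i \<in> carrier T"
  shows "sweedler P f (\<Oplus>\<^bsub>T\<^esub>i\<in>I. t i) = (\<Oplus>\<^bsub>P\<^esub>i\<in>I. sweedler P f (t i))"
  by (rule additive_finsum) (simp_all add: sweedler_closed sweedler_add assms P tensor_abelian_group)

end

text \<open>
  Sweedler sums are nested in the definitions of convolution, cocycle, laziness and twist. The outer
  sum is well defined only because an inner sum depends on the outer variables in a balanced way;
  this holds for each pure tensor, and both sides are additive in the tensor.
\<close>

lemma balanced_sweedler: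
  assumes P: "abelian_group P"
    and 1: "\<And>x y. x \<in> carrier M' \<Longrightarrow> y \<in> carrier N' \<Longrightarrow> balanced R M N P (f x y)"
    and 2: "\<And>m n. m \<in> carrier M \<Longrightarrow> n \<in> carrier N \<Longrightarrow> balanced R M' N' P (\<lambda>x y. f x y m n)"
    and "module R M'" "module R N'"
    and t: "t \<in> carrier T"
  shows "balanced R M' N' P (\<lambda>x y. sweedler P (f x y) t)"
proof -
  interpret P: abelian_group P by fact
  interpret M': module R M' by fact
  interpret N': module R N' by fact
  note s = sweedler_zero[OF P 1] sweedler_add[OF P 1] sweedler_pure[OF P 1] sweedler_closed[OF P 1]
  show ?thesis
    using t
  proof (induction rule: tensor_induct)
    case zero
    show ?case
      by (rule balancedI) (simp_all add: s)
  next
    case (pure m n)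
    then show ?case
      by (intro balancedI) (simp_all add: s balancedD[OF 2])
  next
    case (add t t')
    then show ?case
      by (intro balancedI) (simp_all add: s balancedD[OF add(3)] balancedD[OF add(4)] P.a_ac)
  qed
qed

lemma tensor_map_linear:
  assumes "linear_on R M M f" "linear_on R N N g"
  shows "linear_on R T T (tensor_map R M N f g)"
  unfolding linear_on_def
proof (intro conjI ballI)
  note [simp] = tensor_map_cls[OF assms] formal_map[OF assms]
  fix t assume t: "t \<in> carrier T"
  then show "tensor_map R M N f g t \<in> carrier T"
    by (elim carrier_tensorE) simp
  fix s assume "s \<in> carrier T"
  with t show "tensor_map R M N f g (t \<oplus>\<^bsub>T\<^esub> s) = tensor_map R M N f g t \<oplus>\<^bsub>T\<^esub> tensor_map R M N f g s"
    by (elim carrier_tensorE) (simp add: add_cls)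
next
  note [simp] = tensor_map_cls[OF assms] formal_map[OF assms]
  fix r t assume r: "r \<in> carrier R" and "t \<in> carrier T"
  then obtain u where u: "u \<in> formal" "t = cls u" by (elim carrier_tensorE)
  have "map (\<lambda>(m, n). (f m, g n)) (map (\<lambda>(m, n). (r \<odot>\<^bsub>M\<^esub> m, n)) u) =
      map (\<lambda>(m, n). (r \<odot>\<^bsub>M\<^esub> m, n)) (map (\<lambda>(m, n). (f m, g n)) u)"
    using u(1) by induction (use r assms in \<open>auto simp: linear_on_def\<close>)
  with u r show "tensor_map R M N f g (r \<odot>\<^bsub>T\<^esub> t) = r \<odot>\<^bsub>T\<^esub> tensor_map R M N f g t"
    by (simp add: smult_cls formal_map[OF M.linear_on_smult linear_on_id] del: map_map)
qed

lemma tensor_map_pure: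
  assumes "linear_on R M M f" "linear_on R N N g" "m \<in> carrier M" "n \<in> carrier N"
  shows "tensor_map R M N f g (pure m n) = pure (f m) (g n)"
  using assms by (simp add: tensor_map_cls)

lemma tensor_map_zero:
  assumes "linear_on R M M f" "linear_on R N N g"
  shows "tensor_map R M N f g \<zero>\<^bsub>T\<^esub> = \<zero>\<^bsub>T\<^esub>"
  using assms by (simp add: zero_cls tensor_map_cls)

lemma tensor_map_comp:
  assumes "linear_on R M M f" "linear_on R N N g" "linear_on R M M f'" "linear_on R N N g'"
    and "t \<in> carrier T"
  shows "tensor_map R M N f g (tensor_map R M N f' g' t) = tensor_map R M N (\<lambda>m. f (f' m)) (\<lambda>n. g (g' n)) t"
proof -
  have c: "linear_on R M M (\<lambda>m. f (f' m))" "linear_on R N N (\<lambda>n. g (g' n))"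
    using assms(1-4) by (simp_all add: linear_on_def)
  note l = linear_onD[OF tensor_map_linear[OF assms(1,2)]] linear_onD[OF tensor_map_linear[OF assms(3,4)]]
    linear_onD[OF tensor_map_linear[OF c]] linear_onD[OF assms(3)] linear_onD[OF assms(4)]
  show ?thesis
    using assms(5)
    by (induction rule: tensor_induct)
      (simp_all add: tensor_map_zero[OF assms(1,2)] tensor_map_zero[OF assms(3,4)] tensor_map_zero[OF c]
        tensor_map_pure[OF assms(1,2)] tensor_map_pure[OF assms(3,4)] tensor_map_pure[OF c] l)
qed

lemma tensor_map_cong:
  assumes "\<And>m. m \<in> carrier M \<Longrightarrow> f m = f' m" "\<And>n. n \<in> carrier N \<Longrightarrow> g n = g' n"
    and "linear_on R M M f'" "linear_on R N N g'"  and "t \<in> carrier T"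
  shows "tensor_map R M N f g t = tensor_map R M N f' g' t"
proof -
  have l: "linear_on R M M f" "linear_on R N N g"
    using assms(1-4) M.module_axioms N.module_axioms by (auto simp: linear_on_def M.smult_closed N.smult_closed)
  obtain u where u: "u \<in> formal" "t = cls u" using assms(5) by (elim carrier_tensorE)
  have "map (\<lambda>(m, n). (f m, g n)) u = map (\<lambda>(m, n). (f' m, g' n)) u"
    using u(1) by induction (use assms(1,2) in auto)
  with u show ?thesis by (simp only: tensor_map_cls[OF l] tensor_map_cls[OF assms(3,4)])
qed

lemma tensor_map_id: "t \<in> carrier T \<Longrightarrow> tensor_map R M N (\<lambda>m. m) (\<lambda>n. n) t = t"
  by (elim carrier_tensorE) (simp add: tensor_map_cls linear_on_id)

end

section \<open>The tensor product of two algebras\<close>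

locale two_algebras = M: assoc_algebra R M + N: assoc_algebra R N
  for R :: "('r, 'm) ring_scheme" and M :: "('r, 'a, 'n) module_scheme" and N :: "('r, 'b, 'p) module_scheme"

sublocale two_algebras \<subseteq> two_modules ..

lemma (in assoc_algebra) linear_on_mult_left: "a \<in> carrier A \<Longrightarrow> linear_on R A A (\<lambda>b. a \<otimes>\<^bsub>A\<^esub> b)"
  by (simp add: linear_on_def r_distr smult_mult_right)

lemma (in assoc_algebra) linear_on_mult_right: "a \<in> carrier A \<Longrightarrow> linear_on R A A (\<lambda>b. b \<otimes>\<^bsub>A\<^esub> a)"
  by (simp add: linear_on_def l_distr smult_mult_left)

context two_algebras
begin

definition prods :: "('a \<times> 'b) list \<Rightarrow> ('a \<times> 'b) list \<Rightarrow> ('a \<times> 'b) list" where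
  "prods u v = [(m \<otimes>\<^bsub>M\<^esub> m', n \<otimes>\<^bsub>N\<^esub> n'). (m, n) \<leftarrow> u, (m', n') \<leftarrow> v]"

lemma prods_simps [simp]:
  "prods [] v = []"
  "prods ((m, n) # u) v = map (\<lambda>(m', n'). (m \<otimes>\<^bsub>M\<^esub> m', n \<otimes>\<^bsub>N\<^esub> n')) v @ prods u v"
  "prods (u @ u') v = prods u v @ prods u' v"
  by (simp_all add: prods_def)

lemma prods_Nil_right [simp]: "prods u [] = []"
  by (induction u) auto

lemma prods_closed:
  assumes "u \<in> formal" "v \<in> formal"
  shows "prods u v \<in> formal"
  using assms(1)
proof induction
  case (Cons p u)
  then obtain m n where p: "p = (m, n)" "m \<in> carrier M" "n \<in> carrier N" by auto
  with Cons formal_map[OF M.linear_on_mult_left N.linear_on_mult_left assms(2), of m n] show ?case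
    by simp
qed simp

text \<open>
  On formal sums the product distributes over the right argument only up to reordering, so the
  statement has to be made for classes; in the left argument it holds on the nose.
\<close>

lemma prods_add_right:
  assumes "u \<in> formal" "v \<in> formal" "w \<in> formal"
  shows "cls (prods u (v @ w)) = cls (prods u v) \<oplus>\<^bsub>T\<^esub> cls (prods u w)"
  using assms(1)
proof induction
  case Nil
  show ?case by (simp flip: zero_cls)
next
  case (Cons p u)
  then obtain m n where p: "p = (m, n)" "m \<in> carrier M" "n \<in> carrier N" by auto
  note map = formal_map[OF M.linear_on_mult_left[OF p(2)] N.linear_on_mult_left[OF p(3)]]
  let ?m = "map (\<lambda>(m', n'). (m \<otimes>\<^bsub>M\<^esub> m', n \<otimes>\<^bsub>N\<^esub> n'))"
  have c: "?m v \<in> formal" "?m w \<in> formal" "prods u v \<in> formal" "prods u w \<in> formal" "prods u (v @ w) \<in> formal"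
    using assms Cons by (simp_all add: map prods_closed)
  have "cls (prods (p # u) (v @ w)) = (cls (?m v) \<oplus>\<^bsub>T\<^esub> cls (?m w)) \<oplus>\<^bsub>T\<^esub> cls (prods u (v @ w))"
    using c by (simp add: p add_cls)
  also have "\<dots> = (cls (?m v) \<oplus>\<^bsub>T\<^esub> cls (prods u v)) \<oplus>\<^bsub>T\<^esub> (cls (?m w) \<oplus>\<^bsub>T\<^esub> cls (prods u w))"
    using c Cons by (simp only: Cons.IH T.a_ac cls_closed T.a_closed)
  also have "\<dots> = cls (prods (p # u) v) \<oplus>\<^bsub>T\<^esub> cls (prods (p # u) w)"
    using c by (simp add: p add_cls)
  finally show ?case .
qed

lemma prods_rel_right:
  assumes "u \<in> formal" "(v, v') \<in> rel"
  shows "(prods u v, prods u v') \<in> rel"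
  using assms(1)
proof induction
  case (Cons p u)
  then obtain m n where p: "p = (m, n)" "m \<in> carrier M" "n \<in> carrier N" by auto
  with Cons rel_map[OF M.linear_on_mult_left N.linear_on_mult_left assms(2), of m n] show ?case
    by (simp add: tensor_rel.append)
qed (simp add: tensor_rel.refl)

text \<open>
  By right distributivity it suffices to treat a single pair as right factor, and multiplication by
  a pair is a tensor product of two linear maps, which respects the congruence.
\<close>

lemma prods_rel_left:
  assumes "v \<in> formal" "(u, u') \<in> rel"
  shows "cls (prods u v) = cls (prods u' v)"
  using assms(1)
proof induction
  case (Cons p v)
  then obtain m n where p: "p = (m, n)" "m \<in> carrier M" "n \<in> carrier N" by auto
  have "prods w [p] = map (\<lambda>(m', n'). (m' \<otimes>\<^bsub>M\<^esub> m, n' \<otimes>\<^bsub>N\<^esub> n)) w" for w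
    by (induction w) (auto simp: p)
  then have 1: "cls (prods u [p]) = cls (prods u' [p])"
    using rel_map[OF M.linear_on_mult_right[OF p(2)] N.linear_on_mult_right[OF p(3)] assms(2)]
    by (simp add: cls_eqI)
  have "cls (prods w (p # v)) = cls (prods w [p]) \<oplus>\<^bsub>T\<^esub> cls (prods w v)" if "w \<in> formal" for w
    using prods_add_right[OF that, of "[p]" v] Cons by simp
  with 1 Cons rel_formal[OF assms(2)] show ?case
    by simp
qed simp

lemma mult_cls:
  assumes "u \<in> formal" "v \<in> formal"
  shows "cls u \<otimes>\<^bsub>T\<^esub> cls v = cls (prods u v)"
proof -
  have "congruent2 rel rel (\<lambda>u v. cls (prods u v))"
  proof (rule congruent2I')
    fix u u' v v' assume *: "(u, u') \<in> rel" "(v, v') \<in> rel"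
    then have "u \<in> formal" "v' \<in> formal" using rel_formal by blast+
    then show "cls (prods u v) = cls (prods u' v')"
      using cls_eqI[OF prods_rel_right[of u v v']] prods_rel_left[of v' u u'] * by simp
  qed
  from UN_equiv_class2[OF equiv_rel equiv_rel this assms] show ?thesis
    by (simp add: tensor_def tensor_class_def[symmetric] prods_def)
qed

lemma mult_pure:
  "m \<in> carrier M \<Longrightarrow> n \<in> carrier N \<Longrightarrow> m' \<in> carrier M \<Longrightarrow> n' \<in> carrier N \<Longrightarrow>
    pure m n \<otimes>\<^bsub>T\<^esub> pure m' n' = pure (m \<otimes>\<^bsub>M\<^esub> m') (n \<otimes>\<^bsub>N\<^esub> n')"
  by (simp add: mult_cls)

lemma mult_closed_T: "s \<in> carrier T \<Longrightarrow> t \<in> carrier T \<Longrightarrow> s \<otimes>\<^bsub>T\<^esub> t \<in> carrier T"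
  by (elim carrier_tensorE) (simp add: mult_cls prods_closed)

lemma mult_add_left:
  "s \<in> carrier T \<Longrightarrow> s' \<in> carrier T \<Longrightarrow> t \<in> carrier T \<Longrightarrow>
    (s \<oplus>\<^bsub>T\<^esub> s') \<otimes>\<^bsub>T\<^esub> t = s \<otimes>\<^bsub>T\<^esub> t \<oplus>\<^bsub>T\<^esub> s' \<otimes>\<^bsub>T\<^esub> t"
  by (elim carrier_tensorE)
    (simp add: mult_cls add_cls prods_closed)

lemma mult_add_right:
  "s \<in> carrier T \<Longrightarrow> t \<in> carrier T \<Longrightarrow> t' \<in> carrier T \<Longrightarrow>
    s \<otimes>\<^bsub>T\<^esub> (t \<oplus>\<^bsub>T\<^esub> t') = s \<otimes>\<^bsub>T\<^esub> t \<oplus>\<^bsub>T\<^esub> s \<otimes>\<^bsub>T\<^esub> t'"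
  by (elim carrier_tensorE)
    (simp add: mult_cls add_cls prods_closed prods_add_right)

lemma mult_zero_left: "t \<in> carrier T \<Longrightarrow> \<zero>\<^bsub>T\<^esub> \<otimes>\<^bsub>T\<^esub> t = \<zero>\<^bsub>T\<^esub>"
  by (rule additive_zero[OF tensor_abelian_group tensor_abelian_group, where f = "\<lambda>s. s \<otimes>\<^bsub>T\<^esub> t"])
    (simp_all add: mult_closed_T mult_add_left)

lemma mult_zero_right: "t \<in> carrier T \<Longrightarrow> t \<otimes>\<^bsub>T\<^esub> \<zero>\<^bsub>T\<^esub> = \<zero>\<^bsub>T\<^esub>"
  by (rule additive_zero[OF tensor_abelian_group tensor_abelian_group])
    (simp_all add: mult_closed_T mult_add_right)

lemmas mult_T = mult_closed_T mult_add_left mult_add_right mult_zero_left mult_zero_right mult_pure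

lemma one_T: "\<one>\<^bsub>T\<^esub> = pure \<one>\<^bsub>M\<^esub> \<one>\<^bsub>N\<^esub>"
  by (simp add: tensor_def)

lemma tensor_assoc_algebra: "assoc_algebra R T"
proof (intro assoc_algebra.intro assoc_algebra_axioms.intro ringI monoidI)
  show "module R T" by (rule tensor_module)
  show "abelian_group T" by (rule tensor_abelian_group)
  show "\<one>\<^bsub>T\<^esub> \<in> carrier T" by (simp add: one_T)
next
  fix s t assume "s \<in> carrier T" "t \<in> carrier T"
  then show "s \<otimes>\<^bsub>T\<^esub> t \<in> carrier T" by (rule mult_closed_T)
next
  fix s t w assume *: "s \<in> carrier T" "t \<in> carrier T" "w \<in> carrier T"
  then show "(s \<oplus>\<^bsub>T\<^esub> t) \<otimes>\<^bsub>T\<^esub> w = s \<otimes>\<^bsub>T\<^esub> w \<oplus>\<^bsub>T\<^esub> t \<otimes>\<^bsub>T\<^esub> w"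
    and "w \<otimes>\<^bsub>T\<^esub> (s \<oplus>\<^bsub>T\<^esub> t) = w \<otimes>\<^bsub>T\<^esub> s \<oplus>\<^bsub>T\<^esub> w \<otimes>\<^bsub>T\<^esub> t"
    by (simp_all add: mult_T)
  have pp: "pure m n \<otimes>\<^bsub>T\<^esub> pure m' n' \<otimes>\<^bsub>T\<^esub> w = pure m n \<otimes>\<^bsub>T\<^esub> (pure m' n' \<otimes>\<^bsub>T\<^esub> w)"
    if "m \<in> carrier M" "n \<in> carrier N" "m' \<in> carrier M" "n' \<in> carrier N" for m n m' n'
    using *(3)
    by (induction rule: tensor_induct)
      (use that in \<open>simp_all add: mult_T M.m_assoc N.m_assoc\<close>)
  have p: "pure m n \<otimes>\<^bsub>T\<^esub> t \<otimes>\<^bsub>T\<^esub> w = pure m n \<otimes>\<^bsub>T\<^esub> (t \<otimes>\<^bsub>T\<^esub> w)"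
    if "m \<in> carrier M" "n \<in> carrier N" for m n
    using *(2)
  proof (induction rule: tensor_induct)
    case (pure m' n')
    then show ?case using that pp by simp
  qed (use that * in \<open>simp_all add: mult_T\<close>)
  show "s \<otimes>\<^bsub>T\<^esub> t \<otimes>\<^bsub>T\<^esub> w = s \<otimes>\<^bsub>T\<^esub> (t \<otimes>\<^bsub>T\<^esub> w)"
    using *(1)
  proof (induction rule: tensor_induct)
    case (pure m n)
    then show ?case using p by simp
  qed (use * in \<open>simp_all add: mult_T\<close>)
next
  fix t assume "t \<in> carrier T"
  then show "\<one>\<^bsub>T\<^esub> \<otimes>\<^bsub>T\<^esub> t = t"
    by (induction rule: tensor_induct) (simp_all add: one_T mult_T)
next
  fix t assume "t \<in> carrier T"
  then show "t \<otimes>\<^bsub>T\<^esub> \<one>\<^bsub>T\<^esub> = t"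
    by (induction rule: tensor_induct) (simp_all add: one_T mult_T)
next
  fix r s t assume *: "r \<in> carrier R" "s \<in> carrier T" "t \<in> carrier T"
  have p: "(r \<odot>\<^bsub>T\<^esub> pure m n) \<otimes>\<^bsub>T\<^esub> t = r \<odot>\<^bsub>T\<^esub> (pure m n \<otimes>\<^bsub>T\<^esub> t)"
    "pure m n \<otimes>\<^bsub>T\<^esub> (r \<odot>\<^bsub>T\<^esub> t) = r \<odot>\<^bsub>T\<^esub> (pure m n \<otimes>\<^bsub>T\<^esub> t)"
    if "m \<in> carrier M" "n \<in> carrier N" for m n
    using *(3)
    by (induction rule: tensor_induct)
      (use that * in \<open>simp_all add: mult_T smult_pure smult_add_T smult_zero_T
        M.smult_mult_left M.smult_mult_right T.smult_closed\<close>)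
  show "(r \<odot>\<^bsub>T\<^esub> s) \<otimes>\<^bsub>T\<^esub> t = r \<odot>\<^bsub>T\<^esub> (s \<otimes>\<^bsub>T\<^esub> t)"
    using *(2)
  proof (induction rule: tensor_induct)
    case (pure m n)
    then show ?case using p by simp
  qed (use * in \<open>simp_all add: mult_T smult_add_T smult_zero_T T.smult_closed\<close>)
  show "s \<otimes>\<^bsub>T\<^esub> (r \<odot>\<^bsub>T\<^esub> t) = r \<odot>\<^bsub>T\<^esub> (s \<otimes>\<^bsub>T\<^esub> t)"
    using *(2)
  proof (induction rule: tensor_induct)
    case (pure m n)
    then show ?case using p by simp
  qed (use * in \<open>simp_all add: mult_T smult_add_T smult_zero_T T.smult_closed\<close>)
qed

lemma tensor_map_mult:
  assumes "linear_on R M M f" "linear_on R N N g"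
    and "\<And>x y. x \<in> carrier M \<Longrightarrow> y \<in> carrier M \<Longrightarrow> f (x \<otimes>\<^bsub>M\<^esub> y) = f x \<otimes>\<^bsub>M\<^esub> f y"
    and "\<And>x y. x \<in> carrier N \<Longrightarrow> y \<in> carrier N \<Longrightarrow> g (x \<otimes>\<^bsub>N\<^esub> y) = g x \<otimes>\<^bsub>N\<^esub> g y"
    and "s \<in> carrier T" "t \<in> carrier T"
  shows "tensor_map R M N f g (s \<otimes>\<^bsub>T\<^esub> t) = tensor_map R M N f g s \<otimes>\<^bsub>T\<^esub> tensor_map R M N f g t"
proof -
  note l = linear_onD(1,2)[OF tensor_map_linear[OF assms(1,2)]] linear_onD(1)[OF assms(1)] linear_onD(1)[OF assms(2)]
    tensor_map_zero[OF assms(1,2)] tensor_map_pure[OF assms(1,2)] assms(3,4) mult_T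
  have p: "tensor_map R M N f g (pure m n \<otimes>\<^bsub>T\<^esub> t) = tensor_map R M N f g (pure m n) \<otimes>\<^bsub>T\<^esub> tensor_map R M N f g t"
    if "m \<in> carrier M" "n \<in> carrier N" for m n
    using assms(6) by (induction rule: tensor_induct) (use that in \<open>simp_all add: l\<close>)
  show ?thesis
    using assms(5)
  proof (induction rule: tensor_induct)
    case (pure m n)
    then show ?case using p by simp
  qed (use assms(6) in \<open>simp_all add: l\<close>)
qed

end

section \<open>Right G-algebras, tensor products and invariants\<close>

text \<open>
  Bijectivity is automatic: the action of the inverse group element is an inverse map.
\<close>

lemma right_G_algebraI:
  assumes A: "assoc_algebra R A" and G: "group G"
    and lin: "\<And>g. g \<in> carrier G \<Longrightarrow> linear_on R A A (\<lambda>a. act a g)"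
    and mult: "\<And>g a b. g \<in> carrier G \<Longrightarrow> a \<in> carrier A \<Longrightarrow> b \<in> carrier A \<Longrightarrow>
      act (a \<otimes>\<^bsub>A\<^esub> b) g = act a g \<otimes>\<^bsub>A\<^esub> act b g"
    and one: "\<And>g. g \<in> carrier G \<Longrightarrow> act \<one>\<^bsub>A\<^esub> g = \<one>\<^bsub>A\<^esub>"
    and act_one: "\<And>a. a \<in> carrier A \<Longrightarrow> act a \<one>\<^bsub>G\<^esub> = a"
    and act_mult: "\<And>a g h. a \<in> carrier A \<Longrightarrow> g \<in> carrier G \<Longrightarrow> h \<in> carrier G \<Longrightarrow>
      act a (g \<otimes>\<^bsub>G\<^esub> h) = act (act a g) h"
  shows "right_G_algebra R G A act"
proof -
  interpret A: assoc_algebra R A by (rule A)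
  interpret G: group G by (rule G)
  show ?thesis
  proof unfold_locales
    fix g assume g: "g \<in> carrier G"
    have "bij_betw (\<lambda>a. act a g) (carrier A) (carrier A)"
      by (rule bij_betw_byWitness[where f' = "\<lambda>a. act a (inv\<^bsub>G\<^esub> g)"])
        (use g lin in \<open>auto simp: linear_on_def act_one simp flip: act_mult\<close>)
    with g lin[OF g] show "(\<lambda>a. act a g) \<in> algebra_iso R A A"
      by (auto simp: algebra_iso_def ring_iso_def linear_on_def mult one intro!: ring_hom_memI)
  qed (simp_all add: act_one act_mult)
qed

context right_G_algebra
begin

lemma linear_on_act: "g \<in> carrier G \<Longrightarrow> linear_on R A A (\<lambda>a. act a g)"
  using act_automorphism by (auto simp: algebra_iso_def ring_iso_def ring_hom_def linear_on_def Pi_def)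

lemmas act_closed [simp] = linear_onD(1)[OF linear_on_act]
lemmas act_add = linear_onD(2)[OF linear_on_act]
lemmas act_smult = linear_onD(3)[OF linear_on_act]

lemma act_times: "g \<in> carrier G \<Longrightarrow> a \<in> carrier A \<Longrightarrow> b \<in> carrier A \<Longrightarrow> act (a \<otimes>\<^bsub>A\<^esub> b) g = act a g \<otimes>\<^bsub>A\<^esub> act b g"
  and act_unit: "g \<in> carrier G \<Longrightarrow> act \<one>\<^bsub>A\<^esub> g = \<one>\<^bsub>A\<^esub>"
  using act_automorphism by (auto simp: algebra_iso_def ring_iso_def ring_hom_def)

lemma act_zero: "g \<in> carrier G \<Longrightarrow> act \<zero>\<^bsub>A\<^esub> g = \<zero>\<^bsub>A\<^esub>"
  by (rule additive_zero) (auto simp: act_add intro: A.abelian_group_axioms)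

lemma act_minus: "g \<in> carrier G \<Longrightarrow> a \<in> carrier A \<Longrightarrow> act (\<ominus>\<^bsub>A\<^esub> a) g = \<ominus>\<^bsub>A\<^esub> act a g"
  by (rule A.minus_equality[symmetric]) (simp_all add: A.l_neg act_zero flip: act_add)

lemma act_finsum:
  assumes "g \<in> carrier G" "finite I" "\<And>i. i \<in> I \<Longrightarrow> a i \<in> carrier A"
  shows "act (\<Oplus>\<^bsub>A\<^esub>i\<in>I. a i) g = (\<Oplus>\<^bsub>A\<^esub>i\<in>I. act (a i) g)"
  by (rule additive_finsum) (use assms in \<open>auto simp: act_add intro: A.abelian_group_axioms\<close>)

lemma invariants_assoc_algebra: "assoc_algebra R (invariants A G act)"
proof -
  let ?H = "{a \<in> carrier A. \<forall>g\<in>carrier G. act a g = a}"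
  have "ring (A\<lparr>carrier := ?H\<rparr>)"
    by (rule A.subring_is_ring, rule A.subringI) (auto simp: act_unit act_minus act_times act_add)
  moreover have "module R (A\<lparr>carrier := ?H\<rparr>)"
    by (rule submodule.submodule_is_module[OF A.submoduleI A.module_axioms])
      (auto simp: act_zero act_minus act_smult act_add)
  ultimately show ?thesis
    unfolding invariants_def
    by (intro assoc_algebra.intro assoc_algebra_axioms.intro)
      (auto simp: A.smult_mult_left A.smult_mult_right)
qed

end

lemma trivial_right_G_algebra:
  assumes "assoc_algebra R A" "group G"
  shows "right_G_algebra R G A (\<lambda>a g. a)"
  by (rule right_G_algebraI) (use assms in \<open>auto intro: linear_on_id\<close>)

text \<open>
  This puts the second action, by left translations, on the invariants of the diagonal action.
\<close>

lemma invariants_right_G_algebra: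
  assumes "right_G_algebra R G A act" "right_G_algebra R G A act'"
    and comm: "\<And>a g h. a \<in> carrier A \<Longrightarrow> g \<in> carrier G \<Longrightarrow> h \<in> carrier G \<Longrightarrow> act (act' a h) g = act' (act a g) h"
  shows "right_G_algebra R G (invariants A G act) act'"
proof -
  interpret X: right_G_algebra R G A act by fact
  interpret Y: right_G_algebra R G A act' by fact
  show ?thesis
  proof (rule right_G_algebraI)
    show "assoc_algebra R (invariants A G act)" by (rule X.invariants_assoc_algebra)
    show "linear_on R (invariants A G act) (invariants A G act) (\<lambda>a. act' a g)" if "g \<in> carrier G" for g
      using that by (auto simp: linear_on_def invariants_def comm Y.act_add Y.act_smult)
  qed (auto simp: invariants_def Y.act_times Y.act_unit Y.act_one Y.act_mult)
qed

lemma (in two_algebras) tensor_right_G_algebra: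
  assumes "right_G_algebra R G M actM" "right_G_algebra R G N actN"
  shows "right_G_algebra R G T (\<lambda>t g. tensor_map R M N (\<lambda>m. actM m g) (\<lambda>n. actN n g) t)"
proof -
  interpret X: right_G_algebra R G M actM by fact
  interpret Y: right_G_algebra R G N actN by fact
  note lin = X.linear_on_act Y.linear_on_act
  show ?thesis
  proof (rule right_G_algebraI)
    fix g a b assume "g \<in> carrier G" "a \<in> carrier T" "b \<in> carrier T"
    then show "tensor_map R M N (\<lambda>m. actM m g) (\<lambda>n. actN n g) (a \<otimes>\<^bsub>T\<^esub> b) =
      tensor_map R M N (\<lambda>m. actM m g) (\<lambda>n. actN n g) a \<otimes>\<^bsub>T\<^esub> tensor_map R M N (\<lambda>m. actM m g) (\<lambda>n. actN n g) b"
      by (intro tensor_map_mult lin X.act_times Y.act_times)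
  next
    fix a assume a: "a \<in> carrier T"
    have "tensor_map R M N (\<lambda>m. actM m \<one>\<^bsub>G\<^esub>) (\<lambda>n. actN n \<one>\<^bsub>G\<^esub>) a = tensor_map R M N (\<lambda>m. m) (\<lambda>n. n) a"
      by (rule tensor_map_cong) (use a in \<open>auto simp: X.act_one Y.act_one linear_on_id\<close>)
    with a show "tensor_map R M N (\<lambda>m. actM m \<one>\<^bsub>G\<^esub>) (\<lambda>n. actN n \<one>\<^bsub>G\<^esub>) a = a"
      by (simp add: tensor_map_id)
  next
    fix a g h assume a: "a \<in> carrier T" and g: "g \<in> carrier G" and h: "h \<in> carrier G"
    have l: "linear_on R M M (\<lambda>m. actM (actM m g) h)" "linear_on R N N (\<lambda>n. actN (actN n g) h)"
      using lin[OF g] lin[OF h] by (auto simp: linear_on_def)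
    show "tensor_map R M N (\<lambda>m. actM m (g \<otimes>\<^bsub>G\<^esub> h)) (\<lambda>n. actN n (g \<otimes>\<^bsub>G\<^esub> h)) a =
      tensor_map R M N (\<lambda>m. actM m h) (\<lambda>n. actN n h) (tensor_map R M N (\<lambda>m. actM m g) (\<lambda>n. actN n g) a)"
      unfolding tensor_map_comp[OF lin[OF h] lin[OF g] a]
      by (rule tensor_map_cong) (use a g h in \<open>auto simp: X.act_mult Y.act_mult l\<close>)
  qed (simp_all add: tensor_assoc_algebra X.G.group_axioms tensor_map_linear lin one_T
      tensor_map_pure X.act_unit Y.act_unit)
qed

section \<open>The Hopf algebra of functions on a finite group\<close>

lemma (in abelian_monoid) finsum_swap:
  assumes "finite I" "finite J" "\<And>i j. i \<in> I \<Longrightarrow> j \<in> J \<Longrightarrow> f i j \<in> carrier G"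
  shows "(\<Oplus>i\<in>I. \<Oplus>j\<in>J. f i j) = (\<Oplus>j\<in>J. \<Oplus>i\<in>I. f i j)"
  using assms(1,3)
proof (induction I)
  case (insert i I)
  then have "(\<lambda>i. \<Oplus>j\<in>J. f i j) \<in> I \<rightarrow> carrier G" "(\<Oplus>j\<in>J. f i j) \<in> carrier G"
    "f i \<in> J \<rightarrow> carrier G" "(\<lambda>j. \<Oplus>i\<in>I. f i j) \<in> J \<rightarrow> carrier G"
    by (auto intro!: finsum_closed)
  moreover have "(\<Oplus>j\<in>J. \<Oplus>i\<in>insert i I. f i j) = (\<Oplus>j\<in>J. f i j \<oplus> (\<Oplus>i\<in>I. f i j))"
    using insert by (intro finsum_cong') (auto simp: Pi_def intro!: finsum_closed)
  ultimately show ?case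
    using insert by (simp add: finsum_addf)
qed simp

lemma (in abelian_monoid) finsum_cong_closed:
  assumes "\<And>i. i \<in> I \<Longrightarrow> f i = g i" "\<And>i. i \<in> I \<Longrightarrow> g i \<in> carrier G"
  shows "finsum G f I = finsum G g I"
  by (rule finsum_cong') (use assms in auto)

lemma tensor_rel_mono:
  assumes "carrier M' = carrier M" "zero M' = zero M" "add M' = add M" "module.smult M' = module.smult M"
    and "carrier N' = carrier N" "add N' = add N" "module.smult N' = module.smult N"
  shows "tensor_rel R M' N' \<subseteq> tensor_rel R M N"
proof (rule subrelI)
  fix u v assume "(u, v) \<in> tensor_rel R M' N'"
  then show "(u, v) \<in> tensor_rel R M N"
  proof (induction rule: tensor_rel.induct)
    case (sym u v)
    from sym.IH show ?case by (rule tensor_rel.sym)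
  next
    case (trans u v w)
    from trans.IH show ?case by (rule tensor_rel.trans)
  qed (simp_all add: assms tensor_rel.refl tensor_rel.append tensor_rel.comm tensor_rel.zero
      tensor_rel.add_left tensor_rel.add_right tensor_rel.smult)
qed

lemma tensor_class_cong:
  assumes "carrier M' = carrier M" "zero M' = zero M" "add M' = add M" "module.smult M' = module.smult M"
    and "carrier N' = carrier N" "add N' = add N" "module.smult N' = module.smult N"
  shows "tensor_class R M' N' = tensor_class R M N"
proof -
  have "tensor_rel R M' N' = tensor_rel R M N"
    by (intro equalityI tensor_rel_mono; simp add: assms)
  then show ?thesis by (intro ext) (simp add: tensor_class_def)
qed

lemma tensor_cong:
  assumes "carrier M' = carrier M" "mult M' = mult M" "one M' = one M"
    "zero M' = zero M" "add M' = add M" "module.smult M' = module.smult M"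
    and "carrier N' = carrier N" "mult N' = mult N" "one N' = one N"
    "zero N' = zero N" "add N' = add N" "module.smult N' = module.smult N"
  shows "tensor R M' N' = tensor R M N"
proof -
  have "tensor_class R M' N' = tensor_class R M N"
    by (rule tensor_class_cong) (simp_all add: assms)
  moreover have "tensor_rel R M' N' = tensor_rel R M N"
    by (intro equalityI tensor_rel_mono; simp add: assms)
  ultimately show ?thesis
    by (simp add: tensor_def assms)
qed

locale finite_group_functions = k: cring k + G: group G
  for k :: "('k, 'm) ring_scheme" and G :: "('g, 'q) monoid_scheme" +
  assumes fin: "finite (carrier G)"
begin

abbreviation H where "H \<equiv> fun_hopf k G"
abbreviation e where "e \<equiv> dirac k G"

lemma fun_hopf_simps:
  "carrier H = carrier G \<rightarrow>\<^sub>E carrier k"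
  "mult H = (\<lambda>u v. \<lambda>x\<in>carrier G. u x \<otimes>\<^bsub>k\<^esub> v x)"
  "one H = (\<lambda>x\<in>carrier G. \<one>\<^bsub>k\<^esub>)"
  "zero H = (\<lambda>x\<in>carrier G. \<zero>\<^bsub>k\<^esub>)"
  "add H = (\<lambda>u v. \<lambda>x\<in>carrier G. u x \<oplus>\<^bsub>k\<^esub> v x)"
  "module.smult H = (\<lambda>r u. \<lambda>x\<in>carrier G. r \<otimes>\<^bsub>k\<^esub> u x)"
  "comult H = fun_comult k G"
  "counit H u = u \<one>\<^bsub>G\<^esub>"
  by (simp_all add: fun_hopf_def fun_algebra_def module.defs)

lemma fun_value [simp]: "u \<in> carrier H \<Longrightarrow> x \<in> carrier G \<Longrightarrow> u x \<in> carrier k"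
  by (auto simp: fun_hopf_simps)

lemma fun_eqI:
  "u \<in> carrier H \<Longrightarrow> v \<in> carrier H \<Longrightarrow> (\<And>x. x \<in> carrier G \<Longrightarrow> u x = v x) \<Longrightarrow> u = v"
  by (auto simp: fun_hopf_simps intro: PiE_ext)

lemma H_closed [simp]:
  "u \<in> carrier H \<Longrightarrow> v \<in> carrier H \<Longrightarrow> u \<otimes>\<^bsub>H\<^esub> v \<in> carrier H"
  "u \<in> carrier H \<Longrightarrow> v \<in> carrier H \<Longrightarrow> u \<oplus>\<^bsub>H\<^esub> v \<in> carrier H"
  "r \<in> carrier k \<Longrightarrow> u \<in> carrier H \<Longrightarrow> r \<odot>\<^bsub>H\<^esub> u \<in> carrier H"
  "\<one>\<^bsub>H\<^esub> \<in> carrier H" "\<zero>\<^bsub>H\<^esub> \<in> carrier H"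
  by (auto simp: fun_hopf_simps PiE_mem)

lemma H_apply:
  assumes "x \<in> carrier G"
  shows "(u \<otimes>\<^bsub>H\<^esub> v) x = u x \<otimes>\<^bsub>k\<^esub> v x" "(u \<oplus>\<^bsub>H\<^esub> v) x = u x \<oplus>\<^bsub>k\<^esub> v x"
    "(r \<odot>\<^bsub>H\<^esub> u) x = r \<otimes>\<^bsub>k\<^esub> u x" "\<one>\<^bsub>H\<^esub> x = \<one>\<^bsub>k\<^esub>" "\<zero>\<^bsub>H\<^esub> x = \<zero>\<^bsub>k\<^esub>"
  using assms by (simp_all add: fun_hopf_simps)

lemma H_abelian_group: "abelian_group H"
proof (rule abelian_groupI)
  fix u assume u: "u \<in> carrier H"
  let ?v = "\<lambda>x\<in>carrier G. \<ominus>\<^bsub>k\<^esub> u x"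
  have v: "?v \<in> carrier H"
    using u by (auto simp: fun_hopf_simps PiE_mem)
  with u have "?v \<oplus>\<^bsub>H\<^esub> u = \<zero>\<^bsub>H\<^esub>"
    by (intro fun_eqI) (auto simp: H_apply k.l_neg)
  with v show "\<exists>v\<in>carrier H. v \<oplus>\<^bsub>H\<^esub> u = \<zero>\<^bsub>H\<^esub>" by blast
qed ((simp; fail) | (rule fun_eqI; simp add: H_apply k.a_ac))+

lemma H_assoc_algebra: "assoc_algebra k H"
  by (intro assoc_algebra.intro assoc_algebra_axioms.intro ringI monoidI moduleI)
    ((simp add: H_abelian_group k.cring_axioms; fail)
      | (rule fun_eqI; simp add: H_apply k.m_ac k.l_distr k.r_distr))+

sublocale H: assoc_algebra k H
  by (rule H_assoc_algebra)

sublocale HH: two_algebras k H H ..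

lemma dirac_closed [simp]: "g \<in> carrier G \<Longrightarrow> e g \<in> carrier H"
  by (auto simp: fun_hopf_simps dirac_def)

lemma dirac_apply: "x \<in> carrier G \<Longrightarrow> e g x = (if x = g then \<one>\<^bsub>k\<^esub> else \<zero>\<^bsub>k\<^esub>)"
  by (simp add: dirac_def)

lemma dirac_mult: "g \<in> carrier G \<Longrightarrow> h \<in> carrier G \<Longrightarrow> e g \<otimes>\<^bsub>H\<^esub> e h = (if h = g then e g else \<zero>\<^bsub>H\<^esub>)"
  by (auto simp: fun_hopf_simps dirac_def intro!: restrict_ext)

lemma finsum_apply:
  assumes "finite I" "\<And>i. i \<in> I \<Longrightarrow> u i \<in> carrier H" "x \<in> carrier G"
  shows "(\<Oplus>\<^bsub>H\<^esub>i\<in>I. u i) x = (\<Oplus>\<^bsub>k\<^esub>i\<in>I. u i x)"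
  by (rule additive_finsum[where f = "\<lambda>u. u x"])
    (use assms in \<open>auto simp: fun_hopf_simps(4,5) H.abelian_group_axioms k.abelian_group_axioms\<close>)

lemma finsum_delta:
  assumes "abelian_monoid P" "x \<in> carrier G" "\<And>y. y \<in> carrier G \<Longrightarrow> f y \<in> carrier P"
  shows "(\<Oplus>\<^bsub>P\<^esub>y\<in>carrier G. if y = x then f y else \<zero>\<^bsub>P\<^esub>) = f x"
proof -
  have "(\<lambda>y. if y = x then f y else \<zero>\<^bsub>P\<^esub>) = (\<lambda>y. if x = y then f y else \<zero>\<^bsub>P\<^esub>)"
    by auto
  with abelian_monoid.finsum_singleton[OF assms(1,2) fin, of f] assms(3) show ?thesis
    by auto
qed

lemma fun_expand:
  assumes "u \<in> carrier H"
  shows "u = (\<Oplus>\<^bsub>H\<^esub>g\<in>carrier G. u g \<odot>\<^bsub>H\<^esub> e g)"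
proof (rule fun_eqI)
  show c: "(\<Oplus>\<^bsub>H\<^esub>g\<in>carrier G. u g \<odot>\<^bsub>H\<^esub> e g) \<in> carrier H"
    using assms by (intro H.finsum_closed) auto
  fix x assume x: "x \<in> carrier G"
  have "(\<Oplus>\<^bsub>H\<^esub>g\<in>carrier G. u g \<odot>\<^bsub>H\<^esub> e g) x = (\<Oplus>\<^bsub>k\<^esub>g\<in>carrier G. (u g \<odot>\<^bsub>H\<^esub> e g) x)"
    using assms x by (intro finsum_apply fin) auto
  also have "\<dots> = (\<Oplus>\<^bsub>k\<^esub>g\<in>carrier G. if g = x then u g else \<zero>\<^bsub>k\<^esub>)"
    using assms x by (intro k.finsum_cong_closed) (auto simp: fun_hopf_simps(6) dirac_def)
  also have "\<dots> = u x"
    using assms x by (intro finsum_delta) (auto simp: k.abelian_monoid_axioms)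
  finally show "u x = (\<Oplus>\<^bsub>H\<^esub>g\<in>carrier G. u g \<odot>\<^bsub>H\<^esub> e g) x" ..
qed (fact assms)

lemma one_expand: "\<one>\<^bsub>H\<^esub> = (\<Oplus>\<^bsub>H\<^esub>g\<in>carrier G. e g)"
  by (subst fun_expand[OF H.one_closed])
    (rule H.finsum_cong_closed, auto intro!: fun_eqI simp: H_apply)

lemma left_translate_closed [simp]: "g \<in> carrier G \<Longrightarrow> u \<in> carrier H \<Longrightarrow> translate_left G g u \<in> carrier H"
  by (auto simp: fun_hopf_simps translate_left_def PiE_mem)

lemma right_translate_closed [simp]: "g \<in> carrier G \<Longrightarrow> u \<in> carrier H \<Longrightarrow> translate_right G g u \<in> carrier H"
  by (auto simp: fun_hopf_simps translate_right_def PiE_mem)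

lemma translate_left_apply: "x \<in> carrier G \<Longrightarrow> translate_left G g u x = u (g \<otimes>\<^bsub>G\<^esub> x)"
  by (simp add: translate_left_def)

lemma translate_right_apply: "x \<in> carrier G \<Longrightarrow> translate_right G g u x = u (x \<otimes>\<^bsub>G\<^esub> inv\<^bsub>G\<^esub> g)"
  by (simp add: translate_right_def)

lemma left_translation: "right_G_algebra k G H (\<lambda>u g. translate_left G g u)"
  by (rule right_G_algebraI)
    (auto simp: linear_on_def H_assoc_algebra G.is_group H_apply translate_left_apply G.m_assoc intro!: fun_eqI)

lemma right_translation: "right_G_algebra k G H (\<lambda>u g. translate_right G g u)"
  by (rule right_G_algebraI)
    (auto simp: linear_on_def H_assoc_algebra G.is_group H_apply translate_right_apply G.m_assoc
      G.inv_mult_group intro!: fun_eqI)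

lemma translations_commute:
  "g \<in> carrier G \<Longrightarrow> h \<in> carrier G \<Longrightarrow>
    translate_right G h (translate_left G g u) = translate_left G g (translate_right G h u)"
  by (auto simp: translate_right_def translate_left_def G.m_assoc intro!: restrict_ext)

text \<open>
  The comultiplication is defined over the bare algebra of functions; its value is the same in the
  tensor square of the Hopf algebra, since both records have the same operations.
\<close>

lemma fun_comult_eq:
  assumes "u \<in> carrier H"
  shows "comult H u = (\<Oplus>\<^bsub>HH.T\<^esub>g\<in>carrier G. \<Oplus>\<^bsub>HH.T\<^esub>h\<in>carrier G. HH.pure (u (g \<otimes>\<^bsub>G\<^esub> h) \<odot>\<^bsub>H\<^esub> e g) (e h))"
proof -
  let ?F = "fun_algebra k G"
  have T: "tensor k ?F ?F = HH.T"
    by (rule tensor_cong) (simp_all add: fun_hopf_simps fun_algebra_def)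
  have P: "tensor_class k ?F ?F = HH.cls"
    by (rule tensor_class_cong) (simp_all add: fun_hopf_simps fun_algebra_def)
  show ?thesis
    unfolding fun_hopf_simps(7) fun_comult_def Let_def T P
    by (intro HH.T.finsum_cong_closed HH.T.finsum_closed)
      (use assms in \<open>auto simp: HH.smult_pure intro!: HH.T.finsum_closed\<close>)
qed

text \<open>
  Collecting the terms with a common left factor shows that the comultiplication is the coaction
  belonging to the right action \<open>(u \<cdot> g)(x) = u(g x)\<close>. Collecting by the right factor instead gives
  lemma \<open>comult_right\<close>, with which the products \<open>x\<^sub>2 y\<^sub>2\<close> of a cocycle condition become products
  of two Dirac functions and one of two summations collapses.
\<close>

lemma comult_left:
  assumes u: "u \<in> carrier H"
  shows "comult H u = (\<Oplus>\<^bsub>HH.T\<^esub>g\<in>carrier G. HH.pure (e g) (translate_left G g u))"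
proof -
  have "HH.pure (e g) (translate_left G g u) = (\<Oplus>\<^bsub>HH.T\<^esub>h\<in>carrier G. HH.pure (u (g \<otimes>\<^bsub>G\<^esub> h) \<odot>\<^bsub>H\<^esub> e g) (e h))"
    if g: "g \<in> carrier G" for g
  proof -
    have [simp]: "translate_left G g u h = u (g \<otimes>\<^bsub>G\<^esub> h)" if "h \<in> carrier G" for h
      using that by (simp add: translate_left_def)
    have [simp]: "u (g \<otimes>\<^bsub>G\<^esub> h) \<in> carrier k" if "h \<in> carrier G" for h
      using that u g by auto
    have "HH.pure (e g) (translate_left G g u) =
      HH.pure (e g) (\<Oplus>\<^bsub>H\<^esub>h\<in>carrier G. translate_left G g u h \<odot>\<^bsub>H\<^esub> e h)"
      using fun_expand[OF left_translate_closed[OF g u]] by simp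
    also have "\<dots> = (\<Oplus>\<^bsub>HH.T\<^esub>h\<in>carrier G. HH.pure (e g) (translate_left G g u h \<odot>\<^bsub>H\<^esub> e h))"
      using g by (intro balanced_finsum_right[OF _ _ HH.balanced_pure] fin H.abelian_group_axioms
          HH.T.abelian_group_axioms H.smult_closed dirac_closed) auto
    also have "\<dots> = (\<Oplus>\<^bsub>HH.T\<^esub>h\<in>carrier G. HH.pure (u (g \<otimes>\<^bsub>G\<^esub> h) \<odot>\<^bsub>H\<^esub> e g) (e h))"
      using g by (intro HH.T.finsum_cong_closed)
        (simp_all add: balancedD(4)[OF HH.balanced_pure] H.smult_closed)
    finally show ?thesis .
  qed
  then show ?thesis
    unfolding fun_comult_eq[OF u]
    using u by (intro HH.T.finsum_cong_closed HH.pure_closed dirac_closed left_translate_closed) auto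
qed

lemma comult_right:
  assumes u: "u \<in> carrier H"
  shows "comult H u = (\<Oplus>\<^bsub>HH.T\<^esub>h\<in>carrier G. HH.pure (translate_right G (inv\<^bsub>G\<^esub> h) u) (e h))"
proof -
  have uc [simp]: "u (g \<otimes>\<^bsub>G\<^esub> h) \<in> carrier k" if "g \<in> carrier G" "h \<in> carrier G" for g h
    using that u by auto
  have "HH.pure (translate_right G (inv\<^bsub>G\<^esub> h) u) (e h) = (\<Oplus>\<^bsub>HH.T\<^esub>g\<in>carrier G. HH.pure (u (g \<otimes>\<^bsub>G\<^esub> h) \<odot>\<^bsub>H\<^esub> e g) (e h))"
    if h: "h \<in> carrier G" for h
  proof -
    have tr [simp]: "translate_right G (inv\<^bsub>G\<^esub> h) u g = u (g \<otimes>\<^bsub>G\<^esub> h)" if "g \<in> carrier G" for g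
      using that h by (simp add: translate_right_def)
    have "HH.pure (translate_right G (inv\<^bsub>G\<^esub> h) u) (e h) =
      HH.pure (\<Oplus>\<^bsub>H\<^esub>g\<in>carrier G. translate_right G (inv\<^bsub>G\<^esub> h) u g \<odot>\<^bsub>H\<^esub> e g) (e h)"
      using fun_expand[OF right_translate_closed[OF G.inv_closed[OF h] u]] by simp
    also have "\<dots> = (\<Oplus>\<^bsub>HH.T\<^esub>g\<in>carrier G. HH.pure (translate_right G (inv\<^bsub>G\<^esub> h) u g \<odot>\<^bsub>H\<^esub> e g) (e h))"
      using h by (intro balanced_finsum_left[OF _ _ HH.balanced_pure] fin H.abelian_group_axioms
          HH.T.abelian_group_axioms H.smult_closed dirac_closed) auto
    also have "\<dots> = (\<Oplus>\<^bsub>HH.T\<^esub>g\<in>carrier G. HH.pure (u (g \<otimes>\<^bsub>G\<^esub> h) \<odot>\<^bsub>H\<^esub> e g) (e h))"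
      using h by (intro HH.T.finsum_cong_closed)
        (simp_all add: H.smult_closed)
    finally show ?thesis .
  qed
  moreover have "comult H u = (\<Oplus>\<^bsub>HH.T\<^esub>h\<in>carrier G. \<Oplus>\<^bsub>HH.T\<^esub>g\<in>carrier G. HH.pure (u (g \<otimes>\<^bsub>G\<^esub> h) \<odot>\<^bsub>H\<^esub> e g) (e h))"
    unfolding fun_comult_eq[OF u]
    by (intro HH.T.finsum_swap fin HH.pure_closed H.smult_closed dirac_closed uc)
  ultimately show ?thesis
    using u by (simp only:) (intro HH.T.finsum_cong_closed HH.pure_closed dirac_closed right_translate_closed; simp)
qed

lemma comult_dirac_right:
  assumes "g \<in> carrier G"
  shows "comult H (e g) = (\<Oplus>\<^bsub>HH.T\<^esub>x\<in>carrier G. HH.pure (e (g \<otimes>\<^bsub>G\<^esub> inv\<^bsub>G\<^esub> x)) (e x))"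
  unfolding comult_right[OF dirac_closed[OF assms]]
  using assms by (intro HH.T.finsum_cong_closed) (auto simp: translate_right_dirac G.group_axioms)

lemma comult_dirac_left:
  assumes "g \<in> carrier G"
  shows "comult H (e g) = (\<Oplus>\<^bsub>HH.T\<^esub>x\<in>carrier G. HH.pure (e x) (e (inv\<^bsub>G\<^esub> x \<otimes>\<^bsub>G\<^esub> g)))"
  unfolding comult_left[OF dirac_closed[OF assms]]
  using assms by (intro HH.T.finsum_cong_closed) (auto simp: translate_left_dirac G.group_axioms)

lemma comult_one: "comult H \<one>\<^bsub>H\<^esub> = HH.pure \<one>\<^bsub>H\<^esub> \<one>\<^bsub>H\<^esub>"
proof -
  have "translate_left G g \<one>\<^bsub>H\<^esub> = \<one>\<^bsub>H\<^esub>" if "g \<in> carrier G" for g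
    using that by (auto simp: fun_hopf_simps translate_left_def intro!: restrict_ext)
  then have "comult H \<one>\<^bsub>H\<^esub> = (\<Oplus>\<^bsub>HH.T\<^esub>g\<in>carrier G. HH.pure (e g) \<one>\<^bsub>H\<^esub>)"
    unfolding comult_left[OF H.one_closed]
    by (intro HH.T.finsum_cong_closed HH.pure_closed dirac_closed H.one_closed; simp)
  also have "\<dots> = HH.pure (\<Oplus>\<^bsub>H\<^esub>g\<in>carrier G. e g) \<one>\<^bsub>H\<^esub>"
    by (intro balanced_finsum_left[OF _ _ HH.balanced_pure, symmetric] fin H.abelian_group_axioms
        HH.T.abelian_group_axioms dirac_closed H.one_closed)
  finally show ?thesis by (simp only: one_expand[symmetric])
qed

lemma comult_closed: "u \<in> carrier H \<Longrightarrow> comult H u \<in> carrier HH.T"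
  unfolding comult_left by (intro HH.T.finsum_closed) auto

end

section \<open>The matrix of a lazy two-cocycle\<close>

lemma (in two_modules) sweedler_sweedler:
  assumes P: "abelian_group P"
    and 1: "\<And>x y. x \<in> carrier M \<Longrightarrow> y \<in> carrier N \<Longrightarrow> balanced R M N P (q x y)"
    and 2: "\<And>m n. m \<in> carrier M \<Longrightarrow> n \<in> carrier N \<Longrightarrow> balanced R M N P (\<lambda>x y. q x y m n)"
    and I: "finite I" "\<And>i. i \<in> I \<Longrightarrow> a i \<in> carrier M" "\<And>i. i \<in> I \<Longrightarrow> b i \<in> carrier N"
    and J: "finite J" "\<And>j. j \<in> J \<Longrightarrow> c j \<in> carrier M" "\<And>j. j \<in> J \<Longrightarrow> d j \<in> carrier N"
  shows "sweedler P (\<lambda>m n. sweedler P (q m n) (\<Oplus>\<^bsub>T\<^esub>j\<in>J. pure (c j) (d j))) (\<Oplus>\<^bsub>T\<^esub>i\<in>I. pure (a i) (b i)) =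
    (\<Oplus>\<^bsub>P\<^esub>i\<in>I. \<Oplus>\<^bsub>P\<^esub>j\<in>J. q (a i) (b i) (c j) (d j))"
proof -
  interpret P: abelian_group P by fact
  have s: "(\<Oplus>\<^bsub>T\<^esub>j\<in>J. pure (c j) (d j)) \<in> carrier T"
    using J by (intro T.finsum_closed) auto
  have inner: "sweedler P (q x y) (\<Oplus>\<^bsub>T\<^esub>j\<in>J. pure (c j) (d j)) = (\<Oplus>\<^bsub>P\<^esub>j\<in>J. q x y (c j) (d j))"
    if "x \<in> carrier M" "y \<in> carrier N" for x y
    using that J by (simp add: sweedler_finsum[OF P 1] sweedler_pure[OF P 1] balancedD(1)[OF 1]
        cong: P.finsum_cong_closed)
  have b: "balanced R M N P (\<lambda>m n. sweedler P (q m n) (\<Oplus>\<^bsub>T\<^esub>j\<in>J. pure (c j) (d j)))"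
    by (rule balanced_sweedler[OF P 1 2 M.module_axioms N.module_axioms s])
  show ?thesis
    using I J by (simp add: sweedler_finsum[OF P b] sweedler_pure[OF P b] inner balancedD(1)[OF 1]
        P.finsum_closed Pi_def cong: P.finsum_cong_closed)
qed

context finite_group_functions
begin

context
  fixes P :: "('c, 'x) ring_scheme" and q
  assumes P: "abelian_group P"
    and 1: "\<And>x y. x \<in> carrier H \<Longrightarrow> y \<in> carrier H \<Longrightarrow> balanced k H H P (q x y)"
    and 2: "\<And>m n. m \<in> carrier H \<Longrightarrow> n \<in> carrier H \<Longrightarrow> balanced k H H P (\<lambda>x y. q x y m n)"
begin

interpretation P: abelian_group P by (rule P)

lemma sweedler_comult_right:
  assumes "g \<in> carrier G" "h \<in> carrier G"
  shows "sweedler P (\<lambda>x1 x2. sweedler P (q x1 x2) (comult H (e h))) (comult H (e g)) =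
    (\<Oplus>\<^bsub>P\<^esub>x\<in>carrier G. \<Oplus>\<^bsub>P\<^esub>y\<in>carrier G. q (e (g \<otimes>\<^bsub>G\<^esub> inv\<^bsub>G\<^esub> x)) (e x) (e (h \<otimes>\<^bsub>G\<^esub> inv\<^bsub>G\<^esub> y)) (e y))"
proof -
  show ?thesis
    unfolding assms[THEN comult_dirac_right]
    by (rule HH.sweedler_sweedler[OF P 1 2]; simp add: fin assms)
qed

lemma sweedler_comult_left:
  assumes "g \<in> carrier G" "h \<in> carrier G"
  shows "sweedler P (\<lambda>x1 x2. sweedler P (q x1 x2) (comult H (e h))) (comult H (e g)) =
    (\<Oplus>\<^bsub>P\<^esub>x\<in>carrier G. \<Oplus>\<^bsub>P\<^esub>y\<in>carrier G. q (e x) (e (inv\<^bsub>G\<^esub> x \<otimes>\<^bsub>G\<^esub> g)) (e y) (e (inv\<^bsub>G\<^esub> y \<otimes>\<^bsub>G\<^esub> h)))"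
proof -
  show ?thesis
    unfolding assms[THEN comult_dirac_left]
    by (rule HH.sweedler_sweedler[OF P 1 2]; simp add: fin assms)
qed

lemma sweedler_comult_one:
  "sweedler P (\<lambda>x1 x2. sweedler P (q x1 x2) (comult H \<one>\<^bsub>H\<^esub>)) (comult H \<one>\<^bsub>H\<^esub>) = q \<one>\<^bsub>H\<^esub> \<one>\<^bsub>H\<^esub> \<one>\<^bsub>H\<^esub> \<one>\<^bsub>H\<^esub>"
proof -
  have b: "balanced k H H P (\<lambda>m n. sweedler P (q m n) (HH.pure \<one>\<^bsub>H\<^esub> \<one>\<^bsub>H\<^esub>))"
    by (rule HH.balanced_sweedler[OF P 1 2 H.module_axioms H.module_axioms]) simp_all
  show ?thesis
    by (simp add: comult_one HH.sweedler_pure[OF P b] HH.sweedler_pure[OF P 1])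
qed

lemma sweedler_comult_dirac_one:
  assumes "g \<in> carrier G"
  shows "sweedler P (\<lambda>x1 x2. sweedler P (q x1 x2) (comult H \<one>\<^bsub>H\<^esub>)) (comult H (e g)) =
    (\<Oplus>\<^bsub>P\<^esub>x\<in>carrier G. q (e (g \<otimes>\<^bsub>G\<^esub> inv\<^bsub>G\<^esub> x)) (e x) \<one>\<^bsub>H\<^esub> \<one>\<^bsub>H\<^esub>)"
proof -
  have b: "balanced k H H P (\<lambda>m n. sweedler P (q m n) (HH.pure \<one>\<^bsub>H\<^esub> \<one>\<^bsub>H\<^esub>))"
    by (rule HH.balanced_sweedler[OF P 1 2 H.module_axioms H.module_axioms]) simp_all
  show ?thesis
    using comult_dirac_right[OF assms] assms
    by (simp add: comult_one HH.sweedler_finsum[OF P b fin] HH.sweedler_pure[OF P b] HH.sweedler_pure[OF P 1]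
        balancedD(1)[OF 1] cong: P.finsum_cong_closed)
qed

lemma sweedler_comult_one_dirac:
  assumes "g \<in> carrier G"
  shows "sweedler P (\<lambda>x1 x2. sweedler P (q x1 x2) (comult H (e g))) (comult H \<one>\<^bsub>H\<^esub>) =
    (\<Oplus>\<^bsub>P\<^esub>x\<in>carrier G. q \<one>\<^bsub>H\<^esub> \<one>\<^bsub>H\<^esub> (e (g \<otimes>\<^bsub>G\<^esub> inv\<^bsub>G\<^esub> x)) (e x))"
proof -
  have b: "balanced k H H P (\<lambda>m n. sweedler P (q m n) (comult H (e g)))"
    by (rule HH.balanced_sweedler[OF P 1 2 H.module_axioms H.module_axioms]) (simp_all add: comult_closed assms)
  show ?thesis
    using comult_dirac_right[OF assms] assms
    by (simp add: comult_one HH.sweedler_pure[OF P b[unfolded comult_dirac_right[OF assms]]] HH.sweedler_finsum[OF P 1 fin]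
        HH.sweedler_pure[OF P 1] balancedD(1)[OF 1] cong: P.finsum_cong_closed)
qed

end

lemma finsum_right_translate:
  assumes "abelian_monoid P" "x \<in> carrier G" "\<And>y. y \<in> carrier G \<Longrightarrow> f y \<in> carrier P"
  shows "(\<Oplus>\<^bsub>P\<^esub>y\<in>carrier G. f (y \<otimes>\<^bsub>G\<^esub> x)) = (\<Oplus>\<^bsub>P\<^esub>y\<in>carrier G. f y)"
proof -
  interpret P: abelian_monoid P by fact
  have "inj_on (\<lambda>y. y \<otimes>\<^bsub>G\<^esub> x) (carrier G)"
    using assms(2) by (auto intro: inj_onI)
  moreover have "(\<lambda>y. y \<otimes>\<^bsub>G\<^esub> x) ` carrier G = carrier G"
    by (rule endo_inj_surj[OF fin _ calculation]) (use assms(2) in auto)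
  ultimately show ?thesis
    using P.finsum_reindex[of f "\<lambda>y. y \<otimes>\<^bsub>G\<^esub> x" "carrier G"] assms by auto
qed

lemma finsum_left_translate:
  assumes "abelian_monoid P" "x \<in> carrier G" "\<And>y. y \<in> carrier G \<Longrightarrow> f y \<in> carrier P"
  shows "(\<Oplus>\<^bsub>P\<^esub>y\<in>carrier G. f (x \<otimes>\<^bsub>G\<^esub> y)) = (\<Oplus>\<^bsub>P\<^esub>y\<in>carrier G. f y)"
proof -
  interpret P: abelian_monoid P by fact
  have "inj_on (\<lambda>y. x \<otimes>\<^bsub>G\<^esub> y) (carrier G)"
    using assms(2) by (auto intro: inj_onI)
  moreover have "(\<lambda>y. x \<otimes>\<^bsub>G\<^esub> y) ` carrier G = carrier G"
    by (rule endo_inj_surj[OF fin _ calculation]) (use assms(2) in auto)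
  ultimately show ?thesis
    using P.finsum_reindex[of f "\<lambda>y. x \<otimes>\<^bsub>G\<^esub> y" "carrier G"] assms by auto
qed

text \<open>
  In the group algebra \<open>k[G]\<close>, the hypotheses say \<open>t f = 1\<close> and \<open>f f = c f\<close>. Cancelling \<open>f\<close> on the
  left gives \<open>f = c 1\<close>.
\<close>

lemma quasi_idempotent_unit:
  assumes closed: "\<And>x. x \<in> carrier G \<Longrightarrow> f x \<in> carrier k" "\<And>x. x \<in> carrier G \<Longrightarrow> t x \<in> carrier k" "c \<in> carrier k"
    and inverse: "\<And>g. g \<in> carrier G \<Longrightarrow>
      (\<Oplus>\<^bsub>k\<^esub>x\<in>carrier G. t (g \<otimes>\<^bsub>G\<^esub> inv\<^bsub>G\<^esub> x) \<otimes>\<^bsub>k\<^esub> f x) = (if g = \<one>\<^bsub>G\<^esub> then \<one>\<^bsub>k\<^esub> else \<zero>\<^bsub>k\<^esub>)"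
    and square: "\<And>g. g \<in> carrier G \<Longrightarrow> (\<Oplus>\<^bsub>k\<^esub>x\<in>carrier G. f (g \<otimes>\<^bsub>G\<^esub> inv\<^bsub>G\<^esub> x) \<otimes>\<^bsub>k\<^esub> f x) = c \<otimes>\<^bsub>k\<^esub> f g"
    and g: "g \<in> carrier G"
  shows "f g = (if g = \<one>\<^bsub>G\<^esub> then c else \<zero>\<^bsub>k\<^esub>)"
proof -
  note [simp] = closed k.finsum_closed Pi_def
  have shift: "(\<Oplus>\<^bsub>k\<^esub>x\<in>carrier G. t (g \<otimes>\<^bsub>G\<^esub> inv\<^bsub>G\<^esub> x) \<otimes>\<^bsub>k\<^esub> f (x \<otimes>\<^bsub>G\<^esub> inv\<^bsub>G\<^esub> y)) = (if y = g then \<one>\<^bsub>k\<^esub> else \<zero>\<^bsub>k\<^esub>)"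
    if y: "y \<in> carrier G" for y
  proof -
    have "(\<Oplus>\<^bsub>k\<^esub>x\<in>carrier G. t (g \<otimes>\<^bsub>G\<^esub> inv\<^bsub>G\<^esub> x) \<otimes>\<^bsub>k\<^esub> f (x \<otimes>\<^bsub>G\<^esub> inv\<^bsub>G\<^esub> y)) =
      (\<Oplus>\<^bsub>k\<^esub>x\<in>carrier G. t (g \<otimes>\<^bsub>G\<^esub> inv\<^bsub>G\<^esub> (x \<otimes>\<^bsub>G\<^esub> y)) \<otimes>\<^bsub>k\<^esub> f (x \<otimes>\<^bsub>G\<^esub> y \<otimes>\<^bsub>G\<^esub> inv\<^bsub>G\<^esub> y))"
      using g y by (intro finsum_right_translate[symmetric] k.abelian_monoid_axioms k.m_closed closed) simp_all
    also have "\<dots> = (\<Oplus>\<^bsub>k\<^esub>x\<in>carrier G. t (g \<otimes>\<^bsub>G\<^esub> inv\<^bsub>G\<^esub> y \<otimes>\<^bsub>G\<^esub> inv\<^bsub>G\<^esub> x) \<otimes>\<^bsub>k\<^esub> f x)"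
      using g y by (intro k.finsum_cong_closed) (simp_all add: G.inv_mult_group G.m_assoc)
    also have "\<dots> = (if g \<otimes>\<^bsub>G\<^esub> inv\<^bsub>G\<^esub> y = \<one>\<^bsub>G\<^esub> then \<one>\<^bsub>k\<^esub> else \<zero>\<^bsub>k\<^esub>)"
      using g y by (intro inverse) simp
    also have "g \<otimes>\<^bsub>G\<^esub> inv\<^bsub>G\<^esub> y = \<one>\<^bsub>G\<^esub> \<longleftrightarrow> y = g"
      using g y by (metis G.inv_solve_right' G.l_one G.one_closed)
    finally show ?thesis .
  qed
  have "c \<otimes>\<^bsub>k\<^esub> (if g = \<one>\<^bsub>G\<^esub> then \<one>\<^bsub>k\<^esub> else \<zero>\<^bsub>k\<^esub>) = c \<otimes>\<^bsub>k\<^esub> (\<Oplus>\<^bsub>k\<^esub>x\<in>carrier G. t (g \<otimes>\<^bsub>G\<^esub> inv\<^bsub>G\<^esub> x) \<otimes>\<^bsub>k\<^esub> f x)"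
    using inverse[OF g] by simp
  also have "\<dots> = (\<Oplus>\<^bsub>k\<^esub>x\<in>carrier G. t (g \<otimes>\<^bsub>G\<^esub> inv\<^bsub>G\<^esub> x) \<otimes>\<^bsub>k\<^esub> (\<Oplus>\<^bsub>k\<^esub>y\<in>carrier G. f (x \<otimes>\<^bsub>G\<^esub> inv\<^bsub>G\<^esub> y) \<otimes>\<^bsub>k\<^esub> f y))"
    using g fin by (simp add: k.finsum_rdistr k.m_lcomm square cong: k.finsum_cong_closed)
  also have "\<dots> = (\<Oplus>\<^bsub>k\<^esub>x\<in>carrier G. \<Oplus>\<^bsub>k\<^esub>y\<in>carrier G. t (g \<otimes>\<^bsub>G\<^esub> inv\<^bsub>G\<^esub> x) \<otimes>\<^bsub>k\<^esub> (f (x \<otimes>\<^bsub>G\<^esub> inv\<^bsub>G\<^esub> y) \<otimes>\<^bsub>k\<^esub> f y))"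
    using g fin by (intro k.finsum_cong_closed) (simp_all add: k.finsum_rdistr)
  also have "\<dots> = (\<Oplus>\<^bsub>k\<^esub>y\<in>carrier G. \<Oplus>\<^bsub>k\<^esub>x\<in>carrier G. t (g \<otimes>\<^bsub>G\<^esub> inv\<^bsub>G\<^esub> x) \<otimes>\<^bsub>k\<^esub> (f (x \<otimes>\<^bsub>G\<^esub> inv\<^bsub>G\<^esub> y) \<otimes>\<^bsub>k\<^esub> f y))"
    using g by (intro k.finsum_swap fin) simp
  also have "\<dots> = (\<Oplus>\<^bsub>k\<^esub>y\<in>carrier G. (\<Oplus>\<^bsub>k\<^esub>x\<in>carrier G. t (g \<otimes>\<^bsub>G\<^esub> inv\<^bsub>G\<^esub> x) \<otimes>\<^bsub>k\<^esub> f (x \<otimes>\<^bsub>G\<^esub> inv\<^bsub>G\<^esub> y)) \<otimes>\<^bsub>k\<^esub> f y)"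
    using g fin by (intro k.finsum_cong_closed) (simp_all add: k.finsum_ldistr k.m_assoc cong: k.finsum_cong_closed)
  also have "\<dots> = (\<Oplus>\<^bsub>k\<^esub>y\<in>carrier G. if y = g then f y else \<zero>\<^bsub>k\<^esub>)"
    using g by (intro k.finsum_cong_closed) (simp_all add: shift)
  also have "\<dots> = f g"
    using g by (intro finsum_delta k.abelian_monoid_axioms) simp_all
  finally show ?thesis
    using closed by (auto split: if_splits)
qed

end

locale lazy_cocycle = finite_group_functions k G
  for k :: "('k, 'm) ring_scheme" and G :: "('g, 'q) monoid_scheme" +
  fixes \<sigma> :: "('g \<Rightarrow> 'k) \<Rightarrow> ('g \<Rightarrow> 'k) \<Rightarrow> 'k"
  assumes cocycle: "two_cocycle k H \<sigma>" and lazy: "lazy k H \<sigma>"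
begin

text \<open>
  The two-cocycle is determined by its values on Dirac functions. Its value at \<open>(1, 1)\<close> is the
  constant by which the unit of a twisted algebra has to be corrected.
\<close>

definition kernel where "kernel g h = \<sigma> (e g) (e h)"
definition norm_const where "norm_const = \<sigma> \<one>\<^bsub>H\<^esub> \<one>\<^bsub>H\<^esub>"

lemma form: "bilinear_form k H \<sigma>"
  using cocycle by (simp add: two_cocycle_def)

lemma bilinear_formD:
  assumes "bilinear_form k H \<tau>" "x \<in> carrier H" "y \<in> carrier H"
  shows "\<tau> x y \<in> carrier k"
    and "x' \<in> carrier H \<Longrightarrow> \<tau> (x \<oplus>\<^bsub>H\<^esub> x') y = \<tau> x y \<oplus>\<^bsub>k\<^esub> \<tau> x' y"
    and "y' \<in> carrier H \<Longrightarrow> \<tau> x (y \<oplus>\<^bsub>H\<^esub> y') = \<tau> x y \<oplus>\<^bsub>k\<^esub> \<tau> x y'"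
    and "r \<in> carrier k \<Longrightarrow> \<tau> (r \<odot>\<^bsub>H\<^esub> x) y = r \<otimes>\<^bsub>k\<^esub> \<tau> x y"
    and "r \<in> carrier k \<Longrightarrow> \<tau> x (r \<odot>\<^bsub>H\<^esub> y) = r \<otimes>\<^bsub>k\<^esub> \<tau> x y"
  using assms unfolding bilinear_form_def by blast+

lemmas form_simps = bilinear_formD[OF form]

lemma kernel_closed [simp]: "g \<in> carrier G \<Longrightarrow> h \<in> carrier G \<Longrightarrow> kernel g h \<in> carrier k"
  by (simp add: kernel_def form_simps)

lemma norm_const_closed [simp]: "norm_const \<in> carrier k"
  by (simp add: norm_const_def form_simps)

lemma cocycle_left_balanced:
  assumes "z \<in> carrier H" "x \<in> carrier H" "y \<in> carrier H"
  shows "balanced k H H k (\<lambda>y1 y2. \<sigma> x y1 \<otimes>\<^bsub>k\<^esub> \<sigma> (y \<otimes>\<^bsub>H\<^esub> y2) z)"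
    and "balanced k H H k (\<lambda>x1 x2. \<sigma> x1 x \<otimes>\<^bsub>k\<^esub> \<sigma> (x2 \<otimes>\<^bsub>H\<^esub> y) z)"
  by (rule balancedI; use assms in \<open>simp add: form_simps k.l_distr k.r_distr k.m_ac H.l_distr H.r_distr
        H.smult_mult_left H.smult_mult_right\<close>)+

lemma cocycle_right_balanced:
  assumes "z \<in> carrier H" "x \<in> carrier H" "y \<in> carrier H"
  shows "balanced k H H k (\<lambda>y1 y2. \<sigma> x y1 \<otimes>\<^bsub>k\<^esub> \<sigma> z (y \<otimes>\<^bsub>H\<^esub> y2))"
    and "balanced k H H k (\<lambda>x1 x2. \<sigma> x1 x \<otimes>\<^bsub>k\<^esub> \<sigma> z (x2 \<otimes>\<^bsub>H\<^esub> y))"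
  by (rule balancedI; use assms in \<open>simp add: form_simps k.l_distr k.r_distr k.m_ac H.l_distr H.r_distr
        H.smult_mult_left H.smult_mult_right\<close>)+

lemma convolution_balanced:
  assumes "bilinear_form k H \<tau>" "bilinear_form k H \<rho>" "x \<in> carrier H" "y \<in> carrier H"
  shows "balanced k H H k (\<lambda>y1 y2. \<tau> x y1 \<otimes>\<^bsub>k\<^esub> \<rho> y y2)"
    and "balanced k H H k (\<lambda>x1 x2. \<tau> x1 x \<otimes>\<^bsub>k\<^esub> \<rho> x2 y)"
  by (rule balancedI; use assms(3,4) in \<open>simp add: bilinear_formD[OF assms(1)] bilinear_formD[OF assms(2)]
        k.l_distr k.r_distr k.m_ac\<close>)+

lemma lazy_balanced:
  assumes "x \<in> carrier H" "y \<in> carrier H"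
  shows "balanced k H H H (\<lambda>y1 y2. \<sigma> x y1 \<odot>\<^bsub>H\<^esub> (y \<otimes>\<^bsub>H\<^esub> y2))"
    and "balanced k H H H (\<lambda>x1 x2. \<sigma> x1 x \<odot>\<^bsub>H\<^esub> (x2 \<otimes>\<^bsub>H\<^esub> y))"
    and "balanced k H H H (\<lambda>y1 y2. \<sigma> x y2 \<odot>\<^bsub>H\<^esub> (y \<otimes>\<^bsub>H\<^esub> y1))"
    and "balanced k H H H (\<lambda>x1 x2. \<sigma> x2 x \<odot>\<^bsub>H\<^esub> (x1 \<otimes>\<^bsub>H\<^esub> y))"
  by (rule balancedI; use assms in \<open>simp add: form_simps k.m_ac H.l_distr H.r_distr
        H.smult_mult_left H.smult_mult_right H.smult_l_distr H.smult_r_distr flip: H.smult_assoc1\<close>)+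

lemma cocycle_eq:
  assumes "x \<in> carrier H" "y \<in> carrier H" "z \<in> carrier H"
  shows "sweedler k (\<lambda>x1 x2. sweedler k (\<lambda>y1 y2. \<sigma> x1 y1 \<otimes>\<^bsub>k\<^esub> \<sigma> (x2 \<otimes>\<^bsub>H\<^esub> y2) z) (comult H y)) (comult H x) =
       sweedler k (\<lambda>y1 y2. sweedler k (\<lambda>z1 z2. \<sigma> y1 z1 \<otimes>\<^bsub>k\<^esub> \<sigma> x (y2 \<otimes>\<^bsub>H\<^esub> z2)) (comult H z)) (comult H y)"
  using cocycle assms unfolding two_cocycle_def by blast

lemma form_zero: "x \<in> carrier H \<Longrightarrow> \<sigma> \<zero>\<^bsub>H\<^esub> x = \<zero>\<^bsub>k\<^esub>" "x \<in> carrier H \<Longrightarrow> \<sigma> x \<zero>\<^bsub>H\<^esub> = \<zero>\<^bsub>k\<^esub>"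
  using form_simps(4)[of "\<zero>\<^bsub>H\<^esub>" x "\<zero>\<^bsub>k\<^esub>"] form_simps(5)[of x "\<zero>\<^bsub>H\<^esub>" "\<zero>\<^bsub>k\<^esub>"] by (simp_all add: form_simps)

text \<open>
  The cocycle identity at \<open>(e\<^sub>u, e\<^sub>v, e\<^sub>w)\<close>. On either side two summation variables remain, and the
  product \<open>e\<^sub>x e\<^sub>y\<close> vanishes unless they agree.
\<close>

lemma kernel_cocycle:
  assumes "u \<in> carrier G" "v \<in> carrier G" "w \<in> carrier G"
  shows "(\<Oplus>\<^bsub>k\<^esub>x\<in>carrier G. kernel (u \<otimes>\<^bsub>G\<^esub> inv\<^bsub>G\<^esub> x) (v \<otimes>\<^bsub>G\<^esub> inv\<^bsub>G\<^esub> x) \<otimes>\<^bsub>k\<^esub> kernel x w) =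
    (\<Oplus>\<^bsub>k\<^esub>x\<in>carrier G. kernel (v \<otimes>\<^bsub>G\<^esub> inv\<^bsub>G\<^esub> x) (w \<otimes>\<^bsub>G\<^esub> inv\<^bsub>G\<^esub> x) \<otimes>\<^bsub>k\<^esub> kernel u x)"
proof -
  have collapse: "(\<Oplus>\<^bsub>k\<^esub>x\<in>carrier G. \<Oplus>\<^bsub>k\<^esub>y\<in>carrier G. a x y \<otimes>\<^bsub>k\<^esub> b (e x \<otimes>\<^bsub>H\<^esub> e y)) =
      (\<Oplus>\<^bsub>k\<^esub>x\<in>carrier G. a x x \<otimes>\<^bsub>k\<^esub> b (e x))"
    if a: "\<And>x y. x \<in> carrier G \<Longrightarrow> y \<in> carrier G \<Longrightarrow> a x y \<in> carrier k"
      and b: "\<And>x. x \<in> carrier H \<Longrightarrow> b x \<in> carrier k" "b \<zero>\<^bsub>H\<^esub> = \<zero>\<^bsub>k\<^esub>" for a b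
  proof (rule k.finsum_cong_closed)
    fix x assume x: "x \<in> carrier G"
    have "(\<Oplus>\<^bsub>k\<^esub>y\<in>carrier G. a x y \<otimes>\<^bsub>k\<^esub> b (e x \<otimes>\<^bsub>H\<^esub> e y)) =
      (\<Oplus>\<^bsub>k\<^esub>y\<in>carrier G. if y = x then a x y \<otimes>\<^bsub>k\<^esub> b (e x) else \<zero>\<^bsub>k\<^esub>)"
      using x by (intro k.finsum_cong_closed) (auto simp: dirac_mult a b)
    also have "\<dots> = a x x \<otimes>\<^bsub>k\<^esub> b (e x)"
      using x by (intro finsum_delta) (auto simp: a b k.abelian_monoid_axioms)
    finally show "(\<Oplus>\<^bsub>k\<^esub>y\<in>carrier G. a x y \<otimes>\<^bsub>k\<^esub> b (e x \<otimes>\<^bsub>H\<^esub> e y)) = a x x \<otimes>\<^bsub>k\<^esub> b (e x)" .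
  qed (use a b in auto)
  have "(\<Oplus>\<^bsub>k\<^esub>x\<in>carrier G. kernel (u \<otimes>\<^bsub>G\<^esub> inv\<^bsub>G\<^esub> x) (v \<otimes>\<^bsub>G\<^esub> inv\<^bsub>G\<^esub> x) \<otimes>\<^bsub>k\<^esub> kernel x w) =
    sweedler k (\<lambda>x1 x2. sweedler k (\<lambda>y1 y2. \<sigma> x1 y1 \<otimes>\<^bsub>k\<^esub> \<sigma> (x2 \<otimes>\<^bsub>H\<^esub> y2) (e w)) (comult H (e v))) (comult H (e u))"
    unfolding kernel_def using assms
    by (subst sweedler_comult_right[OF k.abelian_group_axioms cocycle_left_balanced])
      (auto intro!: collapse[symmetric] form_simps(1) form_zero)
  also have "\<dots> = (\<Oplus>\<^bsub>k\<^esub>x\<in>carrier G. kernel (v \<otimes>\<^bsub>G\<^esub> inv\<^bsub>G\<^esub> x) (w \<otimes>\<^bsub>G\<^esub> inv\<^bsub>G\<^esub> x) \<otimes>\<^bsub>k\<^esub> kernel u x)"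
    unfolding kernel_def using assms
    by (subst cocycle_eq, simp, simp, simp, subst sweedler_comult_right[OF k.abelian_group_axioms cocycle_right_balanced])
      (auto intro!: collapse form_simps(1) form_zero)
  finally show ?thesis .
qed

text \<open>
  Laziness at \<open>(e\<^sub>u, e\<^sub>v)\<close> is an equality of two functions; the values at \<open>x\<close> are compared, with the
  comultiplication expanded by its right factor on one side and by its left factor on the other.
\<close>

lemma kernel_lazy:
  assumes "u \<in> carrier G" "v \<in> carrier G" "x \<in> carrier G"
  shows "kernel (u \<otimes>\<^bsub>G\<^esub> inv\<^bsub>G\<^esub> x) (v \<otimes>\<^bsub>G\<^esub> inv\<^bsub>G\<^esub> x) = kernel (inv\<^bsub>G\<^esub> x \<otimes>\<^bsub>G\<^esub> u) (inv\<^bsub>G\<^esub> x \<otimes>\<^bsub>G\<^esub> v)"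
proof -
  have collapse: "(\<Oplus>\<^bsub>H\<^esub>x\<in>carrier G. \<Oplus>\<^bsub>H\<^esub>y\<in>carrier G. a x y \<odot>\<^bsub>H\<^esub> (e x \<otimes>\<^bsub>H\<^esub> e y)) x = a x x"
    if a: "\<And>x y. x \<in> carrier G \<Longrightarrow> y \<in> carrier G \<Longrightarrow> a x y \<in> carrier k" for a
  proof -
    have "(\<Oplus>\<^bsub>H\<^esub>x\<in>carrier G. \<Oplus>\<^bsub>H\<^esub>y\<in>carrier G. a x y \<odot>\<^bsub>H\<^esub> (e x \<otimes>\<^bsub>H\<^esub> e y)) x =
      (\<Oplus>\<^bsub>k\<^esub>z\<in>carrier G. \<Oplus>\<^bsub>k\<^esub>y\<in>carrier G. (a z y \<odot>\<^bsub>H\<^esub> (e z \<otimes>\<^bsub>H\<^esub> e y)) x)"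
      using assms a by (simp add: finsum_apply fin H.finsum_closed Pi_def cong: k.finsum_cong_closed)
    also have "\<dots> = (\<Oplus>\<^bsub>k\<^esub>z\<in>carrier G. if z = x then a z z else \<zero>\<^bsub>k\<^esub>)"
    proof (rule k.finsum_cong_closed)
      fix z assume z: "z \<in> carrier G"
      have "(\<Oplus>\<^bsub>k\<^esub>y\<in>carrier G. (a z y \<odot>\<^bsub>H\<^esub> (e z \<otimes>\<^bsub>H\<^esub> e y)) x) =
        (\<Oplus>\<^bsub>k\<^esub>y\<in>carrier G. if y = x then (if z = x then a z y else \<zero>\<^bsub>k\<^esub>) else \<zero>\<^bsub>k\<^esub>)"
        using assms z a by (intro k.finsum_cong_closed) (auto simp: H_apply dirac_apply)
      also have "\<dots> = (if z = x then a z z else \<zero>\<^bsub>k\<^esub>)"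
        using assms z a by (subst finsum_delta) (auto simp: k.abelian_monoid_axioms)
      finally show "(\<Oplus>\<^bsub>k\<^esub>y\<in>carrier G. (a z y \<odot>\<^bsub>H\<^esub> (e z \<otimes>\<^bsub>H\<^esub> e y)) x) = (if z = x then a z z else \<zero>\<^bsub>k\<^esub>)" .
    qed (use a in auto)
    also have "\<dots> = a x x"
      using assms a by (intro finsum_delta) (auto simp: k.abelian_monoid_axioms)
    finally show ?thesis .
  qed
  have "sweedler H (\<lambda>x1 x2. sweedler H (\<lambda>y1 y2. \<sigma> x1 y1 \<odot>\<^bsub>H\<^esub> (x2 \<otimes>\<^bsub>H\<^esub> y2)) (comult H (e v))) (comult H (e u)) x =
      sweedler H (\<lambda>x1 x2. sweedler H (\<lambda>y1 y2. \<sigma> x2 y2 \<odot>\<^bsub>H\<^esub> (x1 \<otimes>\<^bsub>H\<^esub> y1)) (comult H (e v))) (comult H (e u)) x"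
    using lazy assms unfolding lazy_def by simp
  then show ?thesis
    unfolding kernel_def
    by (subst (asm) sweedler_comult_right[OF H.abelian_group_axioms lazy_balanced(1,2)],
        simp_all add: assms)
      (subst (asm) sweedler_comult_left[OF H.abelian_group_axioms lazy_balanced(3,4)],
        simp_all add: assms collapse form_simps)
qed

text \<open>
  The row sum at \<open>g\<close> is \<open>\<sigma>(e\<^sub>g, 1)\<close>. As an element of \<open>k[G]\<close>, the family \<open>f(g) = \<sigma>(e\<^sub>g, 1)\<close> has the
  left inverse \<open>g \<mapsto> \<tau>(e\<^sub>g, 1)\<close>, where \<open>\<tau>\<close> is the convolution inverse, and the cocycle identity at
  \<open>(e\<^sub>g, 1, 1)\<close> reads \<open>f f = \<sigma>(1, 1) f\<close>. Hence \<open>f\<close> is a multiple of the identity. The column sums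
  are treated in the same way with the cocycle identity at \<open>(1, 1, e\<^sub>g)\<close>.
\<close>

lemma kernel_sums:
  assumes g: "g \<in> carrier G"
  shows "(\<Oplus>\<^bsub>k\<^esub>h\<in>carrier G. kernel g h) = (if g = \<one>\<^bsub>G\<^esub> then norm_const else \<zero>\<^bsub>k\<^esub>)"
    and "(\<Oplus>\<^bsub>k\<^esub>h\<in>carrier G. kernel h g) = (if g = \<one>\<^bsub>G\<^esub> then norm_const else \<zero>\<^bsub>k\<^esub>)"
    and "norm_const \<in> Units k"
proof -
  from cocycle obtain \<tau> where tau: "bilinear_form k H \<tau>"
    and conv: "\<And>x y. x \<in> carrier H \<Longrightarrow> y \<in> carrier H \<Longrightarrow>
      convolution k H \<sigma> \<tau> x y = x \<one>\<^bsub>G\<^esub> \<otimes>\<^bsub>k\<^esub> y \<one>\<^bsub>G\<^esub>"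
      "\<And>x y. x \<in> carrier H \<Longrightarrow> y \<in> carrier H \<Longrightarrow>
      convolution k H \<tau> \<sigma> x y = x \<one>\<^bsub>G\<^esub> \<otimes>\<^bsub>k\<^esub> y \<one>\<^bsub>G\<^esub>"
    unfolding two_cocycle_def convolution_invertible_def fun_hopf_simps(8) by blast
  note cb = convolution_balanced[OF tau form] convolution_balanced[OF form tau]
  have "norm_const \<otimes>\<^bsub>k\<^esub> \<tau> \<one>\<^bsub>H\<^esub> \<one>\<^bsub>H\<^esub> = \<one>\<^bsub>k\<^esub>"
    using conv(1)[OF H.one_closed H.one_closed]
    unfolding convolution_def norm_const_def
    by (subst (asm) sweedler_comult_one[OF k.abelian_group_axioms cb(3,4)]) (simp_all add: H_apply)
  then show "norm_const \<in> Units k"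
    using bilinear_formD(1)[OF tau H.one_closed H.one_closed] k.m_comm[OF norm_const_closed]
    unfolding Units_def by force
  have "\<sigma> (e g) \<one>\<^bsub>H\<^esub> = (if g = \<one>\<^bsub>G\<^esub> then norm_const else \<zero>\<^bsub>k\<^esub>)"
  proof (rule quasi_idempotent_unit[where t = "\<lambda>g. \<tau> (e g) \<one>\<^bsub>H\<^esub>", OF _ _ _ _ _ g])
    fix g assume g: "g \<in> carrier G"
    show "(\<Oplus>\<^bsub>k\<^esub>x\<in>carrier G. \<tau> (e (g \<otimes>\<^bsub>G\<^esub> inv\<^bsub>G\<^esub> x)) \<one>\<^bsub>H\<^esub> \<otimes>\<^bsub>k\<^esub> \<sigma> (e x) \<one>\<^bsub>H\<^esub>) = (if g = \<one>\<^bsub>G\<^esub> then \<one>\<^bsub>k\<^esub> else \<zero>\<^bsub>k\<^esub>)"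
      using conv(2)[OF dirac_closed[OF g] H.one_closed] g
      unfolding convolution_def
      by (subst (asm) sweedler_comult_dirac_one[OF k.abelian_group_axioms cb(1,2)])
        (auto simp: H_apply dirac_apply)
    show "(\<Oplus>\<^bsub>k\<^esub>x\<in>carrier G. \<sigma> (e (g \<otimes>\<^bsub>G\<^esub> inv\<^bsub>G\<^esub> x)) \<one>\<^bsub>H\<^esub> \<otimes>\<^bsub>k\<^esub> \<sigma> (e x) \<one>\<^bsub>H\<^esub>) = norm_const \<otimes>\<^bsub>k\<^esub> \<sigma> (e g) \<one>\<^bsub>H\<^esub>"
      using cocycle_eq[OF dirac_closed[OF g] H.one_closed H.one_closed] g
      unfolding norm_const_def
      by (subst (asm) sweedler_comult_dirac_one[OF k.abelian_group_axioms cocycle_left_balanced], simp_all)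
        (subst (asm) sweedler_comult_one[OF k.abelian_group_axioms cocycle_right_balanced], simp_all add: form_simps cong: k.finsum_cong_closed)
  qed (simp_all add: form_simps bilinear_formD(1)[OF tau])
  moreover have "\<sigma> (e g) \<one>\<^bsub>H\<^esub> = (\<Oplus>\<^bsub>k\<^esub>h\<in>carrier G. kernel g h)"
    unfolding one_expand kernel_def
    by (rule additive_finsum[OF H.abelian_group_axioms k.abelian_group_axioms])
      (use g in \<open>simp_all add: form_simps fin\<close>)
  ultimately show "(\<Oplus>\<^bsub>k\<^esub>h\<in>carrier G. kernel g h) = (if g = \<one>\<^bsub>G\<^esub> then norm_const else \<zero>\<^bsub>k\<^esub>)"
    by simp
  have "\<sigma> \<one>\<^bsub>H\<^esub> (e g) = (if g = \<one>\<^bsub>G\<^esub> then norm_const else \<zero>\<^bsub>k\<^esub>)"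
  proof (rule quasi_idempotent_unit[where t = "\<lambda>g. \<tau> \<one>\<^bsub>H\<^esub> (e g)", OF _ _ _ _ _ g])
    fix g assume g: "g \<in> carrier G"
    show "(\<Oplus>\<^bsub>k\<^esub>x\<in>carrier G. \<tau> \<one>\<^bsub>H\<^esub> (e (g \<otimes>\<^bsub>G\<^esub> inv\<^bsub>G\<^esub> x)) \<otimes>\<^bsub>k\<^esub> \<sigma> \<one>\<^bsub>H\<^esub> (e x)) = (if g = \<one>\<^bsub>G\<^esub> then \<one>\<^bsub>k\<^esub> else \<zero>\<^bsub>k\<^esub>)"
      using conv(2)[OF H.one_closed dirac_closed[OF g]] g
      unfolding convolution_def
      by (subst (asm) sweedler_comult_one_dirac[OF k.abelian_group_axioms cb(1,2)])
        (auto simp: H_apply dirac_apply)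
    show "(\<Oplus>\<^bsub>k\<^esub>x\<in>carrier G. \<sigma> \<one>\<^bsub>H\<^esub> (e (g \<otimes>\<^bsub>G\<^esub> inv\<^bsub>G\<^esub> x)) \<otimes>\<^bsub>k\<^esub> \<sigma> \<one>\<^bsub>H\<^esub> (e x)) = norm_const \<otimes>\<^bsub>k\<^esub> \<sigma> \<one>\<^bsub>H\<^esub> (e g)"
      using cocycle_eq[OF H.one_closed H.one_closed dirac_closed[OF g]] g
      unfolding norm_const_def
      by (subst (asm) sweedler_comult_one_dirac[OF k.abelian_group_axioms cocycle_right_balanced], simp_all)
        (subst (asm) sweedler_comult_one[OF k.abelian_group_axioms cocycle_left_balanced], simp_all add: form_simps cong: k.finsum_cong_closed)
  qed (simp_all add: form_simps bilinear_formD(1)[OF tau])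
  moreover have "\<sigma> \<one>\<^bsub>H\<^esub> (e g) = (\<Oplus>\<^bsub>k\<^esub>h\<in>carrier G. kernel h g)"
    unfolding one_expand kernel_def
    by (rule additive_finsum[OF H.abelian_group_axioms k.abelian_group_axioms, where f = "\<lambda>x. \<sigma> x (e g)"])
      (use g in \<open>simp_all add: form_simps fin\<close>)
  ultimately show "(\<Oplus>\<^bsub>k\<^esub>h\<in>carrier G. kernel h g) = (if g = \<one>\<^bsub>G\<^esub> then norm_const else \<zero>\<^bsub>k\<^esub>)"
    by simp
qed

end

section \<open>Twisting a G-algebra\<close>

lemma (in abelian_monoid) finsum_rotate:
  assumes "finite I" "finite J" "finite K"
    and "\<And>i j l. i \<in> I \<Longrightarrow> j \<in> J \<Longrightarrow> l \<in> K \<Longrightarrow> f i j l \<in> carrier G"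
  shows "(\<Oplus>i\<in>I. \<Oplus>j\<in>J. \<Oplus>l\<in>K. f i j l) = (\<Oplus>j\<in>J. \<Oplus>l\<in>K. \<Oplus>i\<in>I. f i j l)"
proof -
  have "(\<Oplus>i\<in>I. \<Oplus>j\<in>J. \<Oplus>l\<in>K. f i j l) = (\<Oplus>j\<in>J. \<Oplus>i\<in>I. \<Oplus>l\<in>K. f i j l)"
    by (rule finsum_swap) (use assms in \<open>auto intro!: finsum_closed\<close>)
  also have "\<dots> = (\<Oplus>j\<in>J. \<Oplus>l\<in>K. \<Oplus>i\<in>I. f i j l)"
    by (rule finsum_cong_closed, rule finsum_swap) (use assms in \<open>auto intro!: finsum_closed\<close>)
  finally show ?thesis .
qed

lemma (in module) finsum_smult_rdistr:
  assumes "finite I" "\<And>i. i \<in> I \<Longrightarrow> r i \<in> carrier R" "x \<in> carrier M"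
  shows "(\<Oplus>\<^bsub>R\<^esub>i\<in>I. r i) \<odot>\<^bsub>M\<^esub> x = (\<Oplus>\<^bsub>M\<^esub>i\<in>I. r i \<odot>\<^bsub>M\<^esub> x)"
  by (rule additive_finsum[where f = "\<lambda>r. r \<odot>\<^bsub>M\<^esub> x"])
    (use assms in \<open>auto simp: smult_l_distr R.abelian_group_axioms M.abelian_group_axioms\<close>)

text \<open>
  The coaction \<open>\<rho>\<close> is a parameter, prescribed on the carrier only, so that the comultiplication of
  \<open>\<O>\<close> is an instance and the twisted algebra of functions is covered without a separate argument.
\<close>

locale cocycle_twist = lazy_cocycle k G \<sigma> + X: right_G_algebra k G A act
  for k :: "('k, 'm) ring_scheme" and G :: "('g, 'q) monoid_scheme"
    and \<sigma> :: "('g \<Rightarrow> 'k) \<Rightarrow> ('g \<Rightarrow> 'k) \<Rightarrow> 'k"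
    and A :: "('k, 'a, 'n) module_scheme" and act :: "'a \<Rightarrow> 'g \<Rightarrow> 'a" +
  fixes \<rho> :: "'a \<Rightarrow> (('g \<Rightarrow> 'k) \<times> 'a) list set"
  assumes coaction: "\<And>a. a \<in> carrier A \<Longrightarrow> \<rho> a = coaction k G A act a"
begin

sublocale HA: two_algebras k H A ..

abbreviation star (infixl "\<star>" 70) where "a \<star> b \<equiv> twist_mult \<sigma> A \<rho> a b"

lemma star_eq:
  assumes "a \<in> carrier A" "b \<in> carrier A"
  shows "a \<star> b = (\<Oplus>\<^bsub>A\<^esub>g\<in>carrier G. \<Oplus>\<^bsub>A\<^esub>h\<in>carrier G. kernel g h \<odot>\<^bsub>A\<^esub> (act a g \<otimes>\<^bsub>A\<^esub> act b h))"
proof -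
  have b: "balanced k H A A (\<lambda>y b0. \<sigma> x y \<odot>\<^bsub>A\<^esub> (a0 \<otimes>\<^bsub>A\<^esub> b0))"
    "balanced k H A A (\<lambda>y b0. \<sigma> y x \<odot>\<^bsub>A\<^esub> (b0 \<otimes>\<^bsub>A\<^esub> a0))"
    if "x \<in> carrier H" "a0 \<in> carrier A" for x a0
    by (rule balancedI; use that in \<open>simp add: form_simps k.m_ac X.A.l_distr X.A.r_distr
        X.A.smult_mult_left X.A.smult_mult_right X.A.smult_l_distr X.A.smult_r_distr flip: X.A.smult_assoc1\<close>)+
  show ?thesis
    unfolding twist_mult_def coaction[OF assms(1)] coaction[OF assms(2)] coaction_def kernel_def
    by (rule HA.sweedler_sweedler[OF X.A.abelian_group_axioms b]) (simp_all add: fin assms)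
qed

lemma act_star:
  assumes "a \<in> carrier A" "b \<in> carrier A" "x \<in> carrier G"
  shows "act (a \<star> b) x = (\<Oplus>\<^bsub>A\<^esub>g\<in>carrier G. \<Oplus>\<^bsub>A\<^esub>h\<in>carrier G.
    kernel (g \<otimes>\<^bsub>G\<^esub> inv\<^bsub>G\<^esub> x) (h \<otimes>\<^bsub>G\<^esub> inv\<^bsub>G\<^esub> x) \<odot>\<^bsub>A\<^esub> (act a g \<otimes>\<^bsub>A\<^esub> act b h))"
proof -
  let ?F = "\<lambda>g h. kernel (g \<otimes>\<^bsub>G\<^esub> inv\<^bsub>G\<^esub> x) (h \<otimes>\<^bsub>G\<^esub> inv\<^bsub>G\<^esub> x) \<odot>\<^bsub>A\<^esub> (act a g \<otimes>\<^bsub>A\<^esub> act b h)"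
  have [simp]: "g \<otimes>\<^bsub>G\<^esub> x \<otimes>\<^bsub>G\<^esub> inv\<^bsub>G\<^esub> x = g" if "g \<in> carrier G" for g
    using that assms(3) by (simp add: G.m_assoc)
  have "act (a \<star> b) x = (\<Oplus>\<^bsub>A\<^esub>g\<in>carrier G. act (\<Oplus>\<^bsub>A\<^esub>h\<in>carrier G. kernel g h \<odot>\<^bsub>A\<^esub> (act a g \<otimes>\<^bsub>A\<^esub> act b h)) x)"
    unfolding star_eq[OF assms(1,2)] using assms
    by (intro X.act_finsum fin X.A.finsum_closed) auto
  also have "\<dots> = (\<Oplus>\<^bsub>A\<^esub>g\<in>carrier G. \<Oplus>\<^bsub>A\<^esub>h\<in>carrier G. ?F (g \<otimes>\<^bsub>G\<^esub> x) (h \<otimes>\<^bsub>G\<^esub> x))"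
    using assms by (simp add: X.act_finsum fin X.act_smult X.act_times X.act_mult X.A.finsum_closed Pi_def
        cong: X.A.finsum_cong_closed)
  also have "\<dots> = (\<Oplus>\<^bsub>A\<^esub>g\<in>carrier G. \<Oplus>\<^bsub>A\<^esub>h\<in>carrier G. ?F (g \<otimes>\<^bsub>G\<^esub> x) h)"
    using assms by (intro X.A.finsum_cong_closed finsum_right_translate[where f = "?F (_ \<otimes>\<^bsub>G\<^esub> x)"]
      X.A.finsum_closed X.A.abelian_monoid_axioms) auto
  also have "\<dots> = (\<Oplus>\<^bsub>A\<^esub>g\<in>carrier G. \<Oplus>\<^bsub>A\<^esub>h\<in>carrier G. ?F g h)"
    using assms by (intro finsum_right_translate[where f = "\<lambda>g. \<Oplus>\<^bsub>A\<^esub>h\<in>carrier G. ?F g h"]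
      X.A.finsum_closed X.A.abelian_monoid_axioms) auto
  finally show ?thesis .
qed

lemma star_closed [simp]: "a \<in> carrier A \<Longrightarrow> b \<in> carrier A \<Longrightarrow> a \<star> b \<in> carrier A"
  by (simp add: star_eq X.A.finsum_closed Pi_def)

lemma star_add_left:
  "a \<in> carrier A \<Longrightarrow> b \<in> carrier A \<Longrightarrow> c \<in> carrier A \<Longrightarrow> (a \<oplus>\<^bsub>A\<^esub> b) \<star> c = a \<star> c \<oplus>\<^bsub>A\<^esub> b \<star> c"
  by (simp add: star_eq X.act_add X.A.l_distr X.A.smult_r_distr X.A.finsum_addf X.A.finsum_closed Pi_def
      cong: X.A.finsum_cong_closed)

lemma star_add_right:
  "a \<in> carrier A \<Longrightarrow> b \<in> carrier A \<Longrightarrow> c \<in> carrier A \<Longrightarrow> a \<star> (b \<oplus>\<^bsub>A\<^esub> c) = a \<star> b \<oplus>\<^bsub>A\<^esub> a \<star> c"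
  by (simp add: star_eq X.act_add X.A.r_distr X.A.smult_r_distr X.A.finsum_addf X.A.finsum_closed Pi_def
      cong: X.A.finsum_cong_closed)

lemma star_smult:
  assumes "r \<in> carrier k" "a \<in> carrier A" "b \<in> carrier A"
  shows "(r \<odot>\<^bsub>A\<^esub> a) \<star> b = r \<odot>\<^bsub>A\<^esub> (a \<star> b)" "a \<star> (r \<odot>\<^bsub>A\<^esub> b) = r \<odot>\<^bsub>A\<^esub> (a \<star> b)"
proof -
  have "kernel g h \<odot>\<^bsub>A\<^esub> (r \<odot>\<^bsub>A\<^esub> z) = r \<odot>\<^bsub>A\<^esub> (kernel g h \<odot>\<^bsub>A\<^esub> z)"
    if "g \<in> carrier G" "h \<in> carrier G" "z \<in> carrier A" for g h z
    using that assms by (simp add: k.m_comm flip: X.A.smult_assoc1)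
  with assms show "(r \<odot>\<^bsub>A\<^esub> a) \<star> b = r \<odot>\<^bsub>A\<^esub> (a \<star> b)" "a \<star> (r \<odot>\<^bsub>A\<^esub> b) = r \<odot>\<^bsub>A\<^esub> (a \<star> b)"
    by (simp_all add: star_eq X.act_smult X.A.smult_mult_left X.A.smult_mult_right X.A.finsum_smult_ldistr
        fin X.A.finsum_closed Pi_def cong: X.A.finsum_cong_closed)
qed

text \<open>
  Substituting \<open>u = g x\<close> and \<open>v = h x\<close>, both sides become sums over \<open>u, v, w\<close> of
  \<open>(a \<cdot> u)(b \<cdot> v)(c \<cdot> w)\<close>, with coefficients that are equal by the cocycle identity.
\<close>

lemma star_assoc:
  assumes a: "a \<in> carrier A" and b: "b \<in> carrier A" and c: "c \<in> carrier A"
  shows "(a \<star> b) \<star> c = a \<star> (b \<star> c)"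
proof -
  let ?Z = "\<lambda>u v w. act a u \<otimes>\<^bsub>A\<^esub> act b v \<otimes>\<^bsub>A\<^esub> act c w"
  let ?s = "\<lambda>u v x. kernel (u \<otimes>\<^bsub>G\<^esub> inv\<^bsub>G\<^esub> x) (v \<otimes>\<^bsub>G\<^esub> inv\<^bsub>G\<^esub> x)"
  note [simp] = a b c
  have left: "kernel x w \<odot>\<^bsub>A\<^esub> (act (a \<star> b) x \<otimes>\<^bsub>A\<^esub> act c w) =
      (\<Oplus>\<^bsub>A\<^esub>u\<in>carrier G. \<Oplus>\<^bsub>A\<^esub>v\<in>carrier G. (?s u v x \<otimes>\<^bsub>k\<^esub> kernel x w) \<odot>\<^bsub>A\<^esub> ?Z u v w)"
    if "x \<in> carrier G" "w \<in> carrier G" for x w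
    using that by (simp add: act_star X.A.finsum_ldistr X.A.finsum_smult_ldistr fin X.A.finsum_closed Pi_def
        X.A.smult_mult_left k.m_comm cong: X.A.finsum_cong_closed flip: X.A.smult_assoc1)
  have right: "kernel u x \<odot>\<^bsub>A\<^esub> (act a u \<otimes>\<^bsub>A\<^esub> act (b \<star> c) x) =
      (\<Oplus>\<^bsub>A\<^esub>v\<in>carrier G. \<Oplus>\<^bsub>A\<^esub>w\<in>carrier G. (?s v w x \<otimes>\<^bsub>k\<^esub> kernel u x) \<odot>\<^bsub>A\<^esub> ?Z u v w)"
    if "x \<in> carrier G" "u \<in> carrier G" for x u
    using that by (simp add: act_star X.A.finsum_rdistr X.A.finsum_smult_ldistr fin X.A.finsum_closed Pi_def
        X.A.smult_mult_right k.m_comm X.A.m_assoc cong: X.A.finsum_cong_closed flip: X.A.smult_assoc1)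
  have "(a \<star> b) \<star> c = (\<Oplus>\<^bsub>A\<^esub>x\<in>carrier G. \<Oplus>\<^bsub>A\<^esub>w\<in>carrier G. \<Oplus>\<^bsub>A\<^esub>u\<in>carrier G. \<Oplus>\<^bsub>A\<^esub>v\<in>carrier G.
      (?s u v x \<otimes>\<^bsub>k\<^esub> kernel x w) \<odot>\<^bsub>A\<^esub> ?Z u v w)"
    by (simp add: star_eq[of "a \<star> b"] left X.A.finsum_closed Pi_def cong: X.A.finsum_cong_closed)
  also have "\<dots> = (\<Oplus>\<^bsub>A\<^esub>w\<in>carrier G. \<Oplus>\<^bsub>A\<^esub>u\<in>carrier G. \<Oplus>\<^bsub>A\<^esub>x\<in>carrier G. \<Oplus>\<^bsub>A\<^esub>v\<in>carrier G.
      (?s u v x \<otimes>\<^bsub>k\<^esub> kernel x w) \<odot>\<^bsub>A\<^esub> ?Z u v w)"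
    by (rule X.A.finsum_rotate) (auto intro!: fin X.A.finsum_closed)
  also have "\<dots> = (\<Oplus>\<^bsub>A\<^esub>w\<in>carrier G. \<Oplus>\<^bsub>A\<^esub>u\<in>carrier G. \<Oplus>\<^bsub>A\<^esub>v\<in>carrier G. \<Oplus>\<^bsub>A\<^esub>x\<in>carrier G.
      (?s u v x \<otimes>\<^bsub>k\<^esub> kernel x w) \<odot>\<^bsub>A\<^esub> ?Z u v w)"
    by (intro X.A.finsum_cong_closed X.A.finsum_swap) (auto intro!: fin X.A.finsum_closed)
  also have "\<dots> = (\<Oplus>\<^bsub>A\<^esub>w\<in>carrier G. \<Oplus>\<^bsub>A\<^esub>u\<in>carrier G. \<Oplus>\<^bsub>A\<^esub>v\<in>carrier G. \<Oplus>\<^bsub>A\<^esub>x\<in>carrier G.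
      (?s v w x \<otimes>\<^bsub>k\<^esub> kernel u x) \<odot>\<^bsub>A\<^esub> ?Z u v w)"
  proof (rule X.A.finsum_cong_closed, rule X.A.finsum_cong_closed, rule X.A.finsum_cong_closed)
    fix w u v assume "u \<in> carrier G" "v \<in> carrier G" "w \<in> carrier G"
    then show "(\<Oplus>\<^bsub>A\<^esub>x\<in>carrier G. (?s u v x \<otimes>\<^bsub>k\<^esub> kernel x w) \<odot>\<^bsub>A\<^esub> ?Z u v w) =
      (\<Oplus>\<^bsub>A\<^esub>x\<in>carrier G. (?s v w x \<otimes>\<^bsub>k\<^esub> kernel u x) \<odot>\<^bsub>A\<^esub> ?Z u v w)"
      using kernel_cocycle[of u v w] by (simp add: fin flip: X.A.finsum_smult_rdistr)
  qed (auto intro!: X.A.finsum_closed)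
  also have "\<dots> = (\<Oplus>\<^bsub>A\<^esub>u\<in>carrier G. \<Oplus>\<^bsub>A\<^esub>v\<in>carrier G. \<Oplus>\<^bsub>A\<^esub>w\<in>carrier G. \<Oplus>\<^bsub>A\<^esub>x\<in>carrier G.
      (?s v w x \<otimes>\<^bsub>k\<^esub> kernel u x) \<odot>\<^bsub>A\<^esub> ?Z u v w)"
    by (rule X.A.finsum_rotate) (auto intro!: fin X.A.finsum_closed)
  also have "\<dots> = (\<Oplus>\<^bsub>A\<^esub>u\<in>carrier G. \<Oplus>\<^bsub>A\<^esub>x\<in>carrier G. \<Oplus>\<^bsub>A\<^esub>v\<in>carrier G. \<Oplus>\<^bsub>A\<^esub>w\<in>carrier G.
      (?s v w x \<otimes>\<^bsub>k\<^esub> kernel u x) \<odot>\<^bsub>A\<^esub> ?Z u v w)"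
    by (rule X.A.finsum_cong_closed, rule X.A.finsum_rotate[symmetric]) (auto intro!: fin X.A.finsum_closed)
  also have "\<dots> = a \<star> (b \<star> c)"
    by (simp add: star_eq[of a] right X.A.finsum_closed Pi_def cong: X.A.finsum_cong_closed)
  finally show ?thesis .
qed

text \<open>
  Two-cocycles need not be normalized: \<open>1 \<star> a = \<sigma>(1, 1) a\<close>.
\<close>

definition unit where "unit = inv\<^bsub>k\<^esub> norm_const \<odot>\<^bsub>A\<^esub> \<one>\<^bsub>A\<^esub>"

lemma norm_const_inv [simp]: "inv\<^bsub>k\<^esub> norm_const \<in> carrier k"
  by (rule k.Units_inv_closed[OF kernel_sums(3)[OF G.one_closed]])

lemma unit_closed [simp]: "unit \<in> carrier A"
  by (simp add: unit_def)

lemma act_unit: "g \<in> carrier G \<Longrightarrow> act unit g = unit"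
  by (simp add: unit_def X.act_smult X.act_unit)

lemma star_unit:
  assumes a: "a \<in> carrier A"
  shows "unit \<star> a = a" "a \<star> unit = a"
proof -
  note [simp] = a
  have delta: "(\<Oplus>\<^bsub>A\<^esub>h\<in>carrier G. (if h = \<one>\<^bsub>G\<^esub> then norm_const else \<zero>\<^bsub>k\<^esub>) \<odot>\<^bsub>A\<^esub> act a h) = norm_const \<odot>\<^bsub>A\<^esub> a"
  proof -
    have "(\<Oplus>\<^bsub>A\<^esub>h\<in>carrier G. (if h = \<one>\<^bsub>G\<^esub> then norm_const else \<zero>\<^bsub>k\<^esub>) \<odot>\<^bsub>A\<^esub> act a h) =
      (\<Oplus>\<^bsub>A\<^esub>h\<in>carrier G. if h = \<one>\<^bsub>G\<^esub> then norm_const \<odot>\<^bsub>A\<^esub> act a h else \<zero>\<^bsub>A\<^esub>)"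
      by (rule X.A.finsum_cong_closed) auto
    also have "\<dots> = norm_const \<odot>\<^bsub>A\<^esub> act a \<one>\<^bsub>G\<^esub>"
      by (rule finsum_delta) (auto simp: X.A.abelian_monoid_axioms)
    finally show ?thesis by (simp add: X.act_one)
  qed
  have cancel: "inv\<^bsub>k\<^esub> norm_const \<odot>\<^bsub>A\<^esub> (norm_const \<odot>\<^bsub>A\<^esub> a) = a"
    using k.Units_l_inv[OF kernel_sums(3)[OF G.one_closed]] by (simp flip: X.A.smult_assoc1)
  have "\<one>\<^bsub>A\<^esub> \<star> a = (\<Oplus>\<^bsub>A\<^esub>g\<in>carrier G. \<Oplus>\<^bsub>A\<^esub>h\<in>carrier G. kernel g h \<odot>\<^bsub>A\<^esub> act a h)"
    by (simp add: star_eq X.act_unit X.A.finsum_closed Pi_def cong: X.A.finsum_cong_closed)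
  also have "\<dots> = (\<Oplus>\<^bsub>A\<^esub>h\<in>carrier G. \<Oplus>\<^bsub>A\<^esub>g\<in>carrier G. kernel g h \<odot>\<^bsub>A\<^esub> act a h)"
    by (rule X.A.finsum_swap) (auto simp: fin)
  also have "\<dots> = (\<Oplus>\<^bsub>A\<^esub>h\<in>carrier G. (if h = \<one>\<^bsub>G\<^esub> then norm_const else \<zero>\<^bsub>k\<^esub>) \<odot>\<^bsub>A\<^esub> act a h)"
    by (rule X.A.finsum_cong_closed) (auto simp: fin kernel_sums(2) simp flip: X.A.finsum_smult_rdistr)
  finally have "\<one>\<^bsub>A\<^esub> \<star> a = norm_const \<odot>\<^bsub>A\<^esub> a" by (simp only: delta)
  then show "unit \<star> a = a"
    by (simp add: unit_def star_smult cancel)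
  have "a \<star> \<one>\<^bsub>A\<^esub> = (\<Oplus>\<^bsub>A\<^esub>g\<in>carrier G. \<Oplus>\<^bsub>A\<^esub>h\<in>carrier G. kernel g h \<odot>\<^bsub>A\<^esub> act a g)"
    by (simp add: star_eq X.act_unit X.A.finsum_closed Pi_def cong: X.A.finsum_cong_closed)
  also have "\<dots> = (\<Oplus>\<^bsub>A\<^esub>g\<in>carrier G. (if g = \<one>\<^bsub>G\<^esub> then norm_const else \<zero>\<^bsub>k\<^esub>) \<odot>\<^bsub>A\<^esub> act a g)"
    by (rule X.A.finsum_cong_closed) (auto simp: fin kernel_sums(1) simp flip: X.A.finsum_smult_rdistr)
  finally have "a \<star> \<one>\<^bsub>A\<^esub> = norm_const \<odot>\<^bsub>A\<^esub> a" by (simp only: delta)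
  then show "a \<star> unit = a"
    by (simp add: unit_def star_smult cancel)
qed

lemma twist_simps [simp]:
  "carrier (twist \<sigma> A \<rho>) = carrier A"
  "mult (twist \<sigma> A \<rho>) = twist_mult \<sigma> A \<rho>"
  "one (twist \<sigma> A \<rho>) = unit"
  "zero (twist \<sigma> A \<rho>) = zero A"
  "add (twist \<sigma> A \<rho>) = add A"
  "module.smult (twist \<sigma> A \<rho>) = module.smult A"
proof -
  have "(THE u. u \<in> carrier A \<and> (\<forall>a\<in>carrier A. u \<star> a = a \<and> a \<star> u = a)) = unit"
    by (rule the_equality) (auto simp: star_unit, metis star_unit(1) unit_closed)
  then show "one (twist \<sigma> A \<rho>) = unit"
    by (simp add: twist_def)
qed (simp_all add: twist_def)

lemma twist_assoc_algebra: "assoc_algebra k (twist \<sigma> A \<rho>)"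
  by (intro assoc_algebra.intro assoc_algebra_axioms.intro ringI monoidI moduleI; (rule abelian_groupI)?)
    (auto simp: k.cring_axioms star_assoc star_unit star_add_left star_add_right star_smult
      X.A.smult_l_distr X.A.smult_r_distr X.A.smult_assoc1 X.A.a_ac intro: X.A.l_neg X.A.a_inv_closed)

lemma twist_linear_on: "linear_on k (twist \<sigma> A \<rho>) (twist \<sigma> A \<rho>) f = linear_on k A A f"
  by (simp add: linear_on_def)

text \<open>
  Acting by \<open>x\<close> after multiplying translates both arguments of the matrix by \<open>x\<^sup>-\<^sup>1\<close> on the right, and
  acting before multiplying translates them on the left; laziness says that the results agree.
\<close>

lemma twist_right_G_algebra: "right_G_algebra k G (twist \<sigma> A \<rho>) act"
proof (rule right_G_algebraI)
  fix x a b assume x: "x \<in> carrier G" and "a \<in> carrier (twist \<sigma> A \<rho>)" "b \<in> carrier (twist \<sigma> A \<rho>)"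
  then have [simp]: "a \<in> carrier A" "b \<in> carrier A" by simp_all
  let ?F = "\<lambda>g h. kernel (inv\<^bsub>G\<^esub> x \<otimes>\<^bsub>G\<^esub> g) (inv\<^bsub>G\<^esub> x \<otimes>\<^bsub>G\<^esub> h) \<odot>\<^bsub>A\<^esub> (act a g \<otimes>\<^bsub>A\<^esub> act b h)"
  have [simp]: "inv\<^bsub>G\<^esub> x \<otimes>\<^bsub>G\<^esub> (x \<otimes>\<^bsub>G\<^esub> g) = g" if "g \<in> carrier G" for g
    using that x by (simp flip: G.m_assoc)
  have "act a x \<star> act b x = (\<Oplus>\<^bsub>A\<^esub>g\<in>carrier G. \<Oplus>\<^bsub>A\<^esub>h\<in>carrier G. ?F (x \<otimes>\<^bsub>G\<^esub> g) (x \<otimes>\<^bsub>G\<^esub> h))"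
    using x by (simp add: star_eq X.act_mult X.A.finsum_closed Pi_def cong: X.A.finsum_cong_closed)
  also have "\<dots> = (\<Oplus>\<^bsub>A\<^esub>g\<in>carrier G. \<Oplus>\<^bsub>A\<^esub>h\<in>carrier G. ?F (x \<otimes>\<^bsub>G\<^esub> g) h)"
    using x by (intro X.A.finsum_cong_closed finsum_left_translate[where f = "?F (x \<otimes>\<^bsub>G\<^esub> _)"]
      X.A.finsum_closed X.A.abelian_monoid_axioms) auto
  also have "\<dots> = (\<Oplus>\<^bsub>A\<^esub>g\<in>carrier G. \<Oplus>\<^bsub>A\<^esub>h\<in>carrier G. ?F g h)"
    using x by (intro finsum_left_translate[where f = "\<lambda>g. \<Oplus>\<^bsub>A\<^esub>h\<in>carrier G. ?F g h"]
      X.A.finsum_closed X.A.abelian_monoid_axioms) auto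
  also have "\<dots> = act (a \<star> b) x"
    using x by (simp add: act_star kernel_lazy X.A.finsum_closed Pi_def cong: X.A.finsum_cong_closed)
  finally show "act (a \<otimes>\<^bsub>twist \<sigma> A \<rho>\<^esub> b) x = act a x \<otimes>\<^bsub>twist \<sigma> A \<rho>\<^esub> act b x" by simp
qed (simp_all add: twist_assoc_algebra G.group_axioms twist_linear_on X.linear_on_act act_unit X.act_one X.act_mult)

text \<open>
  The twisted product is built from the original product and the action \<open>act\<close> alone, so every
  automorphism of the algebra commuting with \<open>act\<close> is an automorphism of the twist. For
  \<open>\<^sub>\<sigma>\<O>\<close> this applies to the right translations, which commute with the left ones.
\<close>

lemma twist_commuting_right_G_algebra:
  assumes "right_G_algebra k G A act'"
    and comm: "\<And>a g h. a \<in> carrier A \<Longrightarrow> g \<in> carrier G \<Longrightarrow> h \<in> carrier G \<Longrightarrow> act (act' a h) g = act' (act a g) h"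
  shows "right_G_algebra k G (twist \<sigma> A \<rho>) act'"
proof -
  interpret Y: right_G_algebra k G A act' by fact
  show ?thesis
  proof (rule right_G_algebraI)
    fix x a b assume "x \<in> carrier G" "a \<in> carrier (twist \<sigma> A \<rho>)" "b \<in> carrier (twist \<sigma> A \<rho>)"
    then show "act' (a \<otimes>\<^bsub>twist \<sigma> A \<rho>\<^esub> b) x = act' a x \<otimes>\<^bsub>twist \<sigma> A \<rho>\<^esub> act' b x"
      by (simp add: star_eq comm Y.act_finsum fin Y.act_smult Y.act_times X.A.finsum_closed Pi_def
          cong: X.A.finsum_cong_closed)
  next
    fix x assume "x \<in> carrier G"
    then show "act' \<one>\<^bsub>twist \<sigma> A \<rho>\<^esub> x = \<one>\<^bsub>twist \<sigma> A \<rho>\<^esub>"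
      by (simp add: unit_def Y.act_smult Y.act_unit)
  qed (simp_all add: twist_assoc_algebra G.group_axioms twist_linear_on Y.linear_on_act Y.act_one Y.act_mult)
qed

end

section \<open>Evaluation at the identity element\<close>

lemma (in lazy_cocycle) twisted_fun_cocycle_twist:
  "cocycle_twist k G \<sigma> H (\<lambda>u g. translate_left G g u) (comult H)"
proof -
  interpret L: right_G_algebra k G H "\<lambda>u g. translate_left G g u"
    by (rule left_translation)
  show ?thesis
    by unfold_locales (simp add: comult_left coaction_def)
qed

context cocycle_twist
begin

interpretation TF: cocycle_twist k G \<sigma> H "\<lambda>u g. translate_left G g u" "comult H"
  by (rule twisted_fun_cocycle_twist)

abbreviation TO where "TO \<equiv> twisted_fun k G \<sigma>"

lemma TO_simps [simp]:
  "carrier TO = carrier H" "zero TO = zero H" "add TO = add H" "module.smult TO = module.smult H"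
  by (simp_all add: twisted_fun_def)

lemma TO_finsum: "finsum TO = finsum H"
  by (simp add: finsum_def)

lemma TO_left_translation: "right_G_algebra k G TO (\<lambda>u g. translate_left G g u)"
  unfolding twisted_fun_def by (rule TF.twist_right_G_algebra)

lemma TO_right_translation: "right_G_algebra k G TO (\<lambda>u g. translate_right G g u)"
  unfolding twisted_fun_def
  by (rule TF.twist_commuting_right_G_algebra[OF right_translation]) (simp add: translations_commute)

lemma TO_one_apply: "\<one>\<^bsub>TO\<^esub> \<one>\<^bsub>G\<^esub> = inv\<^bsub>k\<^esub> norm_const"
  by (simp add: twisted_fun_def TF.unit_def H_apply)

lemma TO_mult_apply:
  assumes "u \<in> carrier H" "v \<in> carrier H" "x \<in> carrier G"
  shows "(u \<otimes>\<^bsub>TO\<^esub> v) x =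
    (\<Oplus>\<^bsub>k\<^esub>g\<in>carrier G. \<Oplus>\<^bsub>k\<^esub>h\<in>carrier G. kernel g h \<otimes>\<^bsub>k\<^esub> (u (g \<otimes>\<^bsub>G\<^esub> x) \<otimes>\<^bsub>k\<^esub> v (h \<otimes>\<^bsub>G\<^esub> x)))"
  using assms
  by (simp add: twisted_fun_def TF.star_eq finsum_apply fin H.finsum_closed Pi_def H_apply translate_left_apply
      cong: k.finsum_cong_closed)

interpretation TOL: right_G_algebra k G TO "\<lambda>u g. translate_left G g u"
  by (rule TO_left_translation)

interpretation TOR: right_G_algebra k G TO "\<lambda>u g. translate_right G g u"
  by (rule TO_right_translation)

interpretation OA: two_algebras k TO A ..

abbreviation T where "T \<equiv> tensor k TO A"
abbreviation diag where "diag t h \<equiv> tensor_map k TO A (translate_right G h) (\<lambda>a. act a h) t"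
abbreviation left where "left t h \<equiv> tensor_map k TO A (translate_left G h) (\<lambda>a. a) t"
text \<open>
  The value at \<open>x\<close> of a tensor, regarded as a function from \<open>G\<close> to \<open>A\<close>.
\<close>

definition eval where "eval x t = sweedler A (\<lambda>u a. u x \<odot>\<^bsub>A\<^esub> a) t"

lemma diag_right_G_algebra: "right_G_algebra k G T diag"
  by (rule OA.tensor_right_G_algebra[OF TO_right_translation X.right_G_algebra_axioms])

lemma left_right_G_algebra: "right_G_algebra k G T left"
  by (rule OA.tensor_right_G_algebra[OF TO_left_translation trivial_right_G_algebra])
    (rule X.A.assoc_algebra_axioms G.group_axioms)+

lemma diag_left_commute:
  assumes "t \<in> carrier T" "g \<in> carrier G" "h \<in> carrier G"
  shows "diag (left t h) g = left (diag t g) h"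
proof -
  have l: "linear_on k TO TO (\<lambda>u. translate_left G h (translate_right G g u))"
    using TOL.linear_on_act[OF assms(3)] TOR.linear_on_act[OF assms(2)] by (simp add: linear_on_def)
  note lin = TOL.linear_on_act[OF assms(3)] TOR.linear_on_act[OF assms(2)] X.linear_on_act[OF assms(2)] linear_on_id
  have "diag (left t h) g = tensor_map k TO A (\<lambda>u. translate_right G g (translate_left G h u)) (\<lambda>a. act a g) t"
    by (rule OA.tensor_map_comp[OF lin(2,3) lin(1,4) assms(1)])
  also have "\<dots> = tensor_map k TO A (\<lambda>u. translate_left G h (translate_right G g u)) (\<lambda>a. act a g) t"
    by (rule OA.tensor_map_cong) (use assms in \<open>simp_all add: translations_commute l lin\<close>)
  also have "\<dots> = left (diag t g) h"
    by (rule OA.tensor_map_comp[OF lin(1,4) lin(2,3) assms(1), symmetric])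
  finally show ?thesis .
qed

lemma invariants_left_right_G_algebra: "right_G_algebra k G (invariants T G diag) left"
  by (rule invariants_right_G_algebra[OF diag_right_G_algebra left_right_G_algebra diag_left_commute])

lemma eval_balanced: "x \<in> carrier G \<Longrightarrow> balanced k TO A A (\<lambda>u a. u x \<odot>\<^bsub>A\<^esub> a)"
  by (rule balancedI)
    (simp_all add: H_apply k.m_comm X.A.smult_l_distr X.A.smult_r_distr flip: X.A.smult_assoc1)

lemma eval_simps:
  assumes "x \<in> carrier G"
  shows "eval x \<zero>\<^bsub>T\<^esub> = \<zero>\<^bsub>A\<^esub>"
    and "u \<in> carrier H \<Longrightarrow> a \<in> carrier A \<Longrightarrow> eval x (OA.pure u a) = u x \<odot>\<^bsub>A\<^esub> a"
    and "t \<in> carrier T \<Longrightarrow> eval x t \<in> carrier A"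
    and "s \<in> carrier T \<Longrightarrow> t \<in> carrier T \<Longrightarrow> eval x (s \<oplus>\<^bsub>T\<^esub> t) = eval x s \<oplus>\<^bsub>A\<^esub> eval x t"
  using OA.sweedler_zero[OF X.A.abelian_group_axioms eval_balanced[OF assms]]
    OA.sweedler_pure[OF X.A.abelian_group_axioms eval_balanced[OF assms]]
    OA.sweedler_closed[OF X.A.abelian_group_axioms eval_balanced[OF assms]]
    OA.sweedler_add[OF X.A.abelian_group_axioms eval_balanced[OF assms]]
  by (simp_all add: eval_def)

lemma eval_smult:
  assumes "x \<in> carrier G" "r \<in> carrier k" "t \<in> carrier T"
  shows "eval x (r \<odot>\<^bsub>T\<^esub> t) = r \<odot>\<^bsub>A\<^esub> eval x t"
  using assms(3)
  by (induction rule: OA.tensor_induct)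
    (use assms(1,2) in \<open>simp_all add: eval_simps OA.smult_zero_T OA.smult_add_T OA.smult_closed_T OA.smult_pure
      X.A.smult_r_distr X.A.smult_assoc1 H_apply\<close>)

lemma eval_diag:
  assumes "x \<in> carrier G" "h \<in> carrier G" "t \<in> carrier T"
  shows "eval x (diag t h) = act (eval (x \<otimes>\<^bsub>G\<^esub> inv\<^bsub>G\<^esub> h) t) h"
proof -
  interpret D: right_G_algebra k G T diag by (rule diag_right_G_algebra)
  show ?thesis
    using assms(3)
  proof (induction rule: OA.tensor_induct)
    case (pure u a)
    with assms show ?case
      by (simp add: OA.tensor_map_pure[OF TOR.linear_on_act X.linear_on_act] eval_simps X.act_smult translate_right_apply)
  qed (use assms in \<open>simp_all add: D.act_zero D.act_add D.act_closed eval_simps X.act_add X.act_zero\<close>)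
qed

lemma eval_left:
  assumes "x \<in> carrier G" "h \<in> carrier G" "t \<in> carrier T"
  shows "eval x (left t h) = eval (h \<otimes>\<^bsub>G\<^esub> x) t"
proof -
  interpret D: right_G_algebra k G T left by (rule left_right_G_algebra)
  show ?thesis
    using assms(3)
  proof (induction rule: OA.tensor_induct)
    case (pure u a)
    with assms show ?case
      by (simp add: OA.tensor_map_pure[OF TOL.linear_on_act linear_on_id] eval_simps translate_left_apply)
  qed (use assms in \<open>simp_all add: D.act_zero D.act_add D.act_closed eval_simps\<close>)
qed

text \<open>
  Both sides are biadditive in \<open>s\<close> and \<open>t\<close>, so pure tensors suffice; there the formula is the one for
  the product of \<open>\<^sub>\<sigma>\<O>\<close>.
\<close>

lemma eval_mult:
  assumes x: "x \<in> carrier G" and s: "s \<in> carrier T" and t: "t \<in> carrier T"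
  shows "eval x (s \<otimes>\<^bsub>T\<^esub> t) = (\<Oplus>\<^bsub>A\<^esub>g\<in>carrier G. \<Oplus>\<^bsub>A\<^esub>h\<in>carrier G.
    kernel g h \<odot>\<^bsub>A\<^esub> (eval (g \<otimes>\<^bsub>G\<^esub> x) s \<otimes>\<^bsub>A\<^esub> eval (h \<otimes>\<^bsub>G\<^esub> x) t))"
proof -
  note [simp] = x
  note sums = X.A.finsum_addf X.A.finsum_closed Pi_def X.A.smult_r_distr X.A.l_distr X.A.r_distr
  have p: "eval x (OA.pure u a \<otimes>\<^bsub>T\<^esub> t) = (\<Oplus>\<^bsub>A\<^esub>g\<in>carrier G. \<Oplus>\<^bsub>A\<^esub>h\<in>carrier G.
    kernel g h \<odot>\<^bsub>A\<^esub> (eval (g \<otimes>\<^bsub>G\<^esub> x) (OA.pure u a) \<otimes>\<^bsub>A\<^esub> eval (h \<otimes>\<^bsub>G\<^esub> x) t))"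
    if u: "u \<in> carrier H" "a \<in> carrier A" for u a
    using t
  proof (induction rule: OA.tensor_induct)
    case zero
    show ?case using u by (simp add: OA.mult_T eval_simps X.A.finsum_zero cong: X.A.finsum_cong_closed)
  next
    case (pure v b)
    then have v: "v \<in> carrier H" "b \<in> carrier A" by simp_all
    have smult: "(r \<odot>\<^bsub>A\<^esub> a) \<otimes>\<^bsub>A\<^esub> (s \<odot>\<^bsub>A\<^esub> b) = r \<odot>\<^bsub>A\<^esub> (s \<odot>\<^bsub>A\<^esub> (a \<otimes>\<^bsub>A\<^esub> b))"
      if "r \<in> carrier k" "s \<in> carrier k" for r s
      using that u v by (subst X.A.smult_mult_left) (simp_all add: X.A.smult_mult_right)
    have "eval x (OA.pure u a \<otimes>\<^bsub>T\<^esub> OA.pure v b) = (u \<otimes>\<^bsub>TO\<^esub> v) x \<odot>\<^bsub>A\<^esub> (a \<otimes>\<^bsub>A\<^esub> b)"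
      using u v TOL.A.m_closed[of u v] by (simp add: OA.mult_pure eval_simps)
    also have "\<dots> = (\<Oplus>\<^bsub>A\<^esub>g\<in>carrier G. \<Oplus>\<^bsub>A\<^esub>h\<in>carrier G.
      (kernel g h \<otimes>\<^bsub>k\<^esub> (u (g \<otimes>\<^bsub>G\<^esub> x) \<otimes>\<^bsub>k\<^esub> v (h \<otimes>\<^bsub>G\<^esub> x))) \<odot>\<^bsub>A\<^esub> (a \<otimes>\<^bsub>A\<^esub> b))"
      using u v by (simp add: TO_mult_apply X.A.finsum_smult_rdistr fin k.finsum_closed X.A.finsum_closed Pi_def
          cong: X.A.finsum_cong_closed)
    also have "\<dots> = (\<Oplus>\<^bsub>A\<^esub>g\<in>carrier G. \<Oplus>\<^bsub>A\<^esub>h\<in>carrier G.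
      kernel g h \<odot>\<^bsub>A\<^esub> (eval (g \<otimes>\<^bsub>G\<^esub> x) (OA.pure u a) \<otimes>\<^bsub>A\<^esub> eval (h \<otimes>\<^bsub>G\<^esub> x) (OA.pure v b)))"
      using u v by (simp add: eval_simps smult X.A.smult_assoc1 X.A.finsum_closed Pi_def cong: X.A.finsum_cong_closed)
    finally show ?case .
  next
    case (add t t')
    then show ?case using u by (simp add: OA.mult_T eval_simps sums cong: X.A.finsum_cong_closed)
  qed
  show ?thesis
    using s
  proof (induction rule: OA.tensor_induct)
    case zero
    show ?case using t by (simp add: OA.mult_T eval_simps X.A.finsum_zero cong: X.A.finsum_cong_closed)
  next
    case (pure u a)
    then show ?case by (intro p) simp_all
  next
    case (add s s')
    then show ?case using t by (simp add: OA.mult_T eval_simps sums cong: X.A.finsum_cong_closed)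
  qed
qed

lemma eval_expand:
  assumes "t \<in> carrier T"
  shows "t = (\<Oplus>\<^bsub>T\<^esub>g\<in>carrier G. OA.pure (e g) (eval g t))"
  using assms
proof (induction rule: OA.tensor_induct)
  case zero
  have "OA.pure (e g) \<zero>\<^bsub>A\<^esub> = \<zero>\<^bsub>T\<^esub>" if "g \<in> carrier G" for g
    using balanced_zero_right[OF X.A.abelian_group_axioms OA.tensor_abelian_group OA.balanced_pure] that by simp
  then show ?case by (simp add: eval_simps OA.T.finsum_zero cong: OA.T.finsum_cong_closed)
next
  case (pure u a)
  then have u: "u \<in> carrier H" "a \<in> carrier A" by simp_all
  have "OA.pure u a = OA.pure (\<Oplus>\<^bsub>TO\<^esub>g\<in>carrier G. u g \<odot>\<^bsub>TO\<^esub> e g) a"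
    using fun_expand[OF u(1)] by (simp add: TO_finsum)
  also have "\<dots> = (\<Oplus>\<^bsub>T\<^esub>g\<in>carrier G. OA.pure (u g \<odot>\<^bsub>TO\<^esub> e g) a)"
    using u by (intro balanced_finsum_left[OF _ _ OA.balanced_pure] fin TOL.A.abelian_group_axioms
        OA.tensor_abelian_group) simp_all
  also have "\<dots> = (\<Oplus>\<^bsub>T\<^esub>g\<in>carrier G. OA.pure (e g) (eval g (OA.pure u a)))"
    using u by (intro OA.T.finsum_cong_closed)
      (simp_all add: eval_simps balancedD(4)[OF OA.balanced_pure, simplified])
  finally show ?case .
next
  case (add s t)
  have "(\<Oplus>\<^bsub>T\<^esub>g\<in>carrier G. OA.pure (e g) (eval g (s \<oplus>\<^bsub>T\<^esub> t))) =
    (\<Oplus>\<^bsub>T\<^esub>g\<in>carrier G. OA.pure (e g) (eval g s) \<oplus>\<^bsub>T\<^esub> OA.pure (e g) (eval g t))"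
    using add(1,2) by (intro OA.T.finsum_cong_closed) (simp_all add: eval_simps balancedD(3)[OF OA.balanced_pure])
  also have "\<dots> = (\<Oplus>\<^bsub>T\<^esub>g\<in>carrier G. OA.pure (e g) (eval g s)) \<oplus>\<^bsub>T\<^esub> (\<Oplus>\<^bsub>T\<^esub>g\<in>carrier G. OA.pure (e g) (eval g t))"
    using add(1,2) by (intro OA.T.finsum_addf) (simp_all add: eval_simps)
  finally show ?case using add(3,4) by simp
qed

text \<open>
  This is the coaction on \<open>a\<close>, formed in the tensor product with \<open>\<^sub>\<sigma>\<O>\<close>.
\<close>

definition orbit_tensor where "orbit_tensor a = (\<Oplus>\<^bsub>T\<^esub>g\<in>carrier G. OA.pure (e g) (act a g))"

lemma orbit_tensor_invariant:
  assumes "a \<in> carrier A"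
  shows "orbit_tensor a \<in> carrier (invariants T G diag)"
proof -
  interpret D: right_G_algebra k G T diag by (rule diag_right_G_algebra)
  have c: "orbit_tensor a \<in> carrier T"
    unfolding orbit_tensor_def using assms by (intro OA.T.finsum_closed) auto
  have "diag (orbit_tensor a) h = orbit_tensor a" if h: "h \<in> carrier G" for h
  proof -
    have "diag (orbit_tensor a) h = (\<Oplus>\<^bsub>T\<^esub>g\<in>carrier G. diag (OA.pure (e g) (act a g)) h)"
      unfolding orbit_tensor_def using assms h by (intro D.act_finsum fin) simp_all
    also have "\<dots> = (\<Oplus>\<^bsub>T\<^esub>g\<in>carrier G. OA.pure (e (g \<otimes>\<^bsub>G\<^esub> h)) (act a (g \<otimes>\<^bsub>G\<^esub> h)))"
      using assms h by (intro OA.T.finsum_cong_closed)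
        (simp_all add: OA.tensor_map_pure[OF TOR.linear_on_act X.linear_on_act] translate_right_dirac
          G.group_axioms X.act_mult)
    also have "\<dots> = orbit_tensor a"
      unfolding orbit_tensor_def using assms h
      by (intro finsum_right_translate[where f = "\<lambda>g. OA.pure (e g) (act a g)"] OA.T.abelian_monoid_axioms) simp_all
    finally show ?thesis .
  qed
  with c show ?thesis by (simp add: invariants_def)
qed

lemma eval_orbit_tensor:
  assumes "a \<in> carrier A"
  shows "eval \<one>\<^bsub>G\<^esub> (orbit_tensor a) = a"
proof -
  have "eval \<one>\<^bsub>G\<^esub> (orbit_tensor a) = (\<Oplus>\<^bsub>A\<^esub>g\<in>carrier G. eval \<one>\<^bsub>G\<^esub> (OA.pure (e g) (act a g)))"
    unfolding orbit_tensor_def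
    by (rule additive_finsum[OF OA.tensor_abelian_group X.A.abelian_group_axioms])
      (use assms in \<open>simp_all add: eval_simps fin\<close>)
  also have "\<dots> = (\<Oplus>\<^bsub>A\<^esub>g\<in>carrier G. if g = \<one>\<^bsub>G\<^esub> then act a g else \<zero>\<^bsub>A\<^esub>)"
    using assms by (intro X.A.finsum_cong_closed) (auto simp: eval_simps dirac_apply)
  also have "\<dots> = act a \<one>\<^bsub>G\<^esub>"
    using assms by (intro finsum_delta) (auto simp: X.A.abelian_monoid_axioms)
  finally show ?thesis using assms by (simp add: X.act_one)
qed

text \<open>
  Invariance under \<open>g\<close> itself, evaluated at \<open>g\<close>, already expresses \<open>t(g)\<close> through \<open>t(1)\<close>.
\<close>

lemma eval_invariant:
  assumes "t \<in> carrier (invariants T G diag)" "g \<in> carrier G"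
  shows "eval g t = act (eval \<one>\<^bsub>G\<^esub> t) g"
proof -
  have t: "t \<in> carrier T" "diag t g = t"
    using assms by (auto simp: invariants_def)
  show ?thesis
    using eval_diag[OF assms(2) assms(2) t(1)] assms(2) by (simp add: t(2))
qed

lemma orbit_tensor_eval:
  assumes "t \<in> carrier (invariants T G diag)"
  shows "orbit_tensor (eval \<one>\<^bsub>G\<^esub> t) = t"
proof -
  have t: "t \<in> carrier T" using assms by (auto simp: invariants_def)
  have "orbit_tensor (eval \<one>\<^bsub>G\<^esub> t) = (\<Oplus>\<^bsub>T\<^esub>g\<in>carrier G. OA.pure (e g) (eval g t))"
    unfolding orbit_tensor_def using assms t
    by (intro OA.T.finsum_cong_closed) (simp_all add: eval_simps flip: eval_invariant)
  with eval_expand[OF t] show ?thesis by simp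
qed

text \<open>
  The inverse map is \<open>orbit_tensor\<close>. The unit is sent to the unit because the unit of \<open>\<^sub>\<sigma>\<O>\<close> is
  the constant function \<open>\<sigma>(1, 1)\<^sup>-\<^sup>1\<close>.
\<close>

lemma eval_one_iso: "eval \<one>\<^bsub>G\<^esub> \<in> G_algebra_iso k G (invariants T G diag) left (twist \<sigma> A \<rho>) act"
proof -
  have inv: "t \<in> carrier T" if "t \<in> carrier (invariants T G diag)" for t
    using that by (auto simp: invariants_def)
  have ops: "mult (invariants T G diag) = mult T" "add (invariants T G diag) = add T"
    "one (invariants T G diag) = one T" "module.smult (invariants T G diag) = module.smult T"
    by (simp_all add: invariants_def)
  have hom: "eval \<one>\<^bsub>G\<^esub> \<in> ring_hom (invariants T G diag) (twist \<sigma> A \<rho>)"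
  proof (rule ring_hom_memI)
    fix s t assume st: "s \<in> carrier (invariants T G diag)" "t \<in> carrier (invariants T G diag)"
    then show "eval \<one>\<^bsub>G\<^esub> (s \<otimes>\<^bsub>invariants T G diag\<^esub> t) = eval \<one>\<^bsub>G\<^esub> s \<otimes>\<^bsub>twist \<sigma> A \<rho>\<^esub> eval \<one>\<^bsub>G\<^esub> t"
      by (simp add: ops eval_mult inv eval_simps star_eq X.A.finsum_closed Pi_def
          cong: X.A.finsum_cong_closed flip: eval_invariant)
    show "eval \<one>\<^bsub>G\<^esub> (s \<oplus>\<^bsub>invariants T G diag\<^esub> t) = eval \<one>\<^bsub>G\<^esub> s \<oplus>\<^bsub>twist \<sigma> A \<rho>\<^esub> eval \<one>\<^bsub>G\<^esub> t"
      using st by (simp add: ops eval_simps inv)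
  next
    have "\<one>\<^bsub>TO\<^esub> \<in> carrier H" using TOL.A.one_closed by simp
    then show "eval \<one>\<^bsub>G\<^esub> \<one>\<^bsub>invariants T G diag\<^esub> = \<one>\<^bsub>twist \<sigma> A \<rho>\<^esub>"
      by (simp add: ops OA.one_T eval_simps TO_one_apply unit_def)
  qed (simp add: eval_simps inv)
  have "bij_betw (eval \<one>\<^bsub>G\<^esub>) (carrier (invariants T G diag)) (carrier (twist \<sigma> A \<rho>))"
    by (rule bij_betw_byWitness[where f' = orbit_tensor])
      (auto simp: orbit_tensor_eval eval_orbit_tensor orbit_tensor_invariant eval_simps inv)
  with hom show ?thesis
    by (simp add: G_algebra_iso_def algebra_iso_def ring_iso_def ops inv eval_smult eval_left flip: eval_invariant)
qed

end

theorem mainTheorem7: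
  fixes k :: "('k, 'm) ring_scheme"
    and G :: "('g, 'q) monoid_scheme"
    and A :: "('k, 'a, 'n) module_scheme"
    and act :: "'a \<Rightarrow> 'g \<Rightarrow> 'a"
    and \<sigma> :: "('g \<Rightarrow> 'k) \<Rightarrow> ('g \<Rightarrow> 'k) \<Rightarrow> 'k"
  assumes "cring k" and "\<one>\<^bsub>k\<^esub> \<noteq> \<zero>\<^bsub>k\<^esub>"
    and "group G" and "finite (carrier G)"
    and "two_cocycle k (fun_hopf k G) \<sigma>" and "lazy k (fun_hopf k G) \<sigma>"
    and "right_G_algebra k G A act"
  defines "T \<equiv> tensor k (twisted_fun k G \<sigma>) A"
    and "diag \<equiv> (\<lambda>t h. tensor_map k (twisted_fun k G \<sigma>) A (translate_right G h) (\<lambda>a. act a h) t)"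
    and "left \<equiv> (\<lambda>t h. tensor_map k (twisted_fun k G \<sigma>) A (translate_left G h) (\<lambda>a. a) t)"
  shows "right_G_algebra k G T diag \<and>
    right_G_algebra k G (invariants T G diag) left \<and>
    right_G_algebra k G (twist \<sigma> A (coaction k G A act)) act \<and>
    (\<exists>f. f \<in> G_algebra_iso k G (invariants T G diag) left (twist \<sigma> A (coaction k G A act)) act)"
proof -
  interpret k: cring k by fact
  interpret G: group G by fact
  interpret X: right_G_algebra k G A act by fact
  interpret cocycle_twist k G \<sigma> A act "coaction k G A act"
    by unfold_locales (use assms in auto)
  show ?thesis
    unfolding T_def diag_def left_def
    using diag_right_G_algebra invariants_left_right_G_algebra twist_right_G_algebra eval_one_iso by blast
qed

end
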